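(* Let $\Omega=\{(A_1,A_2)\in(\mathbb{R}^{2\times2})^2 : \sigma(A_1)\subset\mathbb{C}\setminus\mathbb{R}, \text{ or } (\sigma(A_1)\subset\mathbb{R} \text{ and } \#\sigma(A_1)=2)\}$, where $\sigma$ denotes the spectrum. Let $P_0,P_1,P_2$ be three totally-real planes in $\mathbb{C}^2$ containing $0$, with $P_0\cap P_j=\{(0,0)\}$ for $j=1,2$, let $g$ be a $\mathbb{C}$-linear isomorphism of $\mathbb{C}^2$ and $A_1,A_2\in\mathbb{R}^{2\times 2}$ with $g(P_0)=\mathbb{R}^2$, $g(P_j)=(A_j+i\mathbb{I})\mathbb{R}^2$ ($j=1,2$), and assume $(A_1,A_2)\in\Omega$. Then there is $T\in GL(2,\mathbb{R})$ with $$TA_1T^{-1}=\begin{pmatrix}\lambda_1&0\\0&\lambda_2\end{pmatrix}\ \text{ or }\ \begin{pmatrix}s&-t\\t&s\end{pmatrix},\qquad \lambda_1\ne\lambda_2\in\mathbb{R},\ s\in\mathbb{R},\ t\in\mathbb{R}\setminus\{0\}, \quad (\ast)$$ and we write $\mathscr{A}_1(T)=TA_1T^{-1}$, $\mathscr{A}_2(T)=TA_2T^{-1}$. Assume further that the pairwise unions of $P_0,P_1,P_2$ are locally polynomially convex at $0$. (i) Suppose $\sigma(A_1)\subset\mathbb{R}$ and $\#\sigma(A_1)=2$. Then either $\det[A_1,A_2]=0$, or there exists $T\in GL(2,\mathbb{R})$ satisfying $(\ast)$ such that $TA_2T^{-1}=\begin{pmatrix}s_{21}&t_2\\t_2&s_{22}\end{pmatrix}$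 or $\begin{pmatrix}s_{21}&-t_2\\t_2&s_{22}\end{pmatrix}$ with $s_{21},s_{22},t_2\in\mathbb{R}$. In the first case ($\det[A_1,A_2]=0$), $P_0\cup P_1\cup P_2$ is locally polynomially convex at $0$. In the second case, $P_0\cup P_1\cup P_2$ is locally polynomially convex at $0$ if, for some such $T$, $\det(\mathscr{A}_j(T)+\mathscr{A}_j(T)^{\mathsf T})>0$ for $j=1,2$. (ii) Suppose $\sigma(A_1)\subset\mathbb{C}\setminus\mathbb{R}$. Then there exists $T\in GL(2,\mathbb{R})$ satisfying $(\ast)$ with $TA_2T^{-1}=\begin{pmatrix}s_{21}&-t_2\\t_2&s_{22}\end{pmatrix}$, $s_{21},s_{22},t_2\in\mathbb{R}$. If $\det(\mathscr{A}_j(T)+\mathscr{A}_j(T)^{\mathsf T})>0$, $j=1,2$, for some such $T$, then $P_0\cup P_1\cup P_2$ is locally polynomially convex at $0$. Moreover, these conditions are optimal in the following sense: let $\Omega^*\subsetneq\Omega$ be the set of pairs $(A_1,A_2)\in\Omega$ satisfying the sufficient conditions in (i) or (ii) (i.e., $\sigma(A_1)\subset\mathbb{R}$ with two elements and either $\det[A_1,A_2]=0$ or some $T$ as in (i) with $\det(\mathscr{A}_j(T)+\mathscr{A}_j(T)^{\mathsf T})>0$ for $j=1,2$; or $\sigma(A_1)\subset\mathbb{C}\setminus\mathbb{R}$ and some $T$ as in (ii) with $\det(\mathscr{A}_j(T)+\mathscr{A}_j(T)^{\mathsf T})>0$ for $j=1,2$). Then there is a one-parameter family of triples $(P_0^\varepsilon,P_1^\varepsilon,P_2^\varepsilon)$,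 with $P_0^\varepsilon=\mathbb{R}^2$ and $P_j^\varepsilon=(A_j^\varepsilon+i\mathbb{I})\mathbb{R}^2$, parametrized by $(A_1^\varepsilon,A_2^\varepsilon)\in\Omega\setminus\Omega^*$, such that the pairwise unions of $P_0^\varepsilon,P_1^\varepsilon,P_2^\varepsilon$ are locally polynomially convex at the origin, the union $P_0^\varepsilon\cup P_1^\varepsilon\cup P_2^\varepsilon$ is not locally polynomially convex at $0$, and $(A_1^\varepsilon,A_2^\varepsilon)$ tends to the boundary $\partial\Omega^*$ (with $\Omega^*$ regarded as a subset of $\Omega$) as $\varepsilon\searrow 0$.
   Context: A real 2-dimensional subspace $P\subset\mathbb{C}^2$ is totally real if $P\cap iP=\{0\}$. A closed set $E\subset\mathbb{C}^n$ is locally polynomially convex at $p\in E$ if $E\cap\overline{\mathbb{B}(p;r)}$ is polynomially convex (equal to its hull with respect to holomorphic polynomials) for some $r>0$. $[A,B]=AB-BA$, $M^{\mathsf T}$ is the transpose. *)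

theory Defs
  imports "HOL-Analysis.Analysis"
begin

definition realR2 :: "(complex^2) set" where
  "realR2 = range (\<lambda>x::real^2. \<chi> k. complex_of_real (x$k))"

definition graphplane :: "real^2^2 \<Rightarrow> (complex^2) set" where
  "graphplane A = range (\<lambda>x::real^2. \<chi> k. complex_of_real ((A *v x)$k) + \<i> * complex_of_real (x$k))"

definition totally_real_plane :: "(complex^2) set \<Rightarrow> bool" where
  "totally_real_plane P \<longleftrightarrow> subspace P \<and> dim P = 2 \<and> P \<inter> ((\<lambda>z. \<i> *s z) ` P) = {0}"

definition cpoly2 :: "(complex^2 \<Rightarrow> complex) \<Rightarrow> bool" where
  "cpoly2 p \<longleftrightarrow> (\<exists>(c::nat \<times> nat \<Rightarrow> complex) N.
      p = (\<lambda>z. \<Sum>j\<le>N. \<Sum>k\<le>N. c (j,k) * (z$1)^j * (z$2)^k))"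

definition poly_hull :: "(complex^2) set \<Rightarrow> (complex^2) set" where
  "poly_hull K = {z. \<forall>p. cpoly2 p \<longrightarrow> norm (p z) \<le> (SUP w\<in>K. norm (p w))}"

definition poly_convex :: "(complex^2) set \<Rightarrow> bool" where
  "poly_convex K \<longleftrightarrow> poly_hull K = K"

definition loc_poly_convex :: "(complex^2) set \<Rightarrow> complex^2 \<Rightarrow> bool" where
  "loc_poly_convex E p \<longleftrightarrow> (\<exists>r>0. poly_convex (E \<inter> cball p r))"

definition cmat :: "real^2^2 \<Rightarrow> complex^2^2" where
  "cmat A = (\<chi> i j. complex_of_real (A$i$j))"

definition mspec :: "real^2^2 \<Rightarrow> complex set" where
  "mspec A = {c. \<exists>v. v \<noteq> 0 \<and> cmat A *v v = c *s v}"

definition Omega :: "((real^2^2) \<times> (real^2^2)) set" where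
  "Omega = {(A1, A2). mspec A1 \<subseteq> - \<real> \<or> (mspec A1 \<subseteq> \<real> \<and> card (mspec A1) = 2)}"

definition mat2 :: "real \<Rightarrow> real \<Rightarrow> real \<Rightarrow> real \<Rightarrow> real^2^2" where
  "mat2 a b c d = vector [vector [a, b], vector [c, d]]"

definition conj_by :: "real^2^2 \<Rightarrow> real^2^2 \<Rightarrow> real^2^2" where
  "conj_by T A = T ** A ** matrix_inv T"

definition normal_form :: "real^2^2 \<Rightarrow> real^2^2 \<Rightarrow> bool" where
  "normal_form T A1 \<longleftrightarrow> invertible T \<and>
     ((\<exists>l1 l2. l1 \<noteq> l2 \<and> conj_by T A1 = mat2 l1 0 0 l2) \<or>
      (\<exists>s t. t \<noteq> 0 \<and> conj_by T A1 = mat2 s (-t) t s))"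

definition form_i :: "real^2^2 \<Rightarrow> real^2^2 \<Rightarrow> bool" where
  "form_i T A2 \<longleftrightarrow> (\<exists>s1 s2 t. conj_by T A2 = mat2 s1 t t s2 \<or> conj_by T A2 = mat2 s1 (-t) t s2)"

definition form_ii :: "real^2^2 \<Rightarrow> real^2^2 \<Rightarrow> bool" where
  "form_ii T A2 \<longleftrightarrow> (\<exists>s1 s2 t. conj_by T A2 = mat2 s1 (-t) t s2)"

definition posdet :: "real^2^2 \<Rightarrow> real^2^2 \<Rightarrow> bool" where
  "posdet T A \<longleftrightarrow> det (conj_by T A + transpose (conj_by T A)) > 0"

definition commdet :: "real^2^2 \<Rightarrow> real^2^2 \<Rightarrow> real" where
  "commdet A B = det (A ** B - B ** A)"

definition Omega_star :: "((real^2^2) \<times> (real^2^2)) set" where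
  "Omega_star = {(A1, A2). (A1, A2) \<in> Omega \<and>
     ((mspec A1 \<subseteq> \<real> \<and> card (mspec A1) = 2 \<and>
        (commdet A1 A2 = 0 \<or>
         (\<exists>T. normal_form T A1 \<and> form_i T A2 \<and> posdet T A1 \<and> posdet T A2))) \<or>
      (mspec A1 \<subseteq> - \<real> \<and>
         (\<exists>T. normal_form T A1 \<and> form_ii T A2 \<and> posdet T A1 \<and> posdet T A2)))}"

end

theory Submission
  imports Defs "HOL-Complex_Analysis.Complex_Analysis" "HOL-Computational_Algebra.Fundamental_Theorem_Algebra"
begin

text \<open>
  For a closed cone, local polynomial convexity at \<open>0\<close> means that the hull of each compact subset
  stays in the cone. This is invariant under linear isomorphisms, so \<open>A1\<close> may be taken in normal form.

  Sufficiency. If \<open>det [A1, A2] = 0\<close>, then \<open>A1\<close> and \<open>A2\<close> can be made upper triangular simultaneously,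
  so \<open>z2\<close> maps the three planes to real lines through \<open>0\<close>, with fibres that are real lines. Points off
  a union of lines through \<open>0\<close>, or off two lines, escape to infinity along a ray, and pushing poles
  along rays shows that hulls do not leave such unions and can be computed fibrewise. If the
  symmetric parts are definite, \<open>z1\<^sup>2 + z2\<^sup>2\<close> maps \<open>\<real>\<^sup>2\<close> to the positive half-line and each of the other
  two planes into a cone inside the open upper or lower half-plane; after a small rotation Kallin's
  argument reduces the triple union to the pairwise ones.

  Optimality. With the complete elliptic integrals \<open>U = K(1 - x)\<close> and \<open>Y = K(x)\<close> of parameter \<open>x\<close>, the map
  \<open>w (U + Y, U - Y)\<close> with \<open>w = (1/2 - x) powr (2 p) * (x (1 - x)) powr k\<close> is a holomorphic disc on
  \<open>{x. Re x < 1/2 \<and> Im x > 0}\<close>: on \<open>{0<..<1/2}\<close> both integrals are real, on \<open>Re x = 1/2\<close> they are conjugate, and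
  on the negative axis \<open>U + \<i> Y\<close> and \<open>Y\<close> are real. Hence its boundary lies in three planes, the
  first one \<open>\<real>\<^sup>2\<close>, and the maximum principle puts the disc into the hull of their union. The sufficient
  conditions must then fail for these planes, while they hold after a small change of the matrices
  when \<open>p\<close> is small and \<open>k\<close> is near \<open>1/4\<close>.
\<close>

text \<open>Optimality needs a triple that fails although all its pairs are convex, so a disc has to
  touch all three planes. \<open>K(x)\<close> and \<open>K(1 - x)\<close> solve one hypergeometric
  equation, which is real on the real axis and symmetric under \<open>x -> 1 - x\<close>; hence on
  every side of the quarter-plane some complex basis change makes the pair real, and each side lands
  in a totally real plane. The weight only turns two of these planes, by \<open>- pi p\<close> and
  \<open>pi k\<close>. The corners dictate its exponents. At 0 one integral has a logarithmic
  singularity, which any \<open>k > 0\<close> kills; at 1/2 the disc passes from one plane to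
  another and must vanish, so \<open>p > 0\<close>; at infinity both integrals decay like
  \<open>|x|^(-1/2)\<close> up to a logarithm, while the weight grows like
  \<open>|x|^(2 p + 2 k)\<close>, so \<open>p + k < 1/4\<close>. At \<open>p + k = 1/4\<close> two
  of the planes meet in a real line. As the parameter tends to 0, one eigenvalue of the first matrix
  tends to minus infinity. The family therefore has no limit, and approach to the boundary means
  that the distance to the frontier tends to 0.\<close>

unbundle no Formal_Power_Series.fps_syntax

section \<open>Polynomial hulls\<close>

lemma cpoly2_monom: "cpoly2 (\<lambda>z. c * (z$1)^j * (z$2)^k)"
proof -
  let ?c = "\<lambda>(a,b). if a = j \<and> b = k then c else 0"
  have "c * (z$1)^j * (z$2)^k =
      (\<Sum>a\<le>max j k. \<Sum>b\<le>max j k. ?c (a,b) * (z$1)^a * (z$2)^b)" for z :: "complex^2"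
  proof -
    have "(\<Sum>b\<le>max j k. ?c (a,b) * (z$1)^a * (z$2)^b) =
        (if a = j then c * (z$1)^j * (z$2)^k else 0)" for a
    proof (cases "a = j")
      case True
      then have "(\<Sum>b\<le>max j k. ?c (a,b) * (z$1)^a * (z$2)^b) =
          (\<Sum>b\<le>max j k. if b = k then c * (z$1)^j * (z$2)^k else 0)"
        by (intro sum.cong) auto
      with True show ?thesis by simp
    qed auto
    then show ?thesis by simp
  qed
  then show ?thesis unfolding cpoly2_def by blast
qed

lemma cpoly2_add:
  assumes "cpoly2 p" "cpoly2 q"
  shows "cpoly2 (\<lambda>z. p z + q z)"
proof -
  obtain c N where p: "p = (\<lambda>z. \<Sum>j\<le>N. \<Sum>k\<le>N. c (j,k) * (z$1)^j * (z$2)^k)"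
    using assms(1) unfolding cpoly2_def by blast
  obtain d M where q: "q = (\<lambda>z. \<Sum>j\<le>M. \<Sum>k\<le>M. d (j,k) * (z$1)^j * (z$2)^k)"
    using assms(2) unfolding cpoly2_def by blast
  \<comment> \<open>Padding the coefficients with zeros brings both sums to the common bound
    \<open>max N M\<close>.\<close>
  have extend: "(\<Sum>j\<le>N. \<Sum>k\<le>N. c (j,k) * (z$1)^j * (z$2)^k) =
     (\<Sum>j\<le>L. \<Sum>k\<le>L. (case (j,k) of (j,k) \<Rightarrow> if j \<le> N \<and> k \<le> N then c (j,k) else 0) * (z$1)^j * (z$2)^k)"
    if "N \<le> L" for N L c and z :: "complex^2"
  proof -
    have "(\<Sum>j\<le>N. \<Sum>k\<le>N. c (j,k) * (z$1)^j * (z$2)^k) =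
        (\<Sum>jk\<in>{..N}\<times>{..N}. c jk * (z$1)^fst jk * (z$2)^snd jk)"
      by (simp add: sum.cartesian_product case_prod_unfold)
    also have "\<dots> = (\<Sum>jk\<in>{..L}\<times>{..L}. (if fst jk \<le> N \<and> snd jk \<le> N then c jk else 0) * (z$1)^fst jk * (z$2)^snd jk)"
      using that by (intro sum.mono_neutral_cong_left) auto
    finally show ?thesis
      by (simp add: sum.cartesian_product case_prod_unfold cong: if_cong)
  qed
  define e where "e = (\<lambda>(j,k). (if j \<le> N \<and> k \<le> N then c (j,k) else 0) + (if j \<le> M \<and> k \<le> M then d (j,k) else 0))"
  have "(\<lambda>z. p z + q z) = (\<lambda>z. \<Sum>j\<le>max N M. \<Sum>k\<le>max N M. e (j,k) * (z$1)^j * (z$2)^k)"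
    unfolding p q
    by (subst extend[of N "max N M"], simp, subst extend[of M "max N M"], simp)
       (simp add: e_def sum.distrib [symmetric] algebra_simps)
  then show ?thesis unfolding cpoly2_def by blast
qed

lemma cpoly2_const: "cpoly2 (\<lambda>z. c)"
  using cpoly2_monom[of c 0 0] by simp

lemma cpoly2_coords: "cpoly2 (\<lambda>z. z$1)" "cpoly2 (\<lambda>z. z$2)"
  using cpoly2_monom[of 1 1 0] cpoly2_monom[of 1 0 1] by simp_all

lemma cpoly2_sum:
  assumes "\<And>i. i \<in> I \<Longrightarrow> cpoly2 (p i)"
  shows "cpoly2 (\<lambda>z. \<Sum>i\<in>I. p i z)"
  using assms by (induction I rule: infinite_finite_induct) (auto intro: cpoly2_add cpoly2_const)

lemma cpoly2_mult:
  assumes "cpoly2 p" "cpoly2 q"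
  shows "cpoly2 (\<lambda>z. p z * q z)"
proof -
  obtain c N where p: "p = (\<lambda>z. \<Sum>j\<le>N. \<Sum>k\<le>N. c (j,k) * (z$1)^j * (z$2)^k)"
    using assms(1) unfolding cpoly2_def by blast
  obtain d M where q: "q = (\<lambda>z. \<Sum>j\<le>M. \<Sum>k\<le>M. d (j,k) * (z$1)^j * (z$2)^k)"
    using assms(2) unfolding cpoly2_def by blast
  have "(\<lambda>z. p z * q z) = (\<lambda>z. \<Sum>i\<le>N. \<Sum>l\<le>M. \<Sum>j\<le>N. \<Sum>k\<le>M.
      (c (i,j) * d (l,k)) * (z$1)^(i+l) * (z$2)^(j+k))"
    unfolding p q sum_product
    by (simp add: power_add mult_ac)
  then show ?thesis
    by (auto intro!: cpoly2_sum cpoly2_monom)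
qed

lemma cpoly2_power: "cpoly2 p \<Longrightarrow> cpoly2 (\<lambda>z. p z ^ n)"
  by (induction n) (auto intro: cpoly2_mult cpoly2_const)

lemma cpoly2_poly: "cpoly2 f \<Longrightarrow> cpoly2 (\<lambda>z. poly q (f z))"
  by (induction q) (auto intro: cpoly2_add cpoly2_mult cpoly2_const)

lemma cpoly2_compose:
  assumes "cpoly2 p" "cpoly2 (\<lambda>z. F z $ 1)" "cpoly2 (\<lambda>z. F z $ 2)"
  shows "cpoly2 (\<lambda>z. p (F z))"
proof -
  obtain c N where p: "p = (\<lambda>z. \<Sum>j\<le>N. \<Sum>k\<le>N. c (j,k) * (z$1)^j * (z$2)^k)"
    using assms(1) unfolding cpoly2_def by blast
  show ?thesis
    unfolding p by (intro cpoly2_sum cpoly2_mult cpoly2_const cpoly2_power assms)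
qed

lemma matrix_vector_2: "(G *v z) $ i = G$i$1 * z$1 + G$i$2 * z$2"
  for z :: "'a::comm_semiring_1^2"
  by (simp add: matrix_vector_mult_def sum_2)

lemma cpoly2_matrix:
  assumes "cpoly2 p"
  shows "cpoly2 (\<lambda>z. p (G *v z))"
  by (rule cpoly2_compose[OF assms])
     (auto simp: matrix_vector_2 intro!: cpoly2_add cpoly2_mult cpoly2_const cpoly2_coords)

lemma continuous_on_cpoly2:
  assumes "cpoly2 p" "continuous_on S f"
  shows "continuous_on S (\<lambda>x. p (f x))"
proof -
  obtain c N where p: "p = (\<lambda>z. \<Sum>j\<le>N. \<Sum>k\<le>N. c (j,k) * (z$1)^j * (z$2)^k)"
    using assms(1) unfolding cpoly2_def by blast
  show ?thesis unfolding p by (intro continuous_intros assms)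
qed

lemma cpoly2_compact_bound:
  assumes "cpoly2 p" "compact K"
  obtains B where "B > 0" "\<And>w. w \<in> K \<Longrightarrow> norm (p w) \<le> B"
proof -
  have "compact (p ` K)"
    by (intro compact_continuous_image continuous_on_cpoly2 assms continuous_on_id)
  then obtain B where "\<forall>x\<in>p ` K. norm x \<le> B"
    using compact_imp_bounded bounded_iff by blast
  then show ?thesis by (intro that[of "max B 1"]) auto
qed

text \<open>Unlike the supremum in \<open>poly_hull\<close>, this form is meaningful also for the empty set,
  whose hull is empty.\<close>

definition in_hull :: "(complex^2) set \<Rightarrow> complex^2 \<Rightarrow> bool" where
  "in_hull K z \<longleftrightarrow> (\<forall>p M. cpoly2 p \<longrightarrow> (\<forall>w\<in>K. norm (p w) \<le> M) \<longrightarrow> norm (p z) \<le> M)"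

lemma in_hullD:
  "in_hull K z \<Longrightarrow> cpoly2 p \<Longrightarrow> (\<And>w. w \<in> K \<Longrightarrow> norm (p w) \<le> M) \<Longrightarrow> norm (p z) \<le> M"
  unfolding in_hull_def by blast

lemma in_hull_nonempty: "in_hull K z \<Longrightarrow> K \<noteq> {}"
  using in_hullD[of K z "\<lambda>_. 1" 0] by (auto intro: cpoly2_const)

lemma in_hull_mono: "in_hull K z \<Longrightarrow> K \<subseteq> L \<Longrightarrow> in_hull L z"
  unfolding in_hull_def by blast

lemma in_hull_incl: "z \<in> K \<Longrightarrow> in_hull K z"
  unfolding in_hull_def by blast

text \<open>Nonemptiness makes the supremum at most every bound \<open>M\<close>, and compactness
  makes it a true upper bound; both fail for \<open>SUP\<close> on arbitrary sets.\<close>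

lemma poly_hull_iff:
  assumes "compact K" "K \<noteq> {}"
  shows "z \<in> poly_hull K \<longleftrightarrow> in_hull K z"
proof
  assume z: "z \<in> poly_hull K"
  show "in_hull K z"
    unfolding in_hull_def
  proof (intro allI impI)
    fix p M assume p: "cpoly2 p" "\<forall>w\<in>K. norm (p w) \<le> M"
    have "norm (p z) \<le> (SUP w\<in>K. norm (p w))"
      using z p unfolding poly_hull_def by blast
    also have "\<dots> \<le> M" using assms p by (intro cSUP_least) auto
    finally show "norm (p z) \<le> M" .
  qed
next
  assume z: "in_hull K z"
  show "z \<in> poly_hull K"
    unfolding poly_hull_def
  proof (intro CollectI allI impI)
    fix p assume p: "cpoly2 p"
    obtain B where "\<And>w. w \<in> K \<Longrightarrow> norm (p w) \<le> B"
      using cpoly2_compact_bound[OF p assms(1)] by blast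
    then have "bdd_above ((\<lambda>w. norm (p w)) ` K)" by (intro bdd_aboveI2)
    then show "norm (p z) \<le> (SUP w\<in>K. norm (p w))"
      by (intro in_hullD[OF z p] cSUP_upper)
  qed
qed

section \<open>Hulls under linear maps and in cones\<close>

lemma in_hull_matrix:
  assumes "in_hull K z"
  shows "in_hull ((*v) G ` K) (G *v z)"
  unfolding in_hull_def
proof (intro allI impI)
  fix p M assume "cpoly2 p" "\<forall>w\<in>(*v) G ` K. norm (p w) \<le> M"
  then show "norm (p (G *v z)) \<le> M"
    using in_hullD[OF assms cpoly2_matrix[of p G]] by auto
qed

text \<open>Quantifying over all compact subsets removes the Euclidean ball, which a matrix would
  distort, and makes the property stable under intersections.\<close>

definition hull_closed :: "(complex^2) set \<Rightarrow> bool" where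
  "hull_closed E \<longleftrightarrow> (\<forall>K z. compact K \<and> K \<subseteq> E \<and> in_hull K z \<longrightarrow> z \<in> E)"

lemma hull_closedD: "hull_closed E \<Longrightarrow> compact K \<Longrightarrow> K \<subseteq> E \<Longrightarrow> in_hull K z \<Longrightarrow> z \<in> E"
  unfolding hull_closed_def by blast

lemma compact_matrix_image:
  "compact K \<Longrightarrow> compact ((*v) G ` K)" for G :: "complex^2^2"
  by (intro compact_continuous_image)
     (auto simp: matrix_vector_mult_def intro!: continuous_intros)

lemma hull_closed_matrix:
  fixes G :: "complex^2^2"
  assumes "invertible G"
  shows "hull_closed ((*v) G ` E) \<longleftrightarrow> hull_closed E"
proof -
  have *: "hull_closed E" if G: "invertible G" and E: "hull_closed ((*v) G ` E)" for G :: "complex^2^2" and E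
    unfolding hull_closed_def
  proof (intro allI impI, elim conjE)
    fix K z assume K: "compact K" "K \<subseteq> E" "in_hull K z"
    have "G *v z \<in> (*v) G ` E"
      using K(2) by (intro hull_closedD[OF E compact_matrix_image[OF K(1)] _ in_hull_matrix[OF K(3)]]) auto
    moreover have "inj ((*v) G)" using G by (simp add: inj_matrix_vector_mult)
    ultimately show "z \<in> E" by (simp add: inj_image_mem_iff)
  qed
  obtain H where H: "H ** G = mat 1" "G ** H = mat 1"
    using assms unfolding invertible_def by blast
  then have "invertible H" unfolding invertible_def by blast
  moreover have "(*v) H ` (*v) G ` E = E"
    by (simp add: image_image matrix_vector_mul_assoc H)
  ultimately show ?thesis
    using *[OF assms, of E] *[of H "(*v) G ` E"] by auto
qed

text \<open>The linear polynomial \<open>w -> <w, z>\<close> takes the value \<open>|z|^2\<close> at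
  \<open>z\<close> and is bounded by \<open>|z| r\<close> on \<open>K\<close> by
  Cauchy-Schwarz.\<close>

lemma in_hull_cball:
  fixes K :: "(complex^2) set"
  assumes "in_hull K z" "K \<subseteq> cball 0 r"
  shows "z \<in> cball 0 r"
proof -
  define s where "s = norm z"
  let ?p = "\<lambda>w::complex^2. cnj (z$1) * w$1 + cnj (z$2) * w$2"
  have r: "r \<ge> 0"
    using in_hull_nonempty[OF assms(1)] assms(2) by (force intro: order_trans[OF norm_ge_zero])
  have "norm (?p z) \<le> s * r"
  proof (rule in_hullD[OF assms(1), where p = ?p])
    show "cpoly2 ?p" by (intro cpoly2_add cpoly2_mult cpoly2_const cpoly2_coords)
    fix w assume "w \<in> K"
    then have w: "norm w \<le> r" using assms(2) by auto
    have "norm (?p w) \<le> norm (z$1) * norm (w$1) + norm (z$2) * norm (w$2)"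
      by (rule norm_triangle_le) (simp add: norm_mult)
    also have "\<dots> = (\<chi> i. norm (z$i)) \<bullet> (\<chi> i. norm (w$i))"
      by (simp add: inner_vec_def sum_2)
    also have "\<dots> \<le> norm (\<chi> i. norm (z$i)) * norm (\<chi> i. norm (w$i))"
      by (rule norm_cauchy_schwarz)
    also have "\<dots> = s * norm w" by (simp add: norm_vec_def s_def)
    also have "\<dots> \<le> s * r" using w by (intro mult_left_mono) (auto simp: s_def)
    finally show "norm (?p w) \<le> s * r" .
  qed
  moreover have "?p z = of_real (s^2)"
  proof -
    have "s^2 = (norm (z$1))^2 + (norm (z$2))^2"
      by (simp add: s_def norm_vec_def L2_set_def sum_2)
    then show ?thesis by (simp add: complex_norm_square [symmetric] mult.commute[of "cnj _"])
  qed
  ultimately have "norm (complex_of_real (s^2)) \<le> s * r" by (simp only:)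
  then have "s * s \<le> s * r" by (simp add: power2_eq_square norm_mult s_def)
  then show ?thesis using r by (cases "s = 0") (auto simp: s_def)
qed

lemma scaleR_matrix: "(mat (complex_of_real t)) *v z = t *\<^sub>R z" for z :: "complex^2"
  by (vector matrix_vector_mult_def mat_def sum_2) (simp add: scaleR_conv_of_real forall_2 sum_2)

text \<open>If \<open>E\<close> is hull closed, the hull of \<open>E\<close> cut by the unit ball
  stays in \<open>E\<close> and, by \<open>in_hull_cball\<close>, in the ball. Conversely a dilation
  by \<open>r / R\<close> moves a given compact set into the good ball, and the inverse dilation
  brings the hull point back into the cone.\<close>

lemma loc_poly_convex_cone_iff:
  assumes cl: "closed E" and cone: "\<And>t z. z \<in> E \<Longrightarrow> t *\<^sub>R z \<in> E" and ne: "0 \<in> E"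
  shows "loc_poly_convex E 0 \<longleftrightarrow> hull_closed E"
proof
  assume E: "hull_closed E"
  let ?X = "E \<inter> cball 0 1"
  have X: "compact ?X" "?X \<noteq> {}" using cl ne by (auto simp: closed_Int_compact)
  have "z \<in> ?X" if "in_hull ?X z" for z
    using hull_closedD[OF E X(1) _ that] in_hull_cball[OF that] by blast
  then have "poly_hull ?X = ?X"
    using poly_hull_iff[OF X] in_hull_incl[of _ ?X] by blast
  then show "loc_poly_convex E 0"
    unfolding loc_poly_convex_def poly_convex_def by (intro exI[of _ 1]) auto
next
  assume "loc_poly_convex E 0"
  then obtain r where r: "r > 0" "poly_hull (E \<inter> cball 0 r) = E \<inter> cball 0 r"
    unfolding loc_poly_convex_def poly_convex_def by blast
  let ?X = "E \<inter> cball 0 r"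
  have X: "compact ?X" "?X \<noteq> {}" using cl ne r(1) by (auto simp: closed_Int_compact)
  show "hull_closed E"
    unfolding hull_closed_def
  proof (intro allI impI, elim conjE)
    fix K z assume K: "compact K" "K \<subseteq> E" "in_hull K z"
    obtain R where R: "R > 0" "\<And>w. w \<in> K \<Longrightarrow> norm w \<le> R"
      using compact_imp_bounded[OF K(1)] bounded_pos by blast
    define t where "t = r / R"
    have t: "t > 0" using r R by (simp add: t_def)
    have "in_hull ((\<lambda>w. t *\<^sub>R w) ` K) (t *\<^sub>R z)"
      using in_hull_matrix[OF K(3), of "mat (complex_of_real t)"] by (simp add: scaleR_matrix)
    moreover have "(\<lambda>w. t *\<^sub>R w) ` K \<subseteq> ?X"
      using K(2) cone R r(1) by (auto simp: t_def field_simps)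
    ultimately have "t *\<^sub>R z \<in> ?X"
      using in_hull_mono poly_hull_iff[OF X] r(2) by blast
    then have "(1/t) *\<^sub>R (t *\<^sub>R z) \<in> E" using cone[of "t *\<^sub>R z" "1/t"] by blast
    then show "z \<in> E" using t by simp
  qed
qed

section \<open>Uniform approximation by polynomials in one variable\<close>

text \<open>Membership in the uniform closure of the polynomials on \<open>K\<close>. The lemmas
  below are explicit cases of Runge's theorem, for functions whose poles can be pushed to
  infinity.\<close>

definition approx :: "complex set \<Rightarrow> (complex \<Rightarrow> complex) \<Rightarrow> bool" where
  "approx K h \<longleftrightarrow> (\<forall>e>0. \<exists>q. \<forall>w\<in>K. norm (h w - poly q w) < e)"

lemma approxD: "approx K h \<Longrightarrow> e > 0 \<Longrightarrow> \<exists>q. \<forall>w\<in>K. norm (h w - poly q w) < e"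
  unfolding approx_def by blast

lemma approx_limit:
  assumes "\<And>e. e > 0 \<Longrightarrow> \<exists>g. approx K g \<and> (\<forall>w\<in>K. norm (h w - g w) < e)"
  shows "approx K h"
  unfolding approx_def
proof (intro allI impI)
  fix e :: real assume "e > 0"
  then have e2: "e/2 > 0" by simp
  obtain g where g: "approx K g" "\<forall>w\<in>K. norm (h w - g w) < e/2" using assms[OF e2] by blast
  obtain q where q: "\<forall>w\<in>K. norm (g w - poly q w) < e/2" using approxD[OF g(1) e2] by blast
  note gq = g(2) q
  have "norm (h w - poly q w) < e" if "w \<in> K" for w
  proof -
    have "norm (h w - g w) < e/2" "norm (g w - poly q w) < e/2" using gq that by auto
    then show ?thesis using norm_triangle_ineq[of "h w - g w" "g w - poly q w"] by simp
  qed
  then show "\<exists>q. \<forall>w\<in>K. norm (h w - poly q w) < e" by blast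
qed

lemma approx_poly: "approx K (poly q)"
  unfolding approx_def by (auto intro!: exI[of _ q])

lemma approx_subset: "approx K h \<Longrightarrow> L \<subseteq> K \<Longrightarrow> approx L h"
  unfolding approx_def by (meson subsetD)

lemma approx_cong: "approx K h \<Longrightarrow> (\<And>w. w \<in> K \<Longrightarrow> h w = g w) \<Longrightarrow> approx K g"
  unfolding approx_def by (metis (no_types, lifting))

lemma approx_bounded:
  assumes "bounded K" "approx K h"
  obtains B where "B > 0" "\<And>w. w \<in> K \<Longrightarrow> norm (h w) \<le> B"
proof -
  obtain q where q: "\<forall>w\<in>K. norm (h w - poly q w) < 1" using approxD[OF assms(2), of 1] by auto
  have "compact (poly q ` closure K)"
    using assms(1) by (intro compact_continuous_image) (auto intro: continuous_intros)
  then obtain B where B: "\<forall>x\<in>poly q ` closure K. norm x \<le> B"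
    using compact_imp_bounded bounded_iff by blast
  have "norm (h w) \<le> \<bar>B\<bar> + 1" if "w \<in> K" for w
  proof -
    have "norm (h w - poly q w) < 1" using q that by blast
    moreover have "norm (poly q w) \<le> B" using B that closure_subset by blast
    ultimately show ?thesis using norm_triangle_ineq[of "h w - poly q w" "poly q w"] by simp
  qed
  then show ?thesis by (intro that[of "\<bar>B\<bar> + 1"]) auto
qed

lemma approx_add:
  assumes "approx K h" "approx K g" shows "approx K (\<lambda>w. h w + g w)"
  unfolding approx_def
proof (intro allI impI)
  fix e :: real assume "e > 0"
  then have e2: "e/2 > 0" by simp
  obtain p where p: "\<forall>w\<in>K. norm (h w - poly p w) < e/2" using approxD[OF assms(1) e2] by blast
  obtain q where q: "\<forall>w\<in>K. norm (g w - poly q w) < e/2" using approxD[OF assms(2) e2] by blast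
  note pq = p q
  have "norm (h w + g w - poly (p + q) w) < e" if "w \<in> K" for w
  proof -
    have "norm (h w - poly p w) < e/2" "norm (g w - poly q w) < e/2" using pq that by auto
    then show ?thesis
      using norm_triangle_ineq[of "h w - poly p w" "g w - poly q w"] by (simp add: algebra_simps)
  qed
  then show "\<exists>q. \<forall>w\<in>K. norm (h w + g w - poly q w) < e" by blast
qed

lemma approx_mult:
  assumes K: "bounded K" and h: "approx K h" and g: "approx K g"
  shows "approx K (\<lambda>w. h w * g w)"
  unfolding approx_def
proof (intro allI impI)
  fix e :: real assume e: "e > 0"
  obtain B where B: "B > 0" "\<And>w. w \<in> K \<Longrightarrow> norm (g w) \<le> B" using approx_bounded[OF K g] by blast
  obtain p where p: "\<forall>w\<in>K. norm (h w - poly p w) < e / (2 * B)"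
    using approxD[OF h, of "e / (2*B)"] e B by auto
  obtain C where C: "C > 0" "\<And>w. w \<in> K \<Longrightarrow> norm (poly p w) \<le> C"
    using approx_bounded[OF K approx_poly] by blast
  obtain q where q: "\<forall>w\<in>K. norm (g w - poly q w) < e / (2 * C)"
    using approxD[OF g, of "e / (2*C)"] e C by auto
  have "norm (h w * g w - poly (p * q) w) < e" if w: "w \<in> K" for w
  proof -
    have "h w * g w - poly (p * q) w = (h w - poly p w) * g w + poly p w * (g w - poly q w)"
      by (simp add: algebra_simps)
    then have "norm (h w * g w - poly (p * q) w)
        \<le> norm (h w - poly p w) * norm (g w) + norm (poly p w) * norm (g w - poly q w)"
      by (metis norm_mult norm_triangle_ineq)
    also have "norm (h w - poly p w) * norm (g w) \<le> e / (2 * B) * B"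
      using p w B e by (intro mult_mono) (auto intro: less_imp_le)
    also have "norm (poly p w) * norm (g w - poly q w) \<le> C * norm (g w - poly q w)"
      using C w by (intro mult_right_mono) auto
    also have "C * norm (g w - poly q w) < C * (e / (2 * C))"
      using q w C by (intro mult_strict_left_mono) auto
    finally show ?thesis using B(1) C(1) by simp
  qed
  then show "\<exists>q. \<forall>w\<in>K. norm (h w * g w - poly q w) < e" by blast
qed

lemma approx_const: "approx K (\<lambda>w. c)"
  using approx_poly[of K "[:c:]"] by (rule approx_cong) simp

lemma approx_id: "approx K (\<lambda>w. w)"
  using approx_poly[of K "[:0,1:]"] by (rule approx_cong) simp

lemma approx_power: "bounded K \<Longrightarrow> approx K h \<Longrightarrow> approx K (\<lambda>w. h w ^ n)"
  by (induction n) (auto intro: approx_const approx_mult)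

lemma approx_sum:
  "(\<And>i. i \<in> I \<Longrightarrow> approx K (h i)) \<Longrightarrow> approx K (\<lambda>w. \<Sum>i\<in>I. h i w)"
  by (induction I rule: infinite_finite_induct) (auto intro: approx_const approx_add)

text \<open>The geometric series in \<open>t h\<close> moves a pole.\<close>

lemma approx_geometric:
  assumes K: "bounded K" and h: "approx K h" and small: "\<And>w. w \<in> K \<Longrightarrow> norm (t * h w) \<le> 1/2"
  shows "approx K (\<lambda>w. 1 / (1 - t * h w))"
proof (rule approx_limit)
  fix e :: real assume "e > 0"
  \<comment> \<open>The remainder of the geometric sum is \<open>x^N / (1 - x)\<close>, at most
    \<open>2 (1/2)^N\<close> in modulus.\<close>
  then obtain N where N: "(1/2::real) ^ N < e / 2"
    using real_arch_pow_inv[of "e/2" "1/2"] by auto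
  let ?g = "\<lambda>w. \<Sum>n<N. (t * h w) ^ n"
  have "approx K ?g"
    by (intro approx_sum approx_power approx_mult K h approx_const)
  moreover have "norm (1 / (1 - t * h w) - ?g w) < e" if "w \<in> K" for w
  proof -
    let ?x = "t * h w"
    have x: "norm ?x \<le> 1/2" using small that by blast
    then have ne: "?x \<noteq> 1" by auto
    have "1/2 \<le> norm (1 - ?x)" using norm_triangle_ineq2[of 1 ?x] x by simp
    moreover have "1 / (1 - ?x) - ?g w = ?x ^ N / (1 - ?x)"
      using ne unfolding sum_gp_strict[of ?x N] by (simp add: diff_divide_distrib [symmetric])
    ultimately have "norm (1 / (1 - ?x) - ?g w) \<le> (1/2) ^ N / (1/2)"
      using power_mono[OF x norm_ge_zero, of N]
      by (simp only: norm_divide norm_power) (intro frac_le, auto)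
    then show ?thesis using N by simp
  qed
  ultimately show "\<exists>g. approx K g \<and> (\<forall>w\<in>K. norm (1 / (1 - t * h w) - g w) < e)" by blast
qed

lemma approx_pole_far:
  assumes "bounded K" "\<And>w. w \<in> K \<Longrightarrow> 2 * norm w \<le> norm a" "a \<noteq> 0"
  shows "approx K (\<lambda>w. 1 / (w - a))"
proof -
  have "approx K (\<lambda>w. 1 / (1 - (1/a) * w))"
    using assms by (intro approx_geometric approx_id) (auto simp: norm_divide field_simps)
  then have "approx K (\<lambda>w. (-1/a) * (1 / (1 - (1/a) * w)))"
    by (intro approx_mult approx_const assms)
  moreover have "(-1/a) * (1 / (1 - (1/a) * w)) = 1 / (w - a)" for w
    using assms(3) by (cases "w = a") (simp_all add: field_simps)
  ultimately show ?thesis by simp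
qed

text \<open>\<open>1 / (w - a)\<close> is \<open>1 / (w - b)\<close> times a geometric series in
  \<open>(a - b) / (w - b)\<close>, whose modulus is at most 1/2 here.\<close>

lemma approx_pole_step:
  assumes K: "bounded K" and b: "approx K (\<lambda>w. 1 / (w - b))"
    and d: "\<And>w. w \<in> K \<Longrightarrow> d \<le> norm (w - b)" "d > 0" "norm (a - b) \<le> d / 2"
  shows "approx K (\<lambda>w. 1 / (w - a))"
proof -
  have "approx K (\<lambda>w. 1 / (1 - (a - b) * (1 / (w - b))))"
  proof (intro approx_geometric K b)
    fix w assume "w \<in> K"
    then show "norm ((a - b) * (1 / (w - b))) \<le> 1/2"
      using d(1)[of w] d(2,3) by (simp add: norm_divide norm_mult divide_simps)
  qed
  then have "approx K (\<lambda>w. 1 / (w - b) * (1 / (1 - (a - b) * (1 / (w - b)))))"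
    by (intro approx_mult K b)
  then show ?thesis
  proof (rule approx_cong)
    fix w assume "w \<in> K"
    then have "w \<noteq> b" using d by fastforce
    then show "1 / (w - b) * (1 / (1 - (a - b) * (1 / (w - b)))) = 1 / (w - a)"
      by (simp add: divide_simps)
  qed
qed

text \<open>A pole beyond twice the radius of \<open>K\<close> is harmless by
  \<open>approx_pole_far\<close>. From there steps of length \<open>d / 2\<close> lead back along
  the ray to \<open>a\<close>, and the uniform distance \<open>d\<close> makes every single step
  admissible.\<close>

lemma approx_pole_ray:
  assumes K: "bounded K" and u: "u \<noteq> 0" and d: "d > 0"
    and ray: "\<And>s w. s \<ge> 0 \<Longrightarrow> w \<in> K \<Longrightarrow> d \<le> norm (w - (a + of_real s * u))"
  shows "approx K (\<lambda>w. 1 / (w - a))"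
proof -
  obtain B where B: "B > 0" "\<And>w. w \<in> K \<Longrightarrow> norm w \<le> B" using K bounded_pos by blast
  define s where "s = d / (2 * norm u)"
  have s: "s > 0" using d u by (simp add: s_def)
  have shift: "approx K (\<lambda>w. 1 / (w - (a + of_real (real n * s) * u)))"
    if "approx K (\<lambda>w. 1 / (w - (a + of_real (real (n + m) * s) * u)))" for n m
    using that
  proof (induction m)
    case (Suc m)
    let ?b = "a + of_real (real (n + Suc m) * s) * u"
    have "approx K (\<lambda>w. 1 / (w - (a + of_real (real (n + m) * s) * u)))"
    proof (rule approx_pole_step[OF K Suc.prems])
      show "d \<le> norm (w - ?b)" if "w \<in> K" for w
        using ray[of "real (n + Suc m) * s" w] s that by simp
      have "a + of_real (real (n + m) * s) * u - ?b = - (of_real s * u)"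
        by (simp add: algebra_simps)
      then show "norm (a + of_real (real (n + m) * s) * u - ?b) \<le> d / 2"
        using s u by (simp add: norm_mult) (simp add: s_def)
    qed (use d in auto)
    then show ?case by (rule Suc.IH)
  qed simp
  obtain n where n: "real n > (2 * B + norm a) / (s * norm u)" using reals_Archimedean2 by blast
  let ?c = "a + of_real (real n * s) * u"
  have "2 * B + norm a < real n * s * norm u"
    using n s u by (simp add: divide_simps mult_ac)
  then have c: "norm ?c > 2 * B"
    using norm_triangle_ineq4[of ?c a] s by (simp add: norm_mult)
  have "approx K (\<lambda>w. 1 / (w - ?c))"
    by (rule approx_pole_far[OF K]) (use B c in force)+
  then show ?thesis using shift[of 0 n] by simp
qed

section \<open>Reciprocals on star-shaped compact sets\<close>

lemma ray_positive_distance: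
  fixes C :: "complex set"
  assumes "closed C" "bounded C" "u \<noteq> 0" and avoid: "\<And>s. s \<ge> 0 \<Longrightarrow> a + of_real s * u \<notin> C"
  obtains d where "d > 0" "\<And>s w. s \<ge> 0 \<Longrightarrow> w \<in> C \<Longrightarrow> d \<le> norm (w - (a + of_real s * u))"
proof -
  let ?R = "(\<lambda>s. a + of_real s * u) ` {0..}"
  have "closed ?R"
  proof -
    have "?R = (\<lambda>z. a + u * z) ` (complex_of_real ` {0..})" by (auto simp: mult.commute image_image)
    moreover have "closed (complex_of_real ` {0..})"
    proof -
      have "complex_of_real ` {0..} = {z. Im z = 0} \<inter> {z. Re z \<ge> 0}"
        by (auto simp: complex_eq_iff image_iff intro: exI[of _ "Re _"])
      then show ?thesis by (simp add: closed_Int closed_halfspace_Im_eq closed_halfspace_Re_ge)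
    qed
    moreover have "(\<lambda>z. a + u * z) ` X = (\<lambda>z. a + z) ` ((*) u) ` X" for X by (auto simp: image_image)
    moreover have "closed ((*) u ` X)" if "closed X" for X :: "complex set"
      using that assms(3) by (intro closed_injective_linear_image) (auto simp: inj_on_def linear_times)
    ultimately show ?thesis by (simp add: closed_translation)
  qed
  moreover have "compact C" using assms compact_eq_bounded_closed by blast
  moreover have "C \<inter> ?R = {}" using avoid by auto
  ultimately obtain d where "d > 0" "\<forall>x\<in>C. \<forall>y\<in>?R. d \<le> dist x y"
    using separate_compact_closed[of C ?R] by blast
  then show ?thesis by (intro that[of d]) (auto simp: dist_norm)
qed

text \<open>The ray from \<open>a\<close> in its own direction avoids \<open>K\<close>: a point of
  it in \<open>K\<close> could be shrunk back to \<open>a\<close>.\<close>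

lemma approx_pole_star:
  assumes K: "compact K" "0 \<in> K" and star: "\<And>t w. 0 \<le> t \<Longrightarrow> t \<le> 1 \<Longrightarrow> w \<in> K \<Longrightarrow> of_real t * w \<in> K"
    and a: "a \<notin> K"
  shows "approx K (\<lambda>w. 1 / (w - a))"
proof -
  have "a \<noteq> 0" using K a by auto
  have "a + of_real s * a \<notin> K" if "s \<ge> 0" for s
  proof
    assume "a + of_real s * a \<in> K"
    then have "of_real (1/(1+s)) * (a + of_real s * a) \<in> K" using that by (intro star) auto
    moreover have "of_real (1/(1+s)) * (a + of_real s * a) = a"
    proof -
      have "(1 + complex_of_real s) \<noteq> 0" using that
        by (metis add_nonneg_eq_0_iff of_real_1 of_real_add of_real_eq_0_iff zero_le_one zero_neq_one)
      then show ?thesis by (simp add: field_simps)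
    qed
    ultimately show False using a by simp
  qed
  then obtain d where "d > 0" "\<And>s w. s \<ge> 0 \<Longrightarrow> w \<in> K \<Longrightarrow> d \<le> norm (w - (a + of_real s * a))"
    using ray_positive_distance[of K a a] \<open>a \<noteq> 0\<close> K(1) by (metis compact_eq_bounded_closed)
  then show ?thesis
    using approx_pole_ray[of K a d a] \<open>a \<noteq> 0\<close> K(1) compact_imp_bounded by blast
qed

text \<open>Split \<open>q\<close> into linear factors; each root lies outside \<open>K\<close>, so
  its reciprocal factor is covered by \<open>approx_pole_star\<close>.\<close>

lemma approx_inverse_poly_star:
  assumes K: "compact K" "0 \<in> K" and star: "\<And>t w. 0 \<le> t \<Longrightarrow> t \<le> 1 \<Longrightarrow> w \<in> K \<Longrightarrow> of_real t * w \<in> K"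
    and q: "\<And>w. w \<in> K \<Longrightarrow> poly q w \<noteq> 0"
  shows "approx K (\<lambda>w. 1 / poly q w)"
  using q
proof (induction "degree q" arbitrary: q)
  case 0
  then obtain c where "q = [:c:]" by (metis degree_eq_zeroE)
  then show ?case by (simp add: approx_const)
next
  case (Suc n)
  then have "\<not> constant (poly q)" by (simp add: constant_degree)
  then obtain a where a: "poly q a = 0" using fundamental_theorem_of_algebra by blast
  then obtain r where r: "q = [:-a, 1:] * r" by (meson dvdE poly_eq_0_iff_dvd)
  have "r \<noteq> 0" using Suc.hyps r by auto
  then have "degree r = n" using Suc.hyps(2) unfolding r by (subst (asm) degree_mult_eq) auto
  moreover have "poly r w \<noteq> 0" if "w \<in> K" for w using Suc.prems[OF that] r by auto
  ultimately have "approx K (\<lambda>w. 1 / poly r w)" using Suc.hyps(1) by blast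
  moreover have "a \<notin> K" using Suc.prems a by blast
  then have "approx K (\<lambda>w. 1 / (w - a))" by (intro approx_pole_star K star)
  ultimately have "approx K (\<lambda>w. 1 / (w - a) * (1 / poly r w))"
    by (intro approx_mult compact_imp_bounded K)
  then show ?case by (rule approx_cong) (simp add: r left_diff_distrib)
qed

lemma approx_inverse_star:
  assumes K: "compact K" "0 \<in> K" and star: "\<And>t w. 0 \<le> t \<Longrightarrow> t \<le> 1 \<Longrightarrow> w \<in> K \<Longrightarrow> of_real t * w \<in> K"
    and h: "approx K h" and k: "k > 0" "\<And>w. w \<in> K \<Longrightarrow> k \<le> norm (h w)"
  shows "approx K (\<lambda>w. 1 / h w)"
proof (rule approx_limit)
  fix e :: real assume e: "e > 0"
  \<comment> \<open>The first bound keeps the approximating polynomial above \<open>k / 2\<close> in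
    modulus; the second makes the error of the reciprocals at most \<open>e / 2\<close>.\<close>
  define m where "m = min (k/2) (e * k * k / 4)"
  have m: "m > 0" "m \<le> k/2" "m \<le> e * k * k / 4" using e k by (auto simp: m_def)
  obtain q where q: "\<forall>w\<in>K. norm (h w - poly q w) < m" using approxD[OF h m(1)] by blast
  have low: "norm (poly q w) \<ge> k/2" if "w \<in> K" for w
  proof -
    have "norm (h w - poly q w) \<le> k/2" using q that m(2) by fastforce
    then show ?thesis using k(2)[OF that] norm_triangle_ineq2[of "h w" "poly q w"] by linarith
  qed
  have "approx K (\<lambda>w. 1 / poly q w)"
    using low k(1) by (intro approx_inverse_poly_star K star) fastforce+
  moreover have "norm (1 / h w - 1 / poly q w) < e" if "w \<in> K" for w
  proof -
    have ne: "h w \<noteq> 0" "poly q w \<noteq> 0" using low[OF that] k(1) k(2)[OF that] by auto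
    have "norm (1 / h w - 1 / poly q w) = norm (h w - poly q w) / (norm (h w) * norm (poly q w))"
    proof -
      have "1 / h w - 1 / poly q w = - ((h w - poly q w) / (h w * poly q w))"
        using ne by (simp add: divide_simps)
      then show ?thesis by (simp only: norm_minus_cancel norm_divide norm_mult)
    qed
    also have "\<dots> \<le> m / (k * (k/2))"
      using q that low[OF that] k m(1) by (intro frac_le mult_mono) (auto intro: less_imp_le)
    also have "\<dots> \<le> (e * k * k / 4) / (k * (k/2))"
      using m k by (intro divide_right_mono) auto
    also have "\<dots> < e" using k e by simp
    finally show ?thesis .
  qed
  ultimately show "\<exists>g. approx K g \<and> (\<forall>w\<in>K. norm (1 / h w - g w) < e)" by blast
qed

lemma approx_exp:
  assumes K: "bounded K"
  shows "approx K (\<lambda>w. exp (c * w))"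
proof (rule approx_limit)
  fix e :: real assume e: "e > 0"
  obtain B where B: "B > 0" "\<And>w. w \<in> K \<Longrightarrow> norm w \<le> B" using K bounded_pos by blast
  have "uniform_limit (cball 0 (norm c * B)) (\<lambda>n x. \<Sum>i<n. inverse (fact i) * x ^ i :: complex) exp sequentially"
    unfolding exp_def scaleR_conv_of_real of_real_inverse of_real_fact
    by (rule Weierstrass_m_test[where M = "\<lambda>n. inverse (fact n) * (norm c * B) ^ n"])
       (auto simp: norm_mult norm_power norm_inverse power_mono intro!: summable_exp)
  then have "\<forall>\<^sub>F n in sequentially. \<forall>x\<in>cball (0::complex) (norm c * B).
      dist (\<Sum>i<n. inverse (fact i) * x ^ i) (exp x) < e"
    by (rule uniform_limitD[OF _ e])
  then obtain N where N: "\<forall>x\<in>cball (0::complex) (norm c * B). dist (\<Sum>i<N. inverse (fact i) * x ^ i) (exp x) < e"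
    using eventually_happens'[OF sequentially_bot] by blast
  let ?g = "\<lambda>w. \<Sum>i<N. inverse (fact i) * (c * w) ^ i"
  have "approx K ?g"
    by (intro approx_sum approx_mult approx_power approx_const approx_id K)
  moreover have "norm (exp (c * w) - ?g w) < e" if "w \<in> K" for w
  proof -
    have "norm c * norm w \<le> norm c * B" using B(2)[OF that] by (rule mult_left_mono) simp
    then have "c * w \<in> cball 0 (norm c * B)" by (simp add: norm_mult)
    then show ?thesis using N by (metis dist_norm dist_commute)
  qed
  ultimately show "\<exists>g. approx K g \<and> (\<forall>w\<in>K. norm (exp (c * w) - g w) < e)" by blast
qed

section \<open>Kallin-type criteria for hulls\<close>

lemma in_hull_approx:
  assumes z: "in_hull K z" and K: "compact K" and f: "cpoly2 f" and p: "cpoly2 p"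
    and h: "approx (insert (f z) (f ` K)) h"
    and M: "\<And>w. w \<in> K \<Longrightarrow> norm (p w * h (f w)) \<le> M"
  shows "norm (p z * h (f z)) \<le> M"
proof (rule field_le_epsilon)
  fix e :: real assume e: "e > 0"
  have "compact (insert z K)" using K by simp
  then obtain B where B: "B > 0" "\<And>w. w \<in> insert z K \<Longrightarrow> norm (p w) \<le> B"
    using cpoly2_compact_bound[OF p] by blast
  obtain q where q: "\<forall>w\<in>insert (f z) (f ` K). norm (h w - poly q w) < e / (2 * B)"
    using approxD[OF h, of "e / (2 * B)"] e B(1) by auto
  have diff: "norm (p w * h (f w) - p w * poly q (f w)) \<le> e / 2" if "w \<in> insert z K" for w
  proof -
    have "norm (h (f w) - poly q (f w)) \<le> e / (2 * B)" using q that by fastforce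
    then have "norm (p w) * norm (h (f w) - poly q (f w)) \<le> B * (e / (2 * B))"
      using B(1) B(2)[OF that] by (intro mult_mono) auto
    then show ?thesis using B(1) by (simp add: norm_mult [symmetric] right_diff_distrib)
  qed
  have "norm (p z * poly q (f z)) \<le> M + e / 2"
  proof (rule in_hullD[OF z, where p = "\<lambda>w. p w * poly q (f w)"])
    show "cpoly2 (\<lambda>w. p w * poly q (f w))" by (intro cpoly2_mult cpoly2_poly f p)
    fix w assume w: "w \<in> K"
    show "norm (p w * poly q (f w)) \<le> M + e / 2"
      using M[OF w] diff[of w] w norm_triangle_sub[of "p w * poly q (f w)" "p w * h (f w)"]
      by (simp add: norm_minus_commute)
  qed
  then show "norm (p z * h (f z)) \<le> M + e"
    using diff[of z] norm_triangle_sub[of "p z * h (f z)" "p z * poly q (f z)"] by simp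
qed

lemma in_hull_image_ray:
  assumes z: "in_hull K z" and K: "compact K" and f: "cpoly2 f"
    and C: "closed C" "f ` K \<subseteq> C" and u: "u \<noteq> 0"
    and ray: "\<And>s. s \<ge> 0 \<Longrightarrow> f z + of_real s * u \<notin> C"
  shows False
proof -
  have fK: "compact (f ` K)"
    by (intro compact_continuous_image continuous_on_cpoly2 f continuous_on_id K)
  obtain d where d: "d > 0" "\<And>s w. s \<ge> 0 \<Longrightarrow> w \<in> f ` K \<Longrightarrow> d \<le> norm (w - (f z + of_real s * u))"
  proof (rule ray_positive_distance[OF compact_imp_closed[OF fK] compact_imp_bounded[OF fK] u])
    show "f z + of_real s * u \<notin> f ` K" if "s \<ge> 0" for s using ray[OF that] C(2) by blast
  qed blast
  define t where "t = d / (2 * norm u)"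
  have t: "t > 0" using d u by (simp add: t_def)
  define a where "a = f z + of_real t * u"
  have a: "norm (f z - a) = d / 2" using t u by (simp add: a_def norm_mult) (simp add: t_def)
  have far: "d / 2 \<le> norm (w - (a + of_real s * u))"
    if "s \<ge> 0" "w \<in> insert (f z) (f ` K)" for s w
  proof -
    have eq: "a + of_real s * u = f z + of_real (t + s) * u"
      by (simp add: a_def algebra_simps)
    show ?thesis
    proof (cases "w = f z")
      case True
      have "d / 2 = t * norm u" using u by (simp add: t_def)
      also have "\<dots> \<le> (t + s) * norm u" using that by (intro mult_right_mono) auto
      finally show ?thesis unfolding eq True using t that by (simp add: norm_mult del: of_real_add)
    next
      case False
      then show ?thesis unfolding eq using d(2)[of "t + s" w] that t d(1) by auto
    qed
  qed
  have "norm (1 * (1 / (f z - a))) \<le> 1 / d"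
  proof (rule in_hull_approx[OF z K f cpoly2_const, where h = "\<lambda>w. 1 / (w - a)"])
    show "approx (insert (f z) (f ` K)) (\<lambda>w. 1 / (w - a))"
      by (rule approx_pole_ray[OF _ u, of _ "d/2"])
         (use fK d far in \<open>auto intro: compact_imp_bounded\<close>)
    fix w assume "w \<in> K"
    then show "norm (1 * (1 / (f w - a))) \<le> 1 / d"
      using d(2)[of t "f w"] t d(1) by (simp add: norm_divide a_def frac_le)
  qed
  then show False using a d(1) by (simp add: norm_divide divide_simps)
qed

text \<open>If a polynomial were larger at \<open>z\<close> than on \<open>S\<close>, a high power
  of it times a suitable \<open>h\<close> would violate the hull inequality on \<open>K\<close>:
  \<open>h\<close> is tiny where the power is large, bounded by \<open>A\<close> elsewhere, and not
  small at \<open>z\<close>.\<close>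

lemma in_hull_localize:
  assumes z: "in_hull K z" and K: "compact K" and f: "cpoly2 f" and S: "S \<subseteq> K" and A: "A > 0"
    and loc: "\<And>F d. compact F \<Longrightarrow> F \<subseteq> K \<Longrightarrow> F \<inter> S = {} \<Longrightarrow> d > 0 \<Longrightarrow>
      \<exists>h. approx (insert (f z) (f ` K)) h \<and> (\<forall>w\<in>K. norm (h (f w)) \<le> A) \<and>
          (\<forall>w\<in>F. norm (h (f w)) \<le> d) \<and> 1 \<le> norm (h (f z))"
  shows "in_hull S z"
proof -
  have main: "norm (p z) \<le> M"
    if p: "cpoly2 p" and M: "M \<ge> 0" "\<And>w. w \<in> S \<Longrightarrow> norm (p w) \<le> M" for p M
  proof (rule ccontr)
    assume "\<not> norm (p z) \<le> M"
    then obtain M' where M': "M < M'" "M' < norm (p z)" using dense[of M "norm (p z)"] by auto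
    \<comment> \<open>Scaling by a value strictly between the bound on \<open>S\<close> and the
      modulus at \<open>z\<close> gives \<open>|r| < 1\<close> on \<open>S\<close> and
      \<open>|r| > 1\<close> at \<open>z\<close>; hence the set \<open>F\<close> below misses
      \<open>S\<close>.\<close>
    define r where "r = (\<lambda>w. of_real (1 / M') * p w)"
    have r: "cpoly2 r" unfolding r_def by (intro cpoly2_mult cpoly2_const p)
    have nr: "norm (r w) = norm (p w) / M'" for w
      using M' M(1) by (simp add: r_def norm_mult norm_divide)
    have rz: "norm (r z) > 1" using M' M(1) by (simp add: nr)
    obtain B where B: "B > 0" "\<And>w. w \<in> K \<Longrightarrow> norm (r w) \<le> B"
      using cpoly2_compact_bound[OF r K] by blast
    define F where "F = {w \<in> K. 1 \<le> norm (r w)}"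
    have "F = K \<inter> {w. 1 \<le> norm (r w)}" by (auto simp: F_def)
    moreover have "closed {w. 1 \<le> norm (r w)}"
      by (intro closed_Collect_le continuous_on_norm continuous_on_cpoly2 r continuous_on_const continuous_on_id)
    ultimately have F: "compact F" using K by (simp add: compact_Int_closed)
    have FS: "F \<inter> S = {}"
      using M M' by (force simp: F_def nr le_divide_eq)
    obtain n where n: "norm (r z) ^ n > A" using real_arch_pow[OF rz] by blast
    have d: "A / B ^ n > 0" using A B(1) by simp
    obtain h where h: "approx (insert (f z) (f ` K)) h" "\<And>w. w \<in> K \<Longrightarrow> norm (h (f w)) \<le> A"
      "\<And>w. w \<in> F \<Longrightarrow> norm (h (f w)) \<le> A / B ^ n" "1 \<le> norm (h (f z))"
      using loc[OF F _ FS d] by (auto simp: F_def)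
    have "norm (r z ^ n * h (f z)) \<le> A"
    proof (rule in_hull_approx[OF z K f cpoly2_power[OF r] h(1)])
      fix w assume w: "w \<in> K"
      have "norm (r w ^ n) * norm (h (f w)) \<le> A"
      proof (cases "w \<in> F")
        case True
        then have "norm (r w ^ n) * norm (h (f w)) \<le> B ^ n * (A / B ^ n)"
          using B w h(3) unfolding norm_power by (intro mult_mono power_mono) auto
        then show ?thesis using B(1) by simp
      next
        case False
        then have "norm (r w ^ n) * norm (h (f w)) \<le> 1 * A"
          using w h(2)[OF w] by (intro mult_mono) (auto simp: F_def norm_power power_le_one)
        then show ?thesis by simp
      qed
      then show "norm (r w ^ n * h (f w)) \<le> A" by (simp add: norm_mult)
    qed
    moreover have "norm (r z) ^ n * 1 \<le> norm (r z) ^ n * norm (h (f z))"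
      using h(4) by (intro mult_left_mono) auto
    ultimately show False using n by (simp add: norm_mult norm_power)
  qed
  \<comment> \<open>On an empty \<open>S\<close> the constant 1 would satisfy the bound 0.
    Nonemptiness then makes every admissible \<open>M\<close> nonnegative, as \<open>main\<close>
    requires.\<close>
  have ne: "S \<noteq> {}"
    using main[of "\<lambda>_. 1" 0] by (auto intro: cpoly2_const)
  show ?thesis
    unfolding in_hull_def
  proof (intro allI impI)
    fix p M assume p: "cpoly2 p" and M: "\<forall>w\<in>S. norm (p w) \<le> M"
    obtain w where "w \<in> S" using ne by blast
    then have "M \<ge> 0" using M norm_ge_zero[of "p w"] by (meson order_trans)
    then show "norm (p z) \<le> M" using M main[OF p] by blast
  qed
qed

text \<open>The rational functions \<open>(c - a) / (w - a)\<close> with \<open>a\<close> tending to \<open>c = f z\<close> peak at \<open>c\<close>.\<close>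

lemma in_hull_fibre:
  assumes z: "in_hull K z" and K: "compact K" and f: "cpoly2 f" and m: "m > 0"
    and peak: "\<And>e. e > 0 \<Longrightarrow> \<exists>a u d. 0 < norm (f z - a) \<and> norm (f z - a) \<le> e \<and> u \<noteq> 0 \<and> d > 0 \<and>
        (\<forall>w\<in>f ` K. m * norm (f z - a) \<le> norm (w - a)) \<and>
        (\<forall>s\<ge>0. \<forall>w\<in>insert (f z) (f ` K). d \<le> norm (w - (a + of_real s * u)))"
  shows "in_hull {w \<in> K. f w = f z} z"
proof (rule in_hull_localize[OF z K f])
  show "1 / m > 0" using m by simp
  fix F and \<delta> :: real assume F: "compact F" "F \<subseteq> K" "F \<inter> {w \<in> K. f w = f z} = {}" and \<delta>: "\<delta> > 0"
  have "compact (f ` F)"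
    by (intro compact_continuous_image continuous_on_cpoly2 f continuous_on_id F)
  moreover have "f z \<notin> f ` F" using F by force
  ultimately obtain \<rho> where \<rho>: "\<rho> > 0" "\<And>w. w \<in> F \<Longrightarrow> \<rho> \<le> norm (f z - f w)"
    using separate_point_closed[of "f ` F" "f z"] by (auto simp: dist_norm compact_imp_closed)
  define e where "e = min (\<rho> / 2) (\<delta> * (\<rho> / 2))"
  have e: "e > 0" "e \<le> \<rho> / 2" "e \<le> \<delta> * (\<rho> / 2)" using \<rho>(1) \<delta> by (auto simp: e_def)
  obtain a u d where a: "0 < norm (f z - a)" "norm (f z - a) \<le> e" "u \<noteq> 0" "d > 0"
    and a1: "\<forall>w\<in>f ` K. m * norm (f z - a) \<le> norm (w - a)"
    and a2: "\<forall>s\<ge>0. \<forall>w\<in>insert (f z) (f ` K). d \<le> norm (w - (a + of_real s * u))"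
    using peak[OF e(1)] by blast
  have near: "m * norm (f z - a) \<le> norm (f w - a)" if "w \<in> K" for w using a1 that by blast
  have ray: "d \<le> norm (w - (a + of_real s * u))" if "s \<ge> 0" "w \<in> insert (f z) (f ` K)" for s w
    using a2 that by blast
  have bdd: "bounded (insert (f z) (f ` K))"
    using compact_imp_bounded[OF compact_continuous_image[OF continuous_on_cpoly2[OF f continuous_on_id] K]]
    by simp
  let ?h = "\<lambda>w. (f z - a) * (1 / (w - a))"
  have h: "norm (?h w) = norm (f z - a) / norm (w - a)" for w by (simp add: norm_divide norm_mult)
  have "approx (insert (f z) (f ` K)) ?h"
    by (intro approx_mult approx_const bdd approx_pole_ray[OF bdd a(3,4)] ray)
  moreover have "norm (?h (f w)) \<le> 1 / m" if w: "w \<in> K" for w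
  proof -
    have "norm (f w - a) > 0" using a(1) near[OF w] m less_le_trans[OF mult_pos_pos] by blast
    then show ?thesis unfolding h using near[OF w] m by (simp add: divide_simps mult_ac)
  qed
  moreover have "norm (?h (f w)) \<le> \<delta>" if w: "w \<in> F" for w
  proof -
    have "norm (f w - a) \<ge> \<rho> / 2"
      using norm_triangle_ineq[of "f z - a" "a - f w"] a(2) e(2) \<rho>(2)[OF w] by (simp add: norm_minus_commute)
    then have "norm (?h (f w)) \<le> (\<delta> * (\<rho> / 2)) / (\<rho> / 2)"
      unfolding h using a(2) e(3) \<rho>(1) \<delta> by (intro frac_le) auto
    then show ?thesis using \<rho>(1) by simp
  qed
  moreover have "1 \<le> norm (?h (f z))" unfolding h using a(1) by simp
  ultimately show "\<exists>h. approx (insert (f z) (f ` K)) h \<and> (\<forall>w\<in>K. norm (h (f w)) \<le> 1 / m) \<and>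
      (\<forall>w\<in>F. norm (h (f w)) \<le> \<delta>) \<and> 1 \<le> norm (h (f z))" by blast
qed auto

text \<open>The zeros of \<open>1 + exp (i u)\<close> are the odd multiples of \<open>pi\<close>,
  and the double cone avoids them. For \<open>|u| >= pi/2\<close> in the upper cone the exponential
  is bounded away from 1 in modulus; for \<open>|u| < pi/2\<close> its real part is nonnegative. The
  lower cone follows by factoring out \<open>exp (i u)\<close>.\<close>

lemma one_plus_exp_cone_bound:
  assumes c: "c > 0"
  obtains k where "k > 0" "\<And>u. c * norm u \<le> \<bar>Im u\<bar> \<Longrightarrow> k \<le> norm (1 + exp (\<i> * u))"
proof -
  define k where "k = min 1 (1 - exp (- (c * (pi/2))))"
  have k: "k > 0" using c by (simp add: k_def)
  have up: "k \<le> norm (1 + exp (\<i> * u))" if u: "c * norm u \<le> Im u" for u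
  proof (cases "norm u \<ge> pi / 2")
    case True
    have "c * (pi / 2) \<le> Im u" using True c u by (meson mult_left_mono less_imp_le order_trans)
    then have "norm (exp (\<i> * u)) \<le> exp (- (c * (pi / 2)))" by (simp add: norm_exp_eq_Re)
    moreover have "1 - norm (exp (\<i> * u)) \<le> norm (1 + exp (\<i> * u))"
      using norm_triangle_ineq2[of 1 "- exp (\<i> * u)"] by (simp only: norm_minus_cancel norm_one diff_minus_eq_add)
    ultimately show ?thesis unfolding k_def by linarith
  next
    case False
    then have "\<bar>Re u\<bar> < pi / 2" using abs_Re_le_cmod[of u] by linarith
    then have "cos (Re u) \<ge> 0" by (intro cos_ge_zero) auto
    then have "1 \<le> Re (1 + exp (\<i> * u))" by (simp add: Re_exp)
    moreover have "k \<le> 1" by (simp add: k_def)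
    ultimately show ?thesis using complex_Re_le_cmod[of "1 + exp (\<i> * u)"] by linarith
  qed
  show ?thesis
  proof (rule that[OF k])
    fix u assume u: "c * norm u \<le> \<bar>Im u\<bar>"
    show "k \<le> norm (1 + exp (\<i> * u))"
    proof (cases "Im u \<ge> 0")
      case True
      then show ?thesis using u by (intro up) simp
    next
      case False
      have "1 + exp (\<i> * u) = exp (\<i> * u) * (1 + exp (\<i> * (- u)))"
        by (simp add: ring_distribs exp_minus)
      moreover have "k \<le> norm (1 + exp (\<i> * (- u)))" using u False by (intro up) simp
      moreover have "norm (exp (\<i> * u)) \<ge> 1" using False by (simp add: norm_exp_eq_Re)
      ultimately show ?thesis
        using mult_mono[of 1 "norm (exp (\<i> * u))" k "norm (1 + exp (\<i> * (- u)))"] k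
        by (simp add: norm_mult)
    qed
  qed
qed

text \<open>On a double cone around the imaginary axis \<open>1 / (1 + exp (i t w))\<close> is bounded uniformly in
  \<open>t\<close>; for large \<open>t\<close> it is small on the lower cone away from \<open>0\<close>, while its modulus stays above
  \<open>1/2\<close> on the upper one.\<close>

lemma in_hull_cone_separation:
  assumes z: "in_hull K z" and K: "compact K" and f: "cpoly2 f" and c: "c > 0"
    and cone: "\<And>w. w \<in> insert z K \<Longrightarrow> c * norm (f w) \<le> \<bar>Im (f w)\<bar>"
    and fz: "Im (f z) > 0"
  shows "in_hull {w \<in> K. Im (f w) \<ge> 0} z"
proof -
  obtain k where k: "k > 0" "\<And>u. c * norm u \<le> \<bar>Im u\<bar> \<Longrightarrow> k \<le> norm (1 + exp (\<i> * u))"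
    using one_plus_exp_cone_bound[OF c] by blast
  have k': "k \<le> norm (1 + exp (\<i> * of_real t * w))" if "t > 0" "c * norm w \<le> \<bar>Im w\<bar>" for t w
  proof -
    have "t * (c * norm w) \<le> t * \<bar>Im w\<bar>" using that by (intro mult_left_mono) auto
    then have "c * norm (of_real t * w) \<le> \<bar>Im (of_real t * w)\<bar>"
      using that by (simp add: norm_mult abs_mult mult.left_commute)
    from k(2)[OF this] show ?thesis by (simp add: mult.assoc)
  qed
  have "compact (f ` insert z K)"
    using K by (intro compact_continuous_image continuous_on_cpoly2 f continuous_on_id) simp
  then obtain R where "R > 0" "\<forall>x\<in>f ` insert z K. norm x \<le> R"
    using compact_imp_bounded bounded_pos by blast
  then have R: "R > 0" "\<And>w. w \<in> insert z K \<Longrightarrow> norm (f w) \<le> R" by auto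
  \<comment> \<open>The double cone cut by a disc is star-shaped about 0, so
    \<open>approx_inverse_star\<close> provides polynomial approximation on all of it.\<close>
  define C where "C = {w. c * norm w \<le> \<bar>Im w\<bar>} \<inter> cball 0 R"
  have C: "compact C" "0 \<in> C"
    unfolding C_def using R(1)
    by (auto intro!: closed_Int_compact closed_Collect_le continuous_intros)
  have star: "of_real t * w \<in> C" if "0 \<le> t" "t \<le> 1" "w \<in> C" for t w
  proof -
    have "norm w \<le> R" "c * norm w \<le> \<bar>Im w\<bar>" using that by (auto simp: C_def)
    then have "t * norm w \<le> 1 * R" "t * (c * norm w) \<le> t * \<bar>Im w\<bar>"
      using that mult_mono[of t 1 "norm w" R] mult_left_mono[of "c * norm w" "\<bar>Im w\<bar>" t] by auto
    then show ?thesis using that by (auto simp: C_def norm_mult abs_mult mult_ac)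
  qed
  have sub: "insert (f z) (f ` K) \<subseteq> C" using cone R by (auto simp: C_def)
  have h: "approx C (\<lambda>w. 1 / (1 + exp (\<i> * of_real t * w)))" if "t > 0" for t
  proof (rule approx_inverse_star[OF C])
    show "approx C (\<lambda>w. 1 + exp (\<i> * of_real t * w))"
      by (intro approx_add approx_const approx_exp compact_imp_bounded C)
    fix w assume "w \<in> C"
    then show "k \<le> norm (1 + exp (\<i> * of_real t * w))"
      using k'[OF that, of w] by (simp add: C_def)
  qed (use star k in auto)
  show ?thesis
  proof (rule in_hull_localize[OF z K f])
    show "2 / k > 0" using k by simp
    fix F and \<delta> :: real
    assume F: "compact F" "F \<subseteq> K" "F \<inter> {w \<in> K. Im (f w) \<ge> 0} = {}" and \<delta>: "\<delta> > 0"
    have "compact (f ` F)"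
      by (intro compact_continuous_image continuous_on_cpoly2 f continuous_on_id F)
    moreover have "0 \<notin> f ` F" using F by force
    ultimately obtain \<rho> where \<rho>: "\<rho> > 0" "\<And>w. w \<in> F \<Longrightarrow> \<rho> \<le> norm (f w)"
      using separate_point_closed[of "f ` F" 0] by (auto simp: compact_imp_closed)
    \<comment> \<open>Chosen so that \<open>exp (t c \<rho>) = 1 + 2 / \<delta>\<close>; subtracting
      the summand 1 leaves the bound \<open>2 / \<delta>\<close> needed on \<open>F\<close>.\<close>
    define t where "t = ln (1 + 2 / \<delta>) / (c * \<rho>)"
    have t: "t > 0" unfolding t_def using c \<rho>(1) \<delta> by (intro divide_pos_pos ln_gt_zero mult_pos_pos) auto
    have expt: "exp (t * (c * \<rho>)) = 1 + 2 / \<delta>"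
    proof -
      have "1 + 2 / \<delta> > 0" using \<delta> by (simp add: add_pos_pos)
      then show ?thesis using c \<rho>(1) by (simp add: t_def)
    qed
    \<comment> \<open>The factor 2 is needed at \<open>f z\<close>, where the denominator has
      modulus at most 2.\<close>
    let ?h = "\<lambda>w. 2 * (1 / (1 + exp (\<i> * of_real t * w)))"
    have "approx (insert (f z) (f ` K)) ?h"
      by (rule approx_subset[OF approx_mult[OF compact_imp_bounded[OF C(1)] approx_const h[OF t]] sub])
    moreover have "norm (?h (f w)) \<le> 2 / k" if w: "w \<in> K" for w
      using k'[OF t, of "f w"] cone w k(1) by (simp add: norm_divide frac_le)
    moreover have "norm (?h (f w)) \<le> \<delta>" if w: "w \<in> F" for w
    proof -
      have wK: "w \<in> K" using w F(2) by blast
      then have "Im (f w) < 0" using w F(3) by force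
      moreover have "c * \<rho> \<le> c * norm (f w)" using \<rho>(2)[OF w] c by (intro mult_left_mono) auto
      ultimately have "c * \<rho> \<le> - Im (f w)" using cone[of w] wK by auto
      then have "t * (c * \<rho>) \<le> t * (- Im (f w))" using t by (intro mult_left_mono) auto
      then have "exp (t * (c * \<rho>)) \<le> norm (exp (\<i> * of_real t * f w))"
        by (simp add: norm_exp_eq_Re)
      then have big: "2 / \<delta> \<le> norm (1 + exp (\<i> * of_real t * f w))"
        unfolding expt using norm_triangle_ineq2[of "exp (\<i> * of_real t * f w)" "-1"] by (simp add: add.commute)
      then have "2 / norm (1 + exp (\<i> * of_real t * f w)) \<le> 2 / (2 / \<delta>)"
        using \<delta> less_le_trans[OF _ big, of 0] by (intro divide_left_mono big mult_pos_pos) auto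
      then show ?thesis using \<delta> by (simp add: norm_divide)
    qed
    moreover have "1 \<le> norm (?h (f z))"
    proof -
      have "norm (exp (\<i> * of_real t * f z)) \<le> 1" using fz t by (simp add: norm_exp_eq_Re)
      then have "norm (1 + exp (\<i> * of_real t * f z)) \<le> 2"
        using norm_triangle_ineq[of 1 "exp (\<i> * of_real t * f z)"] norm_one[where 'a=complex] by linarith
      moreover have "norm (1 + exp (\<i> * of_real t * f z)) > 0"
        by (rule less_le_trans[OF k(1) k'[OF t cone]]) simp
      ultimately show ?thesis by (simp add: norm_divide)
    qed
    ultimately show "\<exists>h. approx (insert (f z) (f ` K)) h \<and> (\<forall>w\<in>K. norm (h (f w)) \<le> 2 / k) \<and>
      (\<forall>w\<in>F. norm (h (f w)) \<le> \<delta>) \<and> 1 \<le> norm (h (f z))" by blast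
  qed auto
qed

lemma cpoly2_preimage_compact:
  assumes K: "compact K" and f: "cpoly2 f" and C: "closed C"
  shows "compact {w \<in> K. f w \<in> C}"
proof -
  have "{w \<in> K. f w \<in> C} = K \<inter> f -` C" by auto
  moreover have "closed (f -` C)"
    by (rule closed_vimage[OF C continuous_on_cpoly2[OF f continuous_on_id]])
  ultimately show ?thesis using K by (simp add: compact_Int_closed)
qed

text \<open>The value \<open>f z\<close> lies in the double cone, since otherwise the ray from
  \<open>f z\<close> away from 0 would escape. Off the vertex, cone separation passes to the hull of
  one half of \<open>K\<close>. At the vertex, poles approach 0 along the positive real axis, which
  meets the cone only in 0, and \<open>zero\<close> puts the remaining fibre into
  \<open>E1\<close>.\<close>

lemma hull_closed_Un_kallin:
  assumes E1: "hull_closed E1" and E2: "hull_closed E2" and f: "cpoly2 f" and c: "c > 0"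
    and f1: "\<And>w. w \<in> E1 \<Longrightarrow> c * norm (f w) \<le> Im (f w)"
    and f2: "\<And>w. w \<in> E2 \<Longrightarrow> c * norm (f w) \<le> - Im (f w)"
    and zero: "\<And>w. w \<in> E1 \<union> E2 \<Longrightarrow> f w = 0 \<Longrightarrow> w \<in> E1 \<inter> E2"
  shows "hull_closed (E1 \<union> E2)"
  unfolding hull_closed_def
proof (intro allI impI, elim conjE)
  fix K z assume K: "compact K" "K \<subseteq> E1 \<union> E2" and z: "in_hull K z"
  define C where "C = {w. c * norm w \<le> \<bar>Im w\<bar>}"
  have C: "closed C" unfolding C_def by (intro closed_Collect_le continuous_intros)
  have fK: "f w \<in> C" if "w \<in> K" for w
    using f1[of w] f2[of w] K(2) that by (auto simp: C_def)
  have fz: "f z \<in> C"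
  proof (rule ccontr)
    assume n: "f z \<notin> C"
    then have "f z \<noteq> 0" by (auto simp: C_def)
    moreover have "f z + of_real s * f z \<notin> C" if "s \<ge> 0" for s
    proof
      assume "f z + of_real s * f z \<in> C"
      moreover have "f z + of_real s * f z = of_real (1 + s) * f z" by (simp add: algebra_simps)
      ultimately have "c * ((1 + s) * norm (f z)) \<le> (1 + s) * \<bar>Im (f z)\<bar>"
        using that by (simp add: C_def norm_mult abs_mult del: of_real_add)
      then have "(1 + s) * (c * norm (f z)) \<le> (1 + s) * \<bar>Im (f z)\<bar>" by (simp add: mult.left_commute)
      then show False using n that by (simp add: C_def)
    qed
    ultimately show False using in_hull_image_ray[OF z K(1) f C, of "f z"] fK by blast
  qed
  have in1: "w \<in> E1" if "w \<in> K" "Im (f w) \<ge> 0" for w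
  proof (cases "w \<in> E1")
    case False
    then have "w \<in> E2" using K(2) that by blast
    then have "c * norm (f w) \<le> 0" using f2 that(2) by force
    then have "f w = 0" using c by (simp add: mult_le_0_iff)
    then show ?thesis using zero \<open>w \<in> E2\<close> by blast
  qed
  have in2: "w \<in> E2" if "w \<in> K" "Im (f w) \<le> 0" for w
  proof (cases "w \<in> E2")
    case False
    then have "w \<in> E1" using K(2) that by blast
    then have "c * norm (f w) \<le> 0" using f1 that(2) by force
    then have "f w = 0" using c by (simp add: mult_le_0_iff)
    then show ?thesis using zero \<open>w \<in> E1\<close> by blast
  qed
  consider "Im (f z) > 0" | "Im (f z) < 0" | "f z = 0"
    using fz c by (force simp: C_def mult_le_0_iff)
  then show "z \<in> E1 \<union> E2"
  proof cases
    case 1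
    have "in_hull {w \<in> K. Im (f w) \<ge> 0} z"
      using fz fK by (intro in_hull_cone_separation[OF z K(1) f c _ 1]) (auto simp: C_def)
    moreover have "compact {w \<in> K. f w \<in> {v. Im v \<ge> 0}}"
      by (intro cpoly2_preimage_compact K f closed_halfspace_Im_ge)
    ultimately show ?thesis using hull_closedD[OF E1, of "{w \<in> K. Im (f w) \<ge> 0}" z] in1 by auto
  next
    case 2
    let ?g = "\<lambda>w. (- 1) * f w"
    have "in_hull {w \<in> K. Im (?g w) \<ge> 0} z"
    proof (rule in_hull_cone_separation[OF z K(1) _ c])
      show "cpoly2 ?g" by (intro cpoly2_mult cpoly2_const f)
    qed (use fz fK 2 in \<open>auto simp: C_def\<close>)
    moreover have "compact {w \<in> K. f w \<in> {v. Im v \<le> 0}}"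
      by (intro cpoly2_preimage_compact K f closed_halfspace_Im_le)
    ultimately show ?thesis using hull_closedD[OF E2, of "{w \<in> K. Im (f w) \<le> 0}" z] in2 by auto
  next
    case 3
    \<comment> \<open>Combines \<open>c |w| <= |w - e|\<close>, valid because \<open>e\<close> is
      real, with the triangle inequality \<open>e <= |w| + |w - e|\<close>.\<close>
    define m where "m = c / (1 + c)"
    have m: "m > 0" using c by (simp add: m_def)
    have dist: "m * e \<le> norm (w - of_real e)" if "w \<in> C" "e > 0" for w e
    proof -
      let ?n = "norm (w - of_real e)"
      have "c * norm w \<le> ?n"
        using that(1) abs_Im_le_cmod[of "w - of_real e"] by (simp add: C_def)
      moreover have "e \<le> norm w + ?n"
        using norm_triangle_ineq4[of w "w - of_real e"] that(2) by simp
      then have "c * e \<le> c * (norm w + ?n)" using c by simp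
      ultimately have "c * e \<le> (1 + c) * ?n" by (simp add: algebra_simps)
      then show ?thesis using c by (simp add: m_def divide_simps mult_ac)
    qed
    have "in_hull {w \<in> K. f w = f z} z"
    proof (rule in_hull_fibre[OF z K(1) f m])
      fix e :: real assume e: "e > 0"
      have near: "\<forall>w\<in>f ` K. m * norm (f z - of_real e) \<le> norm (w - of_real e)"
        using dist fK e 3 by auto
      have ray: "\<forall>s\<ge>0. \<forall>w\<in>insert (f z) (f ` K). m * e \<le> norm (w - (of_real e + of_real s * 1))"
      proof (intro allI impI ballI)
        fix s :: real and w assume s: "0 \<le> s" and w: "w \<in> insert (f z) (f ` K)"
        have "m * e \<le> m * (e + s)" using s m by simp
        also have "\<dots> \<le> norm (w - of_real (e + s))" using w fz fK s e by (intro dist) auto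
        finally show "m * e \<le> norm (w - (of_real e + of_real s * 1))" by simp
      qed
      show "\<exists>a u d. 0 < norm (f z - a) \<and> norm (f z - a) \<le> e \<and> u \<noteq> 0 \<and> d > 0 \<and>
        (\<forall>w\<in>f ` K. m * norm (f z - a) \<le> norm (w - a)) \<and>
        (\<forall>s\<ge>0. \<forall>w\<in>insert (f z) (f ` K). d \<le> norm (w - (a + of_real s * u)))"
        using near ray e m 3 by (intro exI[of _ "of_real e"] exI[of _ 1] exI[of _ "m * e"]) auto
    qed
    moreover have "compact {w \<in> K. f w \<in> {f z}}"
      by (intro cpoly2_preimage_compact K f closed_singleton)
    moreover have "{w \<in> K. f w = f z} \<subseteq> E1" using in1 3 by auto
    ultimately show ?thesis using hull_closedD[OF E1, of "{w \<in> K. f w = f z}" z] by auto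
  qed
qed

section \<open>Unions of triangular planes\<close>

text \<open>The real line through \<open>p\<close> in direction \<open>a\<close>, as the zero set of
  a signed distance (up to the factor \<open>|a|\<close>); for \<open>a = 0\<close> it degenerates
  to the whole plane.\<close>

definition aline :: "complex \<Rightarrow> complex \<Rightarrow> complex set" where
  "aline p a = {v. Im ((v - p) * cnj a) = 0}"

lemma closed_aline: "closed (aline p a)"
  unfolding aline_def by (intro closed_Collect_eq continuous_intros)

lemma aline_iff:
  assumes "a \<noteq> 0"
  shows "v \<in> aline p a \<longleftrightarrow> (\<exists>x::real. v = p + a * of_real x)"
proof
  assume "v \<in> aline p a"
  then obtain r :: real where r: "(v - p) * cnj a = of_real r"
    by (auto simp only: aline_def mem_Collect_eq complex_is_Real_iff [symmetric] elim: Reals_cases)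
  have "(v - p) * (a * cnj a) = ((v - p) * cnj a) * a" by (simp only: mult_ac)
  then have "(v - p) * (a * cnj a) = of_real r * a" unfolding r .
  then have "(v - p) * of_real ((norm a)^2) = of_real r * a" unfolding complex_norm_square .
  then have "v - p = a * of_real (r / (norm a)^2)" using assms by (simp add: field_simps)
  then show "\<exists>x::real. v = p + a * of_real x" by (metis add.commute diff_add_cancel)
next
  assume "\<exists>x::real. v = p + a * of_real x"
  then obtain x :: real where x: "v = p + a * of_real x" by blast
  have "(v - p) * cnj a = of_real (x * (norm a)^2)"
    using complex_norm_square[of a] by (simp add: x mult_ac)
  then show "v \<in> aline p a"
    unfolding aline_def by (simp only: mem_Collect_eq Im_complex_of_real)
qed

text \<open>The direction \<open>u\<close> is such that neither of the two signed distances ever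
  decreases in modulus along the ray. For three lines this fails: they may enclose a
  triangle.\<close>

lemma two_lines_ray:
  assumes "a1 \<noteq> 0" "a2 \<noteq> 0" and w: "w \<notin> aline p1 a1 \<union> aline p2 a2"
  obtains u where "u \<noteq> 0" "\<And>s. s \<ge> 0 \<Longrightarrow> w + of_real s * u \<notin> aline p1 a1 \<union> aline p2 a2"
proof -
  define X1 where "X1 = Im ((w - p1) * cnj a1)"
  define X2 where "X2 = Im ((w - p2) * cnj a2)"
  have X: "X1 \<noteq> 0" "X2 \<noteq> 0" using w by (auto simp: aline_def X1_def X2_def)
  define D where "D = Im (a1 * cnj a2)"
  \<comment> \<open>For crossing lines this solves \<open>Im (u * cnj a1) = D^2 X1\<close> and
    \<open>Im (u * cnj a2) = D^2 X2\<close>; for parallel lines one moves along them.\<close>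
  define u where "u = (if D = 0 then a1 else of_real (X2 * D) * a1 - of_real (X1 * D) * a2)"
  have D': "Im (a2 * cnj a1) = - D" by (simp add: D_def algebra_simps)
  obtain k1 where k1: "k1 \<ge> 0" "Im (u * cnj a1) = k1 * X1"
  proof (cases "D = 0")
    case True then show ?thesis using that[of 0] by (simp add: u_def)
  next
    case False
    have "Im (u * cnj a1) = X2 * D * Im (a1 * cnj a1) - X1 * D * Im (a2 * cnj a1)"
      using False by (simp add: u_def left_diff_distrib mult.assoc del: mult_1)
    also have "\<dots> = (D * D) * X1" unfolding D' by simp
    finally show ?thesis using that[of "D * D"] by simp
  qed
  obtain k2 where k2: "k2 \<ge> 0" "Im (u * cnj a2) = k2 * X2"
  proof (cases "D = 0")
    case True then show ?thesis using that[of 0] by (simp add: u_def D_def)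
  next
    case False
    have "Im (u * cnj a2) = X2 * D * Im (a1 * cnj a2) - X1 * D * Im (a2 * cnj a2)"
      using False by (simp add: u_def left_diff_distrib mult.assoc)
    also have "\<dots> = (D * D) * X2" unfolding D_def by simp
    finally show ?thesis using that[of "D * D"] by simp
  qed
  have u0: "u \<noteq> 0"
  proof
    assume "u = 0"
    then have "D \<noteq> 0" using assms by (auto simp: u_def)
    have "Im (u * cnj a1) = X2 * D * Im (a1 * cnj a1) - X1 * D * Im (a2 * cnj a1)"
      using \<open>D \<noteq> 0\<close> by (simp add: u_def left_diff_distrib mult.assoc)
    then have "X1 * D * D = 0" unfolding D' using \<open>u = 0\<close> by simp
    then show False using X \<open>D \<noteq> 0\<close> by simp
  qed
  show ?thesis
  proof (rule that[OF u0])
    fix s :: real assume s: "s \<ge> 0"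
    have "Im ((w + of_real s * u - p1) * cnj a1) = X1 + s * Im (u * cnj a1)"
      by (simp add: X1_def algebra_simps)
    also have "\<dots> = (1 + s * k1) * X1" unfolding k1(2) by (simp add: algebra_simps)
    finally have 1: "w + of_real s * u \<notin> aline p1 a1"
      using X s k1(1) by (auto simp: aline_def) (smt (verit) mult_nonneg_nonneg)
    have "Im ((w + of_real s * u - p2) * cnj a2) = X2 + s * Im (u * cnj a2)"
      by (simp add: X2_def algebra_simps)
    also have "\<dots> = (1 + s * k2) * X2" unfolding k2(2) by (simp add: algebra_simps)
    finally have 2: "w + of_real s * u \<notin> aline p2 a2"
      using X s k2(1) by (auto simp: aline_def) (smt (verit) mult_nonneg_nonneg)
    from 1 2 show "w + of_real s * u \<notin> aline p1 a1 \<union> aline p2 a2" by blast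
  qed
qed

lemma in_hull_two_lines:
  assumes "in_hull K z" "compact K" "cpoly2 f" "a1 \<noteq> 0" "a2 \<noteq> 0"
    and "\<And>w. w \<in> K \<Longrightarrow> f w \<in> aline p1 a1 \<union> aline p2 a2"
  shows "f z \<in> aline p1 a1 \<union> aline p2 a2"
proof (rule ccontr)
  assume "f z \<notin> aline p1 a1 \<union> aline p2 a2"
  then obtain u where "u \<noteq> 0" "\<And>s. s \<ge> 0 \<Longrightarrow> f z + of_real s * u \<notin> aline p1 a1 \<union> aline p2 a2"
    using two_lines_ray assms(4,5) by metis
  moreover have "closed (aline p1 a1 \<union> aline p2 a2)" by (intro closed_Un closed_aline)
  moreover have "f ` K \<subseteq> aline p1 a1 \<union> aline p2 a2" using assms(6) by blast
  ultimately show False using in_hull_image_ray[OF assms(1-3)] by blast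
qed

lemma abs_Im_mult_cnj_le: "\<bar>Im (w * cnj c)\<bar> \<le> norm w * norm c"
  using abs_Im_le_cmod[of "w * cnj c"] by (simp add: norm_mult)

text \<open>A union of lines through 0 is invariant under real scaling, so the radial ray starting
  outside it never enters.\<close>

lemma in_hull_lines:
  assumes z: "in_hull K z" and K: "compact K" and f: "cpoly2 f"
    and S: "finite S" "S \<noteq> {}" "0 \<notin> S"
    and fK: "\<And>w. w \<in> K \<Longrightarrow> \<exists>c\<in>S. f w \<in> aline 0 c"
  shows "\<exists>c\<in>S. f z \<in> aline 0 c"
proof (rule ccontr)
  assume n: "\<not> (\<exists>c\<in>S. f z \<in> aline 0 c)"
  let ?C = "\<Union>c\<in>S. aline 0 c"
  have "closed ?C" using S(1) by (intro closed_UN ballI closed_aline)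
  moreover have "f ` K \<subseteq> ?C" using fK by blast
  moreover have "f z \<noteq> 0" using n S(2) by (auto simp: aline_def)
  moreover have "f z + of_real s * f z \<notin> ?C" if "s \<ge> 0" for s
  proof
    assume "f z + of_real s * f z \<in> ?C"
    then obtain c where c: "c \<in> S" "Im ((f z + of_real s * f z) * cnj c) = 0"
      by (auto simp: aline_def)
    have "Im ((f z + of_real s * f z) * cnj c) = (1 + s) * Im (f z * cnj c)"
      by (simp add: algebra_simps)
    then have "Im (f z * cnj c) = 0" using c(2) that by simp
    then show False using n c(1) by (auto simp: aline_def)
  qed
  ultimately show False using in_hull_image_ray[OF z K f] by blast
qed

text \<open>The poles approach \<open>f z\<close> in a direction parallel to none of the lines,
  hence at a distance from all lines comparable to their distance from \<open>f z\<close>, and each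
  pole is pushed out radially.\<close>

lemma in_hull_lines_fibre:
  assumes z: "in_hull K z" and K: "compact K" and f: "cpoly2 f"
    and S: "finite S" "S \<noteq> {}" "0 \<notin> S"
    and fK: "\<And>w. w \<in> K \<Longrightarrow> \<exists>c\<in>S. f w \<in> aline 0 c"
  shows "in_hull {w \<in> K. f w = f z} z"
proof -
  have fz: "\<exists>c\<in>S. f z \<in> aline 0 c" using in_hull_lines[OF assms] by blast
  \<comment> \<open>A slope different from that of every line. Vertical lines give the value 0 by
    division by zero, harmless because \<open>u\<close> has real part 1.\<close>
  obtain t :: real where t: "t \<notin> (\<lambda>c. Im c / Re c) ` S"
    using ex_new_if_finite[OF infinite_UNIV_char_0, of "(\<lambda>c. Im c / Re c) ` S"] S(1) by auto
  define u where "u = Complex 1 t"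
  define g where "g = (\<lambda>c w. Im (w * cnj c) / norm c)"
  have g_le: "\<bar>g c w\<bar> \<le> norm w" if "c \<in> S" for c w
    using abs_Im_mult_cnj_le[of w c] that S(3) by (auto simp: g_def divide_simps)
  have g_add: "g c (v + w) = g c v + g c w" "g c (of_real s * w) = s * g c w" for c v w s
    by (simp_all add: g_def algebra_simps add_divide_distrib [symmetric])
  have gu: "g c u \<noteq> 0" if "c \<in> S" for c
  proof
    assume "g c u = 0"
    then have eq: "t * Re c = Im c" using that S(3) by (auto simp: g_def u_def)
    then have "Re c \<noteq> 0" using that S(3) complex_eqI[of c 0] by force
    then have "t = Im c / Re c" using eq by (simp add: field_simps)
    then show False using t that by blast
  qed
  define m0 where "m0 = Min ((\<lambda>c. \<bar>g c u\<bar>) ` S)"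
  have m0: "m0 > 0" "\<And>c. c \<in> S \<Longrightarrow> m0 \<le> \<bar>g c u\<bar>"
    using S gu by (auto simp: m0_def Min_gr_iff)
  have nu: "norm u > 0" by (simp add: u_def complex_eq_iff)
  \<comment> \<open>If \<open>f z\<close> lies on the line of \<open>c\<close>, the distance grows
    exactly linearly in \<open>e\<close>; otherwise it stays bounded below for small
    \<open>e\<close>.\<close>
  have small: "\<forall>\<^sub>F e in at_right 0. \<forall>c\<in>S. e * \<bar>g c u\<bar> \<le> \<bar>g c (f z + of_real e * u)\<bar>"
    using S(1)
  proof (rule eventually_ball_finite, intro ballI)
    fix c assume c: "c \<in> S"
    show "\<forall>\<^sub>F e in at_right 0. e * \<bar>g c u\<bar> \<le> \<bar>g c (f z + of_real e * u)\<bar>"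
    proof (cases "g c (f z) = 0")
      case True
      have "\<forall>\<^sub>F e in at_right (0::real). e > 0" by (simp add: eventually_at_right_less)
      then show ?thesis by eventually_elim (simp add: g_add True abs_mult)
    next
      case False
      have "\<forall>\<^sub>F e in at_right (0::real). e \<in> {0<..<\<bar>g c (f z)\<bar> / (2 * \<bar>g c u\<bar>)}"
        using False gu[OF c] by (intro eventually_at_right_real) simp
      then show ?thesis
      proof eventually_elim
        case (elim e)
        then have "2 * (e * \<bar>g c u\<bar>) \<le> \<bar>g c (f z)\<bar>" using gu[OF c] by (simp add: field_simps)
        moreover have "\<bar>e * g c u\<bar> = e * \<bar>g c u\<bar>" using elim by (simp add: abs_mult)
        ultimately show ?case unfolding g_add by linarith
      qed
    qed
  qed
  show ?thesis
  proof (rule in_hull_fibre[OF z K f])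
    show "m0 / norm u > 0" using m0 nu by simp
    fix e :: real assume e: "e > 0"
    have "\<forall>\<^sub>F d in at_right (0::real). d \<in> {0<..<e / norm u}"
      using e nu by (intro eventually_at_right_real) simp
    with small have "\<forall>\<^sub>F d in at_right 0. d \<in> {0<..<e / norm u} \<and>
        (\<forall>c\<in>S. d * \<bar>g c u\<bar> \<le> \<bar>g c (f z + of_real d * u)\<bar>)"
      by eventually_elim blast
    then obtain d where "d \<in> {0<..<e / norm u} \<and> (\<forall>c\<in>S. d * \<bar>g c u\<bar> \<le> \<bar>g c (f z + of_real d * u)\<bar>)"
      using eventually_happens'[OF trivial_limit_at_right_real] by blast
    then have d: "0 < d" "d < e / norm u"
      "\<And>c. c \<in> S \<Longrightarrow> d * \<bar>g c u\<bar> \<le> \<bar>g c (f z + of_real d * u)\<bar>" by auto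
    define a where "a = f z + of_real d * u"
    have low: "d * m0 \<le> \<bar>g c a\<bar>" if "c \<in> S" for c
    proof -
      have "d * m0 \<le> d * \<bar>g c u\<bar>" using d(1) m0(2)[OF that] by simp
      then show ?thesis using d(3)[OF that] by (simp add: a_def)
    qed
    have far: "d * m0 \<le> norm (w - (a + of_real s * a))"
      if s: "s \<ge> 0" and w: "\<exists>c\<in>S. w \<in> aline 0 c" for s w
    proof -
      obtain c where c: "c \<in> S" "w \<in> aline 0 c" using w by blast
      have gw: "g c w = 0" using c(2) by (simp add: g_def aline_def)
      have "g c w = g c (w - (a + of_real s * a)) + (g c a + s * g c a)"
        using g_add(1)[of c "w - (a + of_real s * a)" "a + of_real s * a"]
        by (simp only: g_add diff_add_cancel)
      then have "\<bar>g c (w - (a + of_real s * a))\<bar> = \<bar>(1 + s) * g c a\<bar>" using gw by (simp add: algebra_simps)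
      also have "\<dots> = (1 + s) * \<bar>g c a\<bar>" using s by (simp add: abs_mult)
      also have "\<dots> \<ge> 1 * \<bar>g c a\<bar>" using s by (intro mult_right_mono) auto
      finally show ?thesis using low[OF c(1)] g_le[OF c(1), of "w - (a + of_real s * a)"] by linarith
    qed
    have na: "norm (f z - a) = d * norm u" using d(1) by (simp add: a_def norm_mult)
    have "a \<noteq> 0"
    proof
      assume "a = 0"
      obtain c where "c \<in> S" using S(2) by blast
      then have "d * m0 \<le> 0" using low[of c] \<open>a = 0\<close> by (simp add: g_def)
      then show False using d(1) m0(1) by (simp add: mult_le_0_iff)
    qed
    moreover have "0 < norm (f z - a)" "norm (f z - a) \<le> e"
      using d nu by (auto simp: na field_simps)
    moreover have "\<forall>w\<in>f ` K. m0 / norm u * norm (f z - a) \<le> norm (w - a)"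
      using far[of 0] fK nu by (auto simp: na mult.commute)
    moreover have "d * m0 > 0" using d m0 by simp
    moreover have "\<forall>s\<ge>0. \<forall>w\<in>insert (f z) (f ` K). d * m0 \<le> norm (w - (a + of_real s * a))"
      using far fK fz by blast
    ultimately show "\<exists>a v d. 0 < norm (f z - a) \<and> norm (f z - a) \<le> e \<and> v \<noteq> 0 \<and> d > 0 \<and>
        (\<forall>w\<in>f ` K. m0 / norm u * norm (f z - a) \<le> norm (w - a)) \<and>
        (\<forall>s\<ge>0. \<forall>w\<in>insert (f z) (f ` K). d \<le> norm (w - (a + of_real s * v)))"
      by - (rule exI[of _ a], rule exI[of _ a], rule exI[of _ "d * m0"], intro conjI; assumption)
  qed
qed

text \<open>The image of real 2-space under the matrix with rows \<open>(a, b)\<close> and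
  \<open>(0, c)\<close>: for nonzero \<open>a\<close> and \<open>c\<close> it lies over the line of
  \<open>c\<close> in the second coordinate, with fibres parallel to \<open>a\<close>.\<close>

definition tri :: "complex \<Rightarrow> complex \<Rightarrow> complex \<Rightarrow> (complex^2) set" where
  "tri a b c = {z. \<exists>x y::real. z$1 = a * of_real x + b * of_real y \<and> z$2 = c * of_real y}"

lemma tri_iff:
  assumes "a \<noteq> 0" "c \<noteq> 0"
  shows "z \<in> tri a b c \<longleftrightarrow> z$2 \<in> aline 0 c \<and> z$1 \<in> aline (b * (z$2 / c)) a"
proof
  assume "z \<in> tri a b c"
  then obtain x y :: real where z: "z$1 = a * of_real x + b * of_real y" "z$2 = c * of_real y"
    unfolding tri_def by blast
  then have "z$2 / c = of_real y" using assms by simp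
  then have "z$1 = b * (z$2 / c) + a * of_real x" using z by simp
  moreover have "z$2 = 0 + c * of_real y" using z by simp
  ultimately show "z$2 \<in> aline 0 c \<and> z$1 \<in> aline (b * (z$2 / c)) a"
    unfolding aline_iff[OF assms(1)] aline_iff[OF assms(2)] by blast
next
  assume "z$2 \<in> aline 0 c \<and> z$1 \<in> aline (b * (z$2 / c)) a"
  then obtain x y :: real where z: "z$1 = b * (z$2 / c) + a * of_real x" "z$2 = 0 + c * of_real y"
    unfolding aline_iff[OF assms(1)] aline_iff[OF assms(2)] by blast
  then have "z$2 / c = of_real y" using assms by simp
  then have "z$1 = a * of_real x + b * of_real y" "z$2 = c * of_real y" using z by simp_all
  then show "z \<in> tri a b c" unfolding tri_def by blast
qed

text \<open>By \<open>c01\<close> and \<open>c02\<close> the line of \<open>c0\<close> meets the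
  other two only in 0, although those two may coincide. So a fibre over \<open>z$2\<close> different
  from 0 consists of at most two lines, and \<open>two_lines_ray\<close> applies. Over 0 there can
  be three, but they all pass through 0.\<close>

lemma hull_closed_tri:
  assumes a: "a0 \<noteq> 0" "a1 \<noteq> 0" "a2 \<noteq> 0" and c: "c0 \<noteq> 0" "c1 \<noteq> 0" "c2 \<noteq> 0"
    and c01: "Im (c1 * cnj c0) \<noteq> 0" and c02: "Im (c2 * cnj c0) \<noteq> 0"
  shows "hull_closed (tri a0 b0 c0 \<union> tri a1 b1 c1 \<union> tri a2 b2 c2)"
  unfolding hull_closed_def
proof (intro allI impI, elim conjE)
  let ?E = "tri a0 b0 c0 \<union> tri a1 b1 c1 \<union> tri a2 b2 c2"
  fix K z assume K: "compact K" "K \<subseteq> ?E" and z: "in_hull K z"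
  let ?L = "\<lambda>v. \<exists>c\<in>{c0,c1,c2}. v \<in> aline 0 c"
  note tri = tri_iff[OF a(1) c(1)] tri_iff[OF a(2) c(2)] tri_iff[OF a(3) c(3)]
  have KL: "?L (w$2)" if "w \<in> K" for w using K(2) that by (auto simp: tri)
  have zL: "?L (z$2)"
    by (rule in_hull_lines[OF z K(1) cpoly2_coords(2), where S = "{c0,c1,c2}"]) (use c KL in auto)
  define F where "F = {w \<in> K. w$2 = z$2}"
  have zF: "in_hull F z" unfolding F_def
    by (rule in_hull_lines_fibre[OF z K(1) cpoly2_coords(2), where S = "{c0,c1,c2}"]) (use c KL in auto)
  have F: "compact F"
    using cpoly2_preimage_compact[OF K(1) cpoly2_coords(2) closed_singleton[of "z$2"]] by (simp add: F_def)
  have F2: "w$2 = z$2" "w \<in> ?E" if "w \<in> F" for w using that K(2) by (auto simp: F_def)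
  have disjoint: "v = 0" if v0: "v \<in> aline 0 c0" and v: "v \<in> aline 0 c" and nz: "Im (c * cnj c0) \<noteq> 0" for v c
  proof -
    obtain x y :: real where "v = c0 * of_real x" "v = c * of_real y"
      using v0 v c(1) nz aline_iff[of c0 v 0] aline_iff[of c v 0] by force
    note v = this
    have "of_real y * (c * cnj c0) = (c * of_real y) * cnj c0" by (simp only: mult_ac)
    also have "\<dots> = of_real x * (c0 * cnj c0)" unfolding v(2) [symmetric] unfolding v(1) by (simp only: mult_ac)
    finally have "of_real y * (c * cnj c0) = of_real x * (c0 * cnj c0)" .
    then have "Im (of_real y * (c * cnj c0)) = Im (of_real x * (c0 * cnj c0))" by (rule arg_cong)
    moreover have "Im (of_real t * w) = t * Im w" for t w by simp
    moreover have "Im (c0 * cnj c0) = 0" by simp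
    ultimately have "y * Im (c * cnj c0) = 0" by (metis mult_zero_right)
    then have "y = 0" using nz mult_eq_0_iff by blast
    then show ?thesis using v(2) by simp
  qed
  show "z \<in> ?E"
  proof (cases "z$2 = 0")
    case True
    have "\<exists>a\<in>{a0,a1,a2}. z$1 \<in> aline 0 a"
    proof (rule in_hull_lines[OF zF F cpoly2_coords(1)])
      fix w assume "w \<in> F"
      then show "\<exists>a\<in>{a0,a1,a2}. w$1 \<in> aline 0 a" using F2[of w] True by (auto simp: tri)
    qed (use a in auto)
    then show ?thesis using True by (auto simp: tri) (auto simp: aline_def)
  next
    case False
    let ?p = "\<lambda>b c. b * (z$2 / c)"
    show ?thesis
    proof (cases "z$2 \<in> aline 0 c0")
      case True
      then have n: "z$2 \<notin> aline 0 c1" "z$2 \<notin> aline 0 c2" using disjoint c01 c02 False by blast+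
      have "z$1 \<in> aline (?p b0 c0) a0 \<union> aline (?p b0 c0) a0"
        by (rule in_hull_two_lines[OF zF F cpoly2_coords(1) a(1) a(1)]) (use F2 n in \<open>auto simp: tri\<close>)
      then show ?thesis using True by (simp add: tri)
    next
      case n0: False
      show ?thesis
      proof (cases "z$2 \<in> aline 0 c1")
        case 1: True
        show ?thesis
        proof (cases "z$2 \<in> aline 0 c2")
          case 2: True
          have "z$1 \<in> aline (?p b1 c1) a1 \<union> aline (?p b2 c2) a2"
            by (rule in_hull_two_lines[OF zF F cpoly2_coords(1) a(2) a(3)]) (use F2 n0 in \<open>auto simp: tri\<close>)
          then show ?thesis using 1 2 by (auto simp: tri)
        next
          case 2: False
          have "z$1 \<in> aline (?p b1 c1) a1 \<union> aline (?p b1 c1) a1"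
            by (rule in_hull_two_lines[OF zF F cpoly2_coords(1) a(2) a(2)]) (use F2 n0 2 in \<open>auto simp: tri\<close>)
          then show ?thesis using 1 by (auto simp: tri)
        qed
      next
        case 1: False
        then have 2: "z$2 \<in> aline 0 c2" using zL n0 by auto
        have "z$1 \<in> aline (?p b2 c2) a2 \<union> aline (?p b2 c2) a2"
          by (rule in_hull_two_lines[OF zF F cpoly2_coords(1) a(3) a(3)]) (use F2 n0 1 in \<open>auto simp: tri\<close>)
        then show ?thesis using 2 by (auto simp: tri)
      qed
    qed
  qed
qed

section \<open>The planes of the normal form\<close>

lemma realR2_iff: "z \<in> realR2 \<longleftrightarrow> Im (z$1) = 0 \<and> Im (z$2) = 0"
proof
  assume "Im (z$1) = 0 \<and> Im (z$2) = 0"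
  then have "z = (\<chi> k. complex_of_real ((\<chi> k. Re (z$k)) $ k))"
    by (simp add: vec_eq_iff forall_2 complex_eq_iff)
  then show "z \<in> realR2" unfolding realR2_def by blast
qed (auto simp: realR2_def)

lemma graphplane_iff:
  "z \<in> graphplane A \<longleftrightarrow> Re (z$1) = A$1$1 * Im (z$1) + A$1$2 * Im (z$2) \<and>
     Re (z$2) = A$2$1 * Im (z$1) + A$2$2 * Im (z$2)"
proof
  assume z: "Re (z$1) = A$1$1 * Im (z$1) + A$1$2 * Im (z$2) \<and>
     Re (z$2) = A$2$1 * Im (z$1) + A$2$2 * Im (z$2)"
  define x :: "real^2" where "x = (\<chi> k. Im (z$k))"
  have "z = (\<chi> k. complex_of_real ((A *v x)$k) + \<i> * complex_of_real (x$k))"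
    using z by (simp add: vec_eq_iff forall_2 complex_eq_iff matrix_vector_2 x_def)
  then show "z \<in> graphplane A" unfolding graphplane_def by blast
qed (auto simp: graphplane_def matrix_vector_2)

lemma subspace_realR2: "subspace realR2"
  by (auto simp: subspace_def realR2_iff)

lemma subspace_graphplane: "subspace (graphplane A)"
  by (auto simp: subspace_def graphplane_iff algebra_simps)

lemma loc_poly_convex_Un:
  assumes "subspace P" "subspace Q"
  shows "loc_poly_convex (P \<union> Q) 0 \<longleftrightarrow> hull_closed (P \<union> Q)"
  using assms by (intro loc_poly_convex_cone_iff closed_Un closed_subspace)
    (auto simp: subspace_0 subspace_scale)

lemma loc_poly_convex_Un3:
  assumes "subspace P" "subspace Q" "subspace R"
  shows "loc_poly_convex (P \<union> Q \<union> R) 0 \<longleftrightarrow> hull_closed (P \<union> Q \<union> R)"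
  using assms by (intro loc_poly_convex_cone_iff closed_Un closed_subspace)
    (auto simp: subspace_0 subspace_scale)

section \<open>Real changes of coordinates\<close>

lemma matrix_eq_2: "A = B \<longleftrightarrow> A$1$1 = B$1$1 \<and> A$1$2 = B$1$2 \<and> A$2$1 = B$2$1 \<and> A$2$2 = B$2$2"
  for A B :: "'a^2^2"
  by (auto simp: vec_eq_iff forall_2)

lemma matrix_mult_2: "(A ** B)$i$j = A$i$1 * B$1$j + A$i$2 * B$2$j"
  for A B :: "'a::semiring_1^2^2"
  by (simp add: matrix_matrix_mult_def sum_2)

lemma mat2_nth [simp]:
  "mat2 a b c d $1$1 = a" "mat2 a b c d $1$2 = b" "mat2 a b c d $2$1 = c" "mat2 a b c d $2$2 = d"
  by (simp_all add: mat2_def)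

lemma cmat_mult: "cmat (A ** B) = cmat A ** cmat B"
  by (simp add: matrix_eq_2 matrix_mult_2 cmat_def)

lemma cmat_one: "cmat (mat 1) = mat 1"
  by (simp add: matrix_eq_2 cmat_def mat_def)

lemma matrix_inv_right_left:
  assumes "invertible T"
  shows "T ** matrix_inv T = mat 1" "matrix_inv T ** T = mat 1"
proof -
  have "\<exists>S. T ** S = mat 1 \<and> S ** T = mat 1" using assms unfolding invertible_def .
  then have "T ** matrix_inv T = mat 1 \<and> matrix_inv T ** T = mat 1"
    unfolding matrix_inv_def by (rule someI_ex)
  then show "T ** matrix_inv T = mat 1" "matrix_inv T ** T = mat 1" by auto
qed

lemma invertible_cmat: "invertible T \<Longrightarrow> invertible (cmat T)"
  unfolding invertible_def by (metis cmat_mult cmat_one)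

lemma conj_by_inverse:
  assumes T: "invertible T"
  shows "invertible (matrix_inv T)" "conj_by (matrix_inv T) (conj_by T A) = A"
proof -
  show inv: "invertible (matrix_inv T)"
    using matrix_inv_right_left[OF T] unfolding invertible_def by blast
  let ?S = "matrix_inv T"
  note T' = matrix_inv_right_left[OF T] and S' = matrix_inv_right_left[OF inv]
  have "matrix_inv ?S = (T ** ?S) ** matrix_inv ?S" unfolding T' by simp
  also have "\<dots> = T" unfolding matrix_mul_assoc [symmetric] S' by simp
  finally have SS: "matrix_inv ?S = T" .
  have "conj_by ?S (conj_by T A) = (?S ** T) ** A ** (?S ** T)"
    unfolding conj_by_def SS by (simp only: matrix_mul_assoc)
  then show "conj_by ?S (conj_by T A) = A" unfolding T' by simp
qed

lemma cmat_image_realR2: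
  assumes T: "invertible T"
  shows "(*v) (cmat T) ` realR2 = realR2"
proof -
  have sub: "(*v) (cmat T) ` realR2 \<subseteq> realR2" for T
    by (auto simp: realR2_iff matrix_vector_2 cmat_def)
  have "z \<in> (*v) (cmat T) ` realR2" if "z \<in> realR2" for z
  proof
    show "z = cmat T *v (cmat (matrix_inv T) *v z)"
      by (simp add: matrix_vector_mul_assoc cmat_mult [symmetric] matrix_inv_right_left[OF T] cmat_one)
    show "cmat (matrix_inv T) *v z \<in> realR2" using sub that by blast
  qed
  then show ?thesis using sub by blast
qed

text \<open>A real matrix acts separately on real and imaginary parts, so \<open>(A + i) y\<close>
  goes to \<open>(T A T^-1 + i) T y\<close>.\<close>

lemma cmat_image_graphplane:
  assumes T: "invertible T"
  shows "(*v) (cmat T) ` graphplane A = graphplane (conj_by T A)"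
proof -
  have sub: "(*v) (cmat T) ` graphplane A \<subseteq> graphplane (conj_by T A)" if T: "invertible T" for T A
  proof (clarify)
    fix z assume z: "z \<in> graphplane A"
    define y :: "real^2" where "y = (\<chi> k. Im (z$k))"
    have eq: "Re ((cmat T *v z)$k) = (T *v (A *v y))$k" "Im ((cmat T *v z)$k) = (T *v y)$k" for k
      using z by (simp_all add: matrix_vector_2 cmat_def y_def graphplane_iff)
    have "T *v (A *v y) = conj_by T A *v (T *v y)"
    proof -
      have "conj_by T A ** T = T ** A ** (matrix_inv T ** T)"
        unfolding conj_by_def by (simp only: matrix_mul_assoc)
      then show ?thesis unfolding matrix_vector_mul_assoc matrix_inv_right_left(2)[OF T] by simp
    qed
    then show "cmat T *v z \<in> graphplane (conj_by T A)"
      unfolding graphplane_iff eq by (simp add: matrix_vector_2[of "conj_by T A"])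
  qed
  have "z \<in> (*v) (cmat T) ` graphplane A" if "z \<in> graphplane (conj_by T A)" for z
  proof
    show "z = cmat T *v (cmat (matrix_inv T) *v z)"
      by (simp add: matrix_vector_mul_assoc cmat_mult [symmetric] matrix_inv_right_left[OF T] cmat_one)
    have "cmat (matrix_inv T) *v z \<in> graphplane (conj_by (matrix_inv T) (conj_by T A))"
      using sub[OF conj_by_inverse(1)[OF T]] that by blast
    then show "cmat (matrix_inv T) *v z \<in> graphplane A" by (simp add: conj_by_inverse[OF T])
  qed
  then show ?thesis using sub[OF T] by blast
qed

lemma hull_closed_conj_by:
  assumes T: "invertible T"
  shows "hull_closed (realR2 \<union> graphplane (conj_by T A)) \<longleftrightarrow> hull_closed (realR2 \<union> graphplane A)"
    "hull_closed (graphplane (conj_by T A) \<union> graphplane (conj_by T B))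
      \<longleftrightarrow> hull_closed (graphplane A \<union> graphplane B)"
    "hull_closed (realR2 \<union> graphplane (conj_by T A) \<union> graphplane (conj_by T B))
      \<longleftrightarrow> hull_closed (realR2 \<union> graphplane A \<union> graphplane B)"
proof -
  let ?T = "(*v) (cmat T)"
  have "realR2 \<union> graphplane (conj_by T A) = ?T ` (realR2 \<union> graphplane A)"
    "graphplane (conj_by T A) \<union> graphplane (conj_by T B) = ?T ` (graphplane A \<union> graphplane B)"
    "realR2 \<union> graphplane (conj_by T A) \<union> graphplane (conj_by T B)
      = ?T ` (realR2 \<union> graphplane A \<union> graphplane B)"
    by (simp_all only: image_Un cmat_image_realR2[OF T] cmat_image_graphplane[OF T])
  note image = this and closed = hull_closed_matrix[OF invertible_cmat[OF T]]
  show "hull_closed (realR2 \<union> graphplane (conj_by T A)) \<longleftrightarrow> hull_closed (realR2 \<union> graphplane A)"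
    unfolding image(1) by (rule closed)
  show "hull_closed (graphplane (conj_by T A) \<union> graphplane (conj_by T B))
      \<longleftrightarrow> hull_closed (graphplane A \<union> graphplane B)"
    unfolding image(2) by (rule closed)
  show "hull_closed (realR2 \<union> graphplane (conj_by T A) \<union> graphplane (conj_by T B))
      \<longleftrightarrow> hull_closed (realR2 \<union> graphplane A \<union> graphplane B)"
    unfolding image(3) by (rule closed)
qed

text \<open>The constant \<open>m\<close> is determinant over trace of the symmetric matrix of the
  form, which lies below its smallest eigenvalue. After subtracting \<open>m (x^2 + y^2)\<close> the
  square can still be completed, with the remainder \<open>4 m^2 y^2\<close>.\<close>

lemma definite_form_bound:
  fixes a d s :: real
  assumes "a > 0" "4 * a * d > s^2"
  obtains m where "m > 0" "\<And>x y. m * (x^2 + y^2) \<le> a * x^2 + s * x * y + d * y^2"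
proof -
  have "4 * a * d > 0" using assms(2) zero_le_power2[of s] by linarith
  then have d: "d > 0" using assms(1) by (simp add: zero_less_mult_iff)
  define m where "m = (4 * a * d - s^2) / (4 * (a + d))"
  have "m * (4 * (a + d)) = 4 * a * d - s^2" using assms(1) d by (simp add: m_def)
  then have eq: "4 * m * (a + d) = 4 * a * d - s^2" by (simp add: algebra_simps)
  have m: "m > 0" using assms d by (simp add: m_def)
  have am: "a - m > 0"
  proof -
    have "4 * m * (a + d) \<le> 4 * a * d" using eq by simp
    also have "\<dots> < 4 * a * (a + d)" using assms(1) d by simp
    finally show ?thesis using assms(1) d by (simp add: mult_less_cancel_right_pos)
  qed
  have "m * (x^2 + y^2) \<le> a * x^2 + s * x * y + d * y^2" for x y
  proof -
    have "4 * (a - m) * ((a - m) * x^2 + s * x * y + (d - m) * y^2)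
        = (2 * (a - m) * x + s * y)^2 + (4 * a * d - s^2 - 4 * m * (a + d) + 4 * m^2) * y^2"
      by (simp add: power2_eq_square algebra_simps)
    also have "\<dots> \<ge> 0" unfolding eq by simp
    finally have "(a - m) * x^2 + s * x * y + (d - m) * y^2 \<ge> 0"
      using am by (simp add: zero_le_mult_iff)
    then show ?thesis by (simp add: algebra_simps)
  qed
  then show ?thesis using that m by blast
qed

section \<open>The quadratic form and planes with definite symmetric part\<close>

definition qform :: "complex^2 \<Rightarrow> complex" where
  "qform z = (z$1)^2 + (z$2)^2"

lemma cpoly2_qform: "cpoly2 (\<lambda>z. c * qform z)"
  unfolding qform_def by (intro cpoly2_mult cpoly2_const cpoly2_add cpoly2_power cpoly2_coords)

text \<open>For \<open>z = (A + i) y\<close> the imaginary part of \<open>qform z\<close> is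
  \<open>y^T (A + A^T) y\<close>; this is why the symmetric part enters. Its definiteness bounds the
  imaginary part below by \<open>2 m |y|^2\<close>, while
  \<open>|qform z| <= L |y|^2\<close>.\<close>

lemma qform_graphplane_pos:
  assumes a: "A$1$1 > 0" and det: "det (A + transpose A) > 0"
  obtains \<delta> where "\<delta> > 0" "\<And>z. z \<in> graphplane A \<Longrightarrow> \<delta> * norm (qform z) \<le> Im (qform z)"
    "\<And>z. z \<in> graphplane A \<Longrightarrow> qform z = 0 \<Longrightarrow> z = 0"
proof -
  have "4 * A$1$1 * A$2$2 > (A$1$2 + A$2$1)^2"
    using det by (simp add: det_2 transpose_def power2_eq_square algebra_simps)
  then obtain m where m: "m > 0"
    "\<And>x y. m * (x^2 + y^2) \<le> A$1$1 * x^2 + (A$1$2 + A$2$1) * x * y + A$2$2 * y^2"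
    using definite_form_bound[OF a] by metis
  define L where "L = 1 + (A$1$1)^2 + (A$1$2)^2 + (A$2$1)^2 + (A$2$2)^2"
  have L: "L > 0" unfolding L_def by (intro add_pos_nonneg) auto
  have main: "2 * m * ((Im (z$1))^2 + (Im (z$2))^2) \<le> Im (qform z)"
     "norm (qform z) \<le> L * ((Im (z$1))^2 + (Im (z$2))^2)" if z: "z \<in> graphplane A" for z
  proof -
    define x y where "x = Im (z$1)" and "y = Im (z$2)"
    have Re: "Re (z$1) = A$1$1 * x + A$1$2 * y" "Re (z$2) = A$2$1 * x + A$2$2 * y"
      using z by (simp_all add: graphplane_iff x_def y_def)
    have "Im (qform z) = 2 * (A$1$1 * x^2 + (A$1$2 + A$2$1) * x * y + A$2$2 * y^2)"
      by (simp add: qform_def Im_power2 Re x_def [symmetric] y_def [symmetric] power2_eq_square algebra_simps)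
    then show "2 * m * ((Im (z$1))^2 + (Im (z$2))^2) \<le> Im (qform z)"
      using m(2)[of x y] by (simp add: x_def y_def)
    have sq: "(a * x + b * y)^2 \<le> (a^2 + b^2) * (x^2 + y^2)" for a b
    proof -
      have "(a^2 + b^2) * (x^2 + y^2) - (a * x + b * y)^2 = (a * y - b * x)^2"
        by (simp add: power2_eq_square algebra_simps)
      then show ?thesis using zero_le_power2[of "a * y - b * x"] by linarith
    qed
    have "norm (qform z) \<le> (norm (z$1))^2 + (norm (z$2))^2"
      unfolding qform_def by (rule norm_triangle_le) (simp add: norm_power)
    also have "\<dots> = (A$1$1 * x + A$1$2 * y)^2 + (A$2$1 * x + A$2$2 * y)^2 + (x^2 + y^2)"
      by (simp add: cmod_power2 Re x_def [symmetric] y_def [symmetric])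
    also have "\<dots> \<le> L * (x^2 + y^2)"
      using sq[of "A$1$1" "A$1$2"] sq[of "A$2$1" "A$2$2"] by (simp add: L_def algebra_simps)
    finally show "norm (qform z) \<le> L * ((Im (z$1))^2 + (Im (z$2))^2)" by (simp add: x_def y_def)
  qed
  show ?thesis
  proof (rule that[of "2 * m / L"])
    show "2 * m / L > 0" using m L by simp
    fix z assume z: "z \<in> graphplane A"
    have "2 * m / L * norm (qform z) \<le> 2 * m / L * (L * ((Im (z$1))^2 + (Im (z$2))^2))"
      using main(2)[OF z] m L by (intro mult_left_mono) auto
    also have "\<dots> = 2 * m * ((Im (z$1))^2 + (Im (z$2))^2)" using L by simp
    finally show "2 * m / L * norm (qform z) \<le> Im (qform z)" using main(1)[OF z] by linarith
    assume "qform z = 0"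
    then have "m * ((Im (z$1))^2 + (Im (z$2))^2) \<le> 0" using main(1)[OF z] by simp
    then have "(Im (z$1))^2 + (Im (z$2))^2 \<le> 0" using m(1) by (simp add: mult_le_0_iff)
    then have "Im (z$1) = 0" "Im (z$2) = 0" by (simp_all add: sum_power2_le_zero_iff)
    then show "z = 0" using z by (simp add: graphplane_iff vec_eq_iff forall_2 complex_eq_iff)
  qed
qed

lemma qform_realR2: "z \<in> realR2 \<Longrightarrow> qform z = of_real ((Re (z$1))^2 + (Re (z$2))^2)"
  by (simp add: realR2_iff qform_def complex_eq_iff Re_power2 Im_power2)

lemma qform_realR2_eq_0: "z \<in> realR2 \<Longrightarrow> qform z = 0 \<Longrightarrow> z = 0"
  by (simp add: qform_realR2 del: of_real_add of_real_power)
     (simp add: sum_power2_eq_zero_iff realR2_iff vec_eq_iff forall_2 complex_eq_iff)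

definition upper :: "real \<Rightarrow> (complex^2) set \<Rightarrow> bool" where
  "upper \<delta> E \<longleftrightarrow> (\<forall>z\<in>E. \<delta> * norm (qform z) \<le> Im (qform z))"

definition lower :: "real \<Rightarrow> (complex^2) set \<Rightarrow> bool" where
  "lower \<delta> E \<longleftrightarrow> (\<forall>z\<in>E. \<delta> * norm (qform z) \<le> - Im (qform z))"

text \<open>Multiplication by \<open>1 + i \<tau>\<close> tilts the positive half-line into the
  half-plane given by the sign of \<open>\<tau>\<close>. With \<open>|\<tau>| = \<delta> / 2\<close>
  the two cones lose at most half their opening constant, and \<open>|1 + i \<tau>| <= 2\<close>
  costs another factor 2.\<close>

lemma upper_lower_rotate:
  assumes \<delta>: "0 < \<delta>" "\<delta> \<le> 1" and \<tau>: "\<bar>\<tau>\<bar> = \<delta> / 2"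
  defines "f \<equiv> \<lambda>z. Complex 1 \<tau> * qform z"
  shows "\<delta> * norm (qform z) \<le> Im (qform z) \<Longrightarrow> \<delta> / 4 * norm (f z) \<le> Im (f z)"
    and "\<delta> * norm (qform z) \<le> - Im (qform z) \<Longrightarrow> \<delta> / 4 * norm (f z) \<le> - Im (f z)"
    and "z \<in> realR2 \<Longrightarrow> \<tau> > 0 \<Longrightarrow> \<delta> / 4 * norm (f z) \<le> Im (f z)"
    and "z \<in> realR2 \<Longrightarrow> \<tau> < 0 \<Longrightarrow> \<delta> / 4 * norm (f z) \<le> - Im (f z)"
    and "f z = 0 \<Longrightarrow> qform z = 0"
proof -
  let ?q = "norm (qform z)"
  have "norm (Complex 1 \<tau>) \<le> 1 + \<bar>\<tau>\<bar>" using cmod_le[of "Complex 1 \<tau>"] by simp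
  then have "norm (Complex 1 \<tau>) \<le> 2" using \<delta> \<tau> by simp
  then have "norm (f z) \<le> 2 * ?q"
    unfolding f_def norm_mult by (intro mult_right_mono) auto
  then have nf: "\<delta> / 4 * norm (f z) \<le> \<delta> / 2 * ?q"
    using \<delta> mult_left_mono[of "norm (f z)" "2 * ?q" "\<delta> / 4"] by simp
  have Im_f: "Im (f z) = Im (qform z) + \<tau> * Re (qform z)" by (simp add: f_def)
  have "\<bar>\<tau> * Re (qform z)\<bar> \<le> \<delta> / 2 * ?q"
    unfolding abs_mult \<tau> using \<delta> abs_Re_le_cmod[of "qform z"] by (intro mult_left_mono) auto
  then show "\<delta> * ?q \<le> Im (qform z) \<Longrightarrow> \<delta> / 4 * norm (f z) \<le> Im (f z)"
    and "\<delta> * ?q \<le> - Im (qform z) \<Longrightarrow> \<delta> / 4 * norm (f z) \<le> - Im (f z)"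
    using nf unfolding Im_f by (simp_all add: abs_le_iff)
  show "f z = 0 \<Longrightarrow> qform z = 0" by (simp add: f_def complex_eq_iff[of "Complex 1 \<tau>"])
  have "Im (f z) = \<tau> * ?q" if z: "z \<in> realR2"
  proof -
    have "Re (qform z) = ?q" "Im (qform z) = 0"
      unfolding qform_realR2[OF z] by (simp_all del: of_real_add of_real_power)
    then show ?thesis unfolding Im_f by simp
  qed
  then show "z \<in> realR2 \<Longrightarrow> \<tau> > 0 \<Longrightarrow> \<delta> / 4 * norm (f z) \<le> Im (f z)"
    and "z \<in> realR2 \<Longrightarrow> \<tau> < 0 \<Longrightarrow> \<delta> / 4 * norm (f z) \<le> - Im (f z)"
    using nf \<tau> by auto
qed

text \<open>The sign of the tilt decides which side \<open>realR2\<close> joins: the lower one in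
  the first claim, the upper one in the second.\<close>

lemma hull_closed_upper_lower:
  assumes 0: "0 \<in> E1" "0 \<in> E2" and q0: "\<And>z. z \<in> E1 \<union> E2 \<Longrightarrow> qform z = 0 \<Longrightarrow> z = 0"
    and \<delta>: "\<delta> > 0" and E: "upper \<delta> E1" "lower \<delta> E2"
  shows "hull_closed E1 \<Longrightarrow> hull_closed (realR2 \<union> E2) \<Longrightarrow> hull_closed (E1 \<union> (realR2 \<union> E2))"
    and "hull_closed E2 \<Longrightarrow> hull_closed (realR2 \<union> E1) \<Longrightarrow> hull_closed (realR2 \<union> E1 \<union> E2)"
proof -
  define e where "e = min \<delta> 1"
  have e: "0 < e" "e \<le> 1" "e / 4 > 0" using \<delta> by (auto simp: e_def)
  have le: "e * norm (qform z) \<le> \<delta> * norm (qform z)" for z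
    by (intro mult_right_mono) (auto simp: e_def)
  have up: "e * norm (qform z) \<le> Im (qform z)" if "z \<in> E1" for z
    using E(1) le[of z] that by (force simp: upper_def)
  have lo: "e * norm (qform z) \<le> - Im (qform z)" if "z \<in> E2" for z
    using E(2) le[of z] that by (force simp: lower_def)
  have r0: "0 \<in> realR2" by (simp add: realR2_iff)
  have z0: "z = 0" if "z \<in> E1 \<union> E2 \<union> realR2" "Complex 1 t * qform z = 0" for z t
    using that q0 qform_realR2_eq_0 by (auto simp: complex_eq_iff[of "Complex 1 t"])
  show "hull_closed (E1 \<union> (realR2 \<union> E2))" if "hull_closed E1" "hull_closed (realR2 \<union> E2)"
  proof (rule hull_closed_Un_kallin[OF that cpoly2_qform e(3)])
    have t: "\<bar>- (e/2)\<bar> = e / 2" using e by simp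
    let ?c = "Complex 1 (- (e/2))"
    show "e / 4 * norm (?c * qform w) \<le> Im (?c * qform w)" if "w \<in> E1" for w
      by (rule upper_lower_rotate(1)[OF e(1,2) t up[OF that]])
    show "e / 4 * norm (?c * qform w) \<le> - Im (?c * qform w)" if "w \<in> realR2 \<union> E2" for w
      using that upper_lower_rotate(2)[OF e(1,2) t lo] upper_lower_rotate(4)[OF e(1,2) t] e(1) by auto
    show "w \<in> E1 \<inter> (realR2 \<union> E2)" if "w \<in> E1 \<union> (realR2 \<union> E2)" "?c * qform w = 0" for w
      using z0[of w] that 0 r0 by blast
  qed
  show "hull_closed (realR2 \<union> E1 \<union> E2)" if "hull_closed E2" "hull_closed (realR2 \<union> E1)"
  proof (rule hull_closed_Un_kallin[OF that(2,1) cpoly2_qform e(3)])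
    have t: "\<bar>e/2\<bar> = e / 2" using e by simp
    let ?c = "Complex 1 (e/2)"
    show "e / 4 * norm (?c * qform w) \<le> - Im (?c * qform w)" if "w \<in> E2" for w
      by (rule upper_lower_rotate(2)[OF e(1,2) t lo[OF that]])
    show "e / 4 * norm (?c * qform w) \<le> Im (?c * qform w)" if "w \<in> realR2 \<union> E1" for w
      using that upper_lower_rotate(1)[OF e(1,2) t up] upper_lower_rotate(3)[OF e(1,2) t] e(1) by auto
    show "w \<in> (realR2 \<union> E1) \<inter> E2" if "w \<in> realR2 \<union> E1 \<union> E2" "?c * qform w = 0" for w
      using z0[of w] that 0 r0 by blast
  qed
qed

text \<open>In the negative definite case coordinatewise conjugation maps the plane of
  \<open>A\<close> to that of \<open>- A\<close> and conjugates \<open>qform\<close>, exchanging the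
  half-planes.\<close>

lemma qform_graphplane_cone:
  assumes det: "det (A + transpose A) > 0"
  obtains \<delta> where "\<delta> > 0" "upper \<delta> (graphplane A) \<or> lower \<delta> (graphplane A)"
    "\<And>z. z \<in> graphplane A \<Longrightarrow> qform z = 0 \<Longrightarrow> z = 0"
proof (cases "A$1$1 > 0")
  case True
  then show ?thesis
    using qform_graphplane_pos[OF _ det] that unfolding upper_def by metis
next
  case False
  have "4 * A$1$1 * A$2$2 > (A$1$2 + A$2$1)^2"
    using det by (simp add: det_2 transpose_def power2_eq_square algebra_simps)
  then have "A$1$1 \<noteq> 0" using not_sum_power2_lt_zero[of 0 "A$1$2 + A$2$1"] by force
  then have pos: "(- A)$1$1 > 0" using False by simp
  have "det (- A + transpose (- A)) > 0"
    using det by (simp add: det_2 transpose_def algebra_simps)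
  then obtain \<delta> where \<delta>: "\<delta> > 0"
    "\<And>z. z \<in> graphplane (- A) \<Longrightarrow> \<delta> * norm (qform z) \<le> Im (qform z)"
    "\<And>z. z \<in> graphplane (- A) \<Longrightarrow> qform z = 0 \<Longrightarrow> z = 0"
    using qform_graphplane_pos[OF pos] by metis
  let ?cj = "\<lambda>z::complex^2. \<chi> k. cnj (z$k)"
  have cj: "?cj z \<in> graphplane (- A)" "qform (?cj z) = cnj (qform z)" if "z \<in> graphplane A" for z
    using that by (simp_all add: graphplane_iff qform_def)
  show ?thesis
  proof (rule that[OF \<delta>(1)])
    show "upper \<delta> (graphplane A) \<or> lower \<delta> (graphplane A)"
      using \<delta>(2)[OF cj(1)] cj(2) by (auto simp: lower_def)
    fix z assume z: "z \<in> graphplane A" "qform z = 0"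
    then have "?cj z = 0" using \<delta>(3)[OF cj(1)[OF z(1)]] cj(2)[OF z(1)] by simp
    then show "z = 0" by (simp add: vec_eq_iff)
  qed
qed

lemma hull_closed_Int: "hull_closed E \<Longrightarrow> hull_closed F \<Longrightarrow> hull_closed (E \<inter> F)"
  unfolding hull_closed_def by blast

lemma hull_closed_realR2: "hull_closed realR2"
  unfolding hull_closed_def
proof (intro allI impI, elim conjE)
  fix K z assume K: "compact K" "K \<subseteq> realR2" and z: "in_hull K z"
  have "z$1 \<in> aline 0 1 \<union> aline 0 1"
    by (rule in_hull_two_lines[OF z K(1) cpoly2_coords(1)]) (use K(2) in \<open>auto simp: aline_def realR2_iff\<close>)
  moreover have "z$2 \<in> aline 0 1 \<union> aline 0 1"
    by (rule in_hull_two_lines[OF z K(1) cpoly2_coords(2)]) (use K(2) in \<open>auto simp: aline_def realR2_iff\<close>)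
  ultimately show "z \<in> realR2" by (simp add: aline_def realR2_iff)
qed

text \<open>If both planes lie on the same side, they are separated as a pair from
  \<open>realR2\<close>. If they lie on opposite sides, \<open>realR2\<close> is grouped with one of
  them. In each case only pairs and single planes remain.\<close>

lemma hull_closed_definite:
  assumes A: "det (A + transpose A) > 0" and B: "det (B + transpose B) > 0"
    and RA: "hull_closed (realR2 \<union> graphplane A)" and RB: "hull_closed (realR2 \<union> graphplane B)"
    and AB: "hull_closed (graphplane A \<union> graphplane B)"
  shows "hull_closed (realR2 \<union> graphplane A \<union> graphplane B)"
proof -
  have real_Int: "realR2 \<inter> graphplane C = {0}" for C
    by (auto simp: realR2_iff graphplane_iff vec_eq_iff forall_2 complex_eq_iff)
  \<comment> \<open>Both planes meet \<open>realR2\<close> only in 0, so intersecting two pairwise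
    unions isolates a single plane.\<close>
  have "graphplane A = (realR2 \<union> graphplane A) \<inter> (graphplane A \<union> graphplane B)"
    "graphplane B = (realR2 \<union> graphplane B) \<inter> (graphplane A \<union> graphplane B)"
    using real_Int[of A] real_Int[of B] subspace_0[OF subspace_graphplane[of A]]
      subspace_0[OF subspace_graphplane[of B]] by blast+
  then have hA: "hull_closed (graphplane A)" and hB: "hull_closed (graphplane B)"
    using hull_closed_Int RA RB AB by metis+
  have 0: "0 \<in> graphplane C" for C by (rule subspace_0[OF subspace_graphplane])
  have q0: "qform (0::complex^2) = 0" by (simp add: qform_def)
  obtain d1 where d1: "d1 > 0" "upper d1 (graphplane A) \<or> lower d1 (graphplane A)"
    "\<And>z. z \<in> graphplane A \<Longrightarrow> qform z = 0 \<Longrightarrow> z = 0"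
    using qform_graphplane_cone[OF A] by blast
  obtain d2 where d2: "d2 > 0" "upper d2 (graphplane B) \<or> lower d2 (graphplane B)"
    "\<And>z. z \<in> graphplane B \<Longrightarrow> qform z = 0 \<Longrightarrow> z = 0"
    using qform_graphplane_cone[OF B] by blast
  define d where "d = min d1 d2"
  have d: "d > 0" using d1 d2 by (simp add: d_def)
  have "d * x \<le> d1 * x" "d * x \<le> d2 * x" if "x \<ge> 0" for x
    using that by (auto simp: d_def intro: mult_right_mono)
  then have "upper d1 E \<Longrightarrow> upper d E" "lower d1 E \<Longrightarrow> lower d E" "upper d2 E \<Longrightarrow> upper d E"
      "lower d2 E \<Longrightarrow> lower d E" for E
    unfolding upper_def lower_def by (meson norm_ge_zero order_trans)+
  then consider "upper d (graphplane A)" "upper d (graphplane B)"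
    | "upper d (graphplane A)" "lower d (graphplane B)"
    | "lower d (graphplane A)" "upper d (graphplane B)"
    | "lower d (graphplane A)" "lower d (graphplane B)"
    using d1(2) d2(2) by blast
  then show ?thesis
  proof cases
    case 1
    \<comment> \<open>The set \<open>{0}\<close> serves as the missing lower plane.\<close>
    have "hull_closed ((graphplane A \<union> graphplane B) \<union> (realR2 \<union> {0}))"
      using 1 0 d1(3) d2(3) AB hull_closed_realR2 q0 realR2_iff[of 0]
      by (intro hull_closed_upper_lower(1)[OF _ _ _ d]) (auto simp: upper_def lower_def insert_absorb)
    then show ?thesis using realR2_iff[of 0] by (simp add: insert_absorb Un_ac)
  next
    case 2
    then show ?thesis using d1(3) d2(3) RA hB
      by (intro hull_closed_upper_lower(2)[OF 0 0 _ d]) auto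
  next
    case 3
    then have "hull_closed (realR2 \<union> graphplane B \<union> graphplane A)" using d1(3) d2(3) RB hA
      by (intro hull_closed_upper_lower(2)[OF 0 0 _ d]) auto
    then show ?thesis by (simp add: Un_ac)
  next
    case 4
    have "hull_closed (realR2 \<union> {0} \<union> (graphplane A \<union> graphplane B))"
      using 4 0 d1(3) d2(3) AB hull_closed_realR2 q0 realR2_iff[of 0]
      by (intro hull_closed_upper_lower(2)[OF _ _ _ d]) (auto simp: upper_def lower_def insert_absorb)
    then show ?thesis using realR2_iff[of 0] by (simp add: insert_absorb Un_ac)
  qed
qed

text \<open>When the lower left entry of \<open>C\<close> vanishes, the second coordinate runs
  through the line spanned by \<open>C$2$2 + i\<close>. This is never the real line, which is what
  \<open>hull_closed_tri\<close> demands.\<close>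

lemma hull_closed_upper_triangular:
  assumes "A$2$1 = 0" "B$2$1 = 0"
  shows "hull_closed (realR2 \<union> graphplane A \<union> graphplane B)"
proof -
  have R: "realR2 = tri 1 0 1"
  proof (intro set_eqI iffI)
    fix z assume "z \<in> realR2"
    then have "z$1 = 1 * of_real (Re (z$1)) + 0 * of_real (Re (z$2))" "z$2 = 1 * of_real (Re (z$2))"
      by (auto simp: realR2_iff complex_eq_iff)
    then show "z \<in> tri 1 0 1" unfolding tri_def by blast
  qed (auto simp: realR2_iff tri_def)
  have G: "graphplane C = tri (Complex (C$1$1) 1) (of_real (C$1$2)) (Complex (C$2$2) 1)"
    if "C$2$1 = 0" for C
  proof (intro set_eqI iffI)
    fix z assume "z \<in> graphplane C"
    then have "z$1 = Complex (C$1$1) 1 * of_real (Im (z$1)) + of_real (C$1$2) * of_real (Im (z$2))"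
      "z$2 = Complex (C$2$2) 1 * of_real (Im (z$2))"
      using that by (auto simp: graphplane_iff complex_eq_iff)
    then show "z \<in> tri (Complex (C$1$1) 1) (of_real (C$1$2)) (Complex (C$2$2) 1)"
      unfolding tri_def by blast
  qed (use that in \<open>auto simp: graphplane_iff tri_def\<close>)
  show ?thesis
    unfolding R G[OF assms(1)] G[OF assms(2)]
    by (rule hull_closed_tri) (auto simp: complex_eq_iff)
qed

section \<open>Normal forms of pairs of real matrices\<close>

lemma conj_by_eqI:
  assumes "invertible T" "T ** A = D ** T"
  shows "conj_by T A = D"
  unfolding conj_by_def assms(2)
  by (simp add: matrix_mul_assoc [symmetric] matrix_inv_right_left[OF assms(1)])

lemma conj_by_conj_by:
  assumes S: "invertible S" and T: "invertible T"
  shows "invertible (S ** T)" "conj_by (S ** T) A = conj_by S (conj_by T A)"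
proof -
  show inv: "invertible (S ** T)" using S T by (simp add: invertible_det_nz det_mul)
  have "conj_by S (conj_by T A) ** (S ** T) = S ** T ** A ** (matrix_inv T ** (matrix_inv S ** S) ** T)"
    unfolding conj_by_def by (simp only: matrix_mul_assoc)
  then have "conj_by S (conj_by T A) ** (S ** T) = S ** T ** A"
    by (simp add: matrix_inv_right_left[OF S] matrix_inv_right_left[OF T])
  then show "conj_by (S ** T) A = conj_by S (conj_by T A)"
    by (intro conj_by_eqI[OF inv]) simp
qed

lemma conj_by_mat1: "conj_by (mat 1) A = A"
  by (rule conj_by_eqI) (simp_all add: invertible_det_nz)

lemma conj_by_swap:
  "invertible (mat2 0 1 1 0)" "conj_by (mat2 0 1 1 0) A = mat2 (A$2$2) (A$2$1) (A$1$2) (A$1$1)"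
proof -
  show inv: "invertible (mat2 0 1 1 0)" by (simp add: invertible_det_nz det_2)
  show "conj_by (mat2 0 1 1 0) A = mat2 (A$2$2) (A$2$1) (A$1$2) (A$1$1)"
    by (rule conj_by_eqI[OF inv]) (simp add: matrix_eq_2 matrix_mult_2)
qed

lemma commdet_conj_by:
  assumes T: "invertible T"
  shows "commdet (conj_by T A) (conj_by T B) = commdet A B"
proof -
  note T' = matrix_inv_right_left[OF T]
  have mult: "conj_by T A ** conj_by T B = conj_by T (A ** B)" for A B
  proof -
    have "conj_by T A ** conj_by T B = T ** A ** (matrix_inv T ** T) ** B ** matrix_inv T"
      unfolding conj_by_def by (simp only: matrix_mul_assoc)
    then show ?thesis unfolding T' conj_by_def by (simp add: matrix_mul_assoc)
  qed
  have diff: "conj_by T A - conj_by T B = conj_by T (A - B)" for A B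
    unfolding conj_by_def by (simp add: matrix_eq_2 matrix_mult_2 algebra_simps)
  have "det (conj_by T C) = det C" for C
  proof -
    have "det (conj_by T C) = det (T ** matrix_inv T) * det C" by (simp add: conj_by_def det_mul)
    then show ?thesis unfolding T' by simp
  qed
  then show ?thesis unfolding commdet_def mult diff by simp
qed

section \<open>Spectrum, discriminant and normal forms\<close>

lemma mspec_iff:
  "c \<in> mspec A \<longleftrightarrow> c^2 - of_real (A$1$1 + A$2$2) * c + of_real (A$1$1 * A$2$2 - A$1$2 * A$2$1) = 0"
    (is "_ \<longleftrightarrow> ?chi c = 0")
proof -
  define a b d e where abde: "a = of_real (A$1$1) - c" "b = complex_of_real (A$1$2)"
    "d = complex_of_real (A$2$1)" "e = of_real (A$2$2) - c"
  have chi: "?chi c = a * e - b * d" by (simp add: abde algebra_simps power2_eq_square)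
  have ev: "cmat A *v v = c *s v \<longleftrightarrow> a * v$1 + b * v$2 = 0 \<and> d * v$1 + e * v$2 = 0" for v :: "complex^2"
    by (auto simp: vec_eq_iff forall_2 matrix_vector_2 cmat_def abde algebra_simps)
  show ?thesis
  proof
    assume "c \<in> mspec A"
    then obtain v where v0: "v \<noteq> 0" "cmat A *v v = c *s v"
      unfolding mspec_def mem_Collect_eq by (elim exE conjE)
    then have v: "v \<noteq> 0" "a * v$1 + b * v$2 = 0" "d * v$1 + e * v$2 = 0"
      using ev[of v] by simp_all
    have "(a * e - b * d) * v$1 = e * (a * v$1 + b * v$2) - b * (d * v$1 + e * v$2)"
      "(a * e - b * d) * v$2 = a * (d * v$1 + e * v$2) - d * (a * v$1 + b * v$2)"
      by (simp_all add: algebra_simps)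
    then have "(a * e - b * d) * v$1 = 0" "(a * e - b * d) * v$2 = 0" using v by simp_all
    then show "?chi c = 0" unfolding chi using v(1) by (auto simp: vec_eq_iff forall_2)
  next
    assume "?chi c = 0"
    then have det: "a * e = b * d" unfolding chi by simp
    \<comment> \<open>A nonzero row of the singular matrix supplies the kernel vector,
      \<open>(b, - a)\<close> or \<open>(e, - d)\<close>.\<close>
    have "\<exists>v::complex^2. v \<noteq> 0 \<and> a * v$1 + b * v$2 = 0 \<and> d * v$1 + e * v$2 = 0"
    proof (cases "a = 0 \<and> b = 0")
      case False
      then show ?thesis using det
        by (intro exI[of _ "vector [b, - a]"]) (auto simp: vec_eq_iff forall_2 algebra_simps)
    next
      case ab: True
      show ?thesis
      proof (cases "d = 0 \<and> e = 0")
        case False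
        then show ?thesis using ab
          by (intro exI[of _ "vector [e, - d]"]) (auto simp: vec_eq_iff forall_2 algebra_simps)
      next
        case True
        then show ?thesis using ab
          by (intro exI[of _ "vector [1, 0]"]) (auto simp: vec_eq_iff forall_2)
      qed
    qed
    then show "c \<in> mspec A" unfolding mspec_def mem_Collect_eq using ev by (elim exE) (rule exI, simp)
  qed
qed

text \<open>The discriminant \<open>tr^2 - 4 det\<close> of the characteristic polynomial.\<close>

definition discr :: "real^2^2 \<Rightarrow> real" where
  "discr A = (A$1$1 - A$2$2)^2 + 4 * (A$1$2 * A$2$1)"

lemma mspec_root:
  assumes "r^2 = complex_of_real (discr A)"
  shows "c \<in> mspec A \<longleftrightarrow> c = (of_real (A$1$1 + A$2$2) + r) / 2 \<or> c = (of_real (A$1$1 + A$2$2) - r) / 2"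
proof -
  let ?t = "complex_of_real (A$1$1 + A$2$2)"
  have "4 * (c^2 - ?t * c + of_real (A$1$1 * A$2$2 - A$1$2 * A$2$1)) = (2 * c - ?t)^2 - r^2"
    unfolding assms by (simp add: discr_def power2_eq_square algebra_simps)
  also have "\<dots> = (2 * c - ?t - r) * (2 * c - ?t + r)" by (simp add: power2_eq_square algebra_simps)
  finally have "c \<in> mspec A \<longleftrightarrow> 2 * c - ?t - r = 0 \<or> 2 * c - ?t + r = 0"
    unfolding mspec_iff by (metis mult_eq_0_iff mult_zero_right zero_neq_numeral)
  then show ?thesis by (auto simp: field_simps)
qed

lemma discr_neg_if_mspec_nonreal:
  assumes "mspec A \<subseteq> - \<real>"
  shows "discr A < 0"
proof (rule ccontr)
  assume "\<not> discr A < 0"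
  then have "(of_real (sqrt (discr A)))^2 = complex_of_real (discr A)"
    by (simp flip: of_real_power)
  from mspec_root[OF this] have "(of_real (A$1$1 + A$2$2) + of_real (sqrt (discr A))) / 2 \<in> mspec A" by blast
  then show False using assms by (auto dest!: subsetD simp del: of_real_add simp flip: of_real_add)
qed

lemma discr_pos_if_mspec_real:
  assumes "mspec A \<subseteq> \<real>" "card (mspec A) = 2"
  shows "discr A > 0"
proof (rule ccontr)
  assume n: "\<not> discr A > 0"
  show False
  proof (cases "discr A = 0")
    case True
    then have "c \<in> mspec A \<longleftrightarrow> c = of_real (A$1$1 + A$2$2) / 2" for c using mspec_root[of 0 A c] by simp
    then have "mspec A = {of_real (A$1$1 + A$2$2) / 2}" by blast
    then show False using assms(2) by simp
  next
    case False
    let ?s = "sqrt (- discr A)"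
    have "(\<i> * of_real ?s)^2 = complex_of_real (discr A)"
      using n by (simp add: power_mult_distrib flip: of_real_power)
    from mspec_root[OF this] have "(of_real (A$1$1 + A$2$2) + \<i> * of_real ?s) / 2 \<in> mspec A" by blast
    then have "Im ((of_real (A$1$1 + A$2$2) + \<i> * of_real ?s) / 2) = 0"
      using assms(1) by (auto simp: complex_is_Real_iff)
    then show False using n False by simp
  qed
qed

text \<open>\<open>T A = D T\<close> says that the rows of \<open>T\<close> are left eigenvectors:
  \<open>(c, l - a)\<close> if \<open>c\<close> is nonzero, \<open>(l - d, b)\<close> if
  \<open>b\<close> is nonzero.\<close>

lemma normal_form_real:
  assumes "discr A > 0"
  obtains T l1 l2 where "invertible T" "l1 \<noteq> l2" "conj_by T A = mat2 l1 0 0 l2"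
proof -
  define a b c d where abcd: "a = A$1$1" "b = A$1$2" "c = A$2$1" "d = A$2$2"
  define r where "r = sqrt (discr A)"
  have r: "r > 0" "r * r = (a - d)^2 + 4 * (b * c)"
    using assms by (simp_all add: r_def discr_def abcd)
  define l where "l = (\<lambda>s. (a + d + s * r) / 2)"
  have l: "l 1 \<noteq> l (-1)" using r by (simp add: l_def)
  have chi: "(l s - a) * (l s - d) = b * c" if "s * s = 1" for s
  proof -
    have "4 * ((l s - a) * (l s - d)) = (s * s) * (r * r) - (a - d)^2"
      by (simp add: l_def field_simps power2_eq_square)
    then show ?thesis using that r(2) by simp
  qed
  consider "c \<noteq> 0" | "b \<noteq> 0" | "b = 0" "c = 0" by blast
  then show ?thesis
  proof cases
    case 1
    let ?T = "mat2 c (l 1 - a) c (l (-1) - a)"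
    have inv: "invertible ?T" using 1 l by (simp add: invertible_det_nz det_2 algebra_simps)
    have "?T ** A = mat2 (l 1) 0 0 (l (-1)) ** ?T"
      using chi[of 1] chi[of "-1"] by (simp add: matrix_eq_2 matrix_mult_2 abcd [symmetric] algebra_simps)
    then show ?thesis using that[OF inv l conj_by_eqI[OF inv]] by blast
  next
    case 2
    let ?T = "mat2 (l 1 - d) b (l (-1) - d) b"
    have inv: "invertible ?T" using 2 l by (simp add: invertible_det_nz det_2 algebra_simps)
    have "?T ** A = mat2 (l 1) 0 0 (l (-1)) ** ?T"
      using chi[of 1] chi[of "-1"] by (simp add: matrix_eq_2 matrix_mult_2 abcd [symmetric] algebra_simps)
    then show ?thesis using that[OF inv l conj_by_eqI[OF inv]] by blast
  next
    case 3
    then have "A = mat2 a 0 0 d" by (simp add: matrix_eq_2 abcd)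
    moreover have "a \<noteq> d" using 3 r by auto
    ultimately show ?thesis using that[of "mat 1" a d] by (simp add: conj_by_mat1 invertible_det_nz)
  qed
qed

lemma normal_form_complex:
  assumes "discr A < 0"
  obtains T s t where "invertible T" "t \<noteq> 0" "conj_by T A = mat2 s (- t) t s"
proof -
  define a b c d where abcd: "a = A$1$1" "b = A$1$2" "c = A$2$1" "d = A$2$2"
  define t where "t = sqrt (- discr A) / 2"
  define s where "s = (a + d) / 2"
  have "t > 0" using assms by (simp add: t_def)
  have "4 * (t * t) = - ((a - d)^2 + 4 * (b * c))"
    using assms by (simp add: t_def discr_def abcd)
  then have eq: "(s - a) * (s - d) - t * t = b * c"
    by (simp add: s_def field_simps power2_eq_square)
  have "c \<noteq> 0"
    using assms not_sum_power2_lt_zero[of "a - d" 0] by (auto simp: discr_def abcd)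
  \<comment> \<open>The rows are the real and imaginary parts of the left eigenvector
    \<open>(c, \<lambda> - a)\<close> for \<open>\<lambda> = s + i t\<close>; a negative
    discriminant forces \<open>c\<close> to be nonzero.\<close>
  let ?T = "mat2 c (s - a) 0 t"
  have inv: "invertible ?T" using \<open>c \<noteq> 0\<close> \<open>t > 0\<close> by (simp add: invertible_det_nz det_2)
  have sd: "s - d = a - s" by (simp add: s_def field_simps)
  have TA: "?T ** A = mat2 s (- t) t s ** ?T"
    using eq unfolding sd by (simp add: matrix_eq_2 matrix_mult_2 abcd [symmetric] s_def field_simps)
  show ?thesis
    by (rule that[OF inv _ conj_by_eqI[OF inv TA]]) (use \<open>t > 0\<close> in simp)
qed

text \<open>Conjugation by \<open>diag (1, v)\<close> turns the off-diagonal entries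
  \<open>b, c\<close> into \<open>b / v, c v\<close>, which have equal modulus when
  \<open>v^2 = |b / c|\<close>. The sign of \<open>b c\<close> decides between the two
  shapes.\<close>

lemma balance_off_diagonal:
  assumes "B$1$2 * B$2$1 \<noteq> 0"
  obtains v t where "v \<noteq> 0" "conj_by (mat2 1 0 0 v) (mat2 l1 0 0 l2) = mat2 l1 0 0 l2"
    "invertible (mat2 1 0 0 v)"
    "conj_by (mat2 1 0 0 v) B = mat2 (B$1$1) t t (B$2$2) \<or>
     conj_by (mat2 1 0 0 v) B = mat2 (B$1$1) (- t) t (B$2$2)"
proof -
  define b c where bc: "b = B$1$2" "c = B$2$1"
  define v where "v = sqrt \<bar>b / c\<bar>"
  have ne: "b \<noteq> 0" "c \<noteq> 0" using assms by (auto simp: bc)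
  then have v: "v > 0" "v * v = \<bar>b / c\<bar>" by (simp_all add: v_def)
  have inv: "invertible (mat2 1 0 0 v)" using v by (simp add: invertible_det_nz det_2)
  have diag: "conj_by (mat2 1 0 0 v) (mat2 l1 0 0 l2) = mat2 l1 0 0 l2"
    by (rule conj_by_eqI[OF inv]) (simp add: matrix_eq_2 matrix_mult_2)
  have "\<bar>b\<bar> = \<bar>c\<bar> * (v * v)" using v(2) ne by (simp add: abs_divide)
  then have "b = c * v * v \<or> b = - c * v * v" by (auto simp: abs_if split: if_splits)
  then show ?thesis
  proof
    assume b: "b = c * v * v"
    have "conj_by (mat2 1 0 0 v) B = mat2 (B$1$1) (c * v) (c * v) (B$2$2)"
      by (rule conj_by_eqI[OF inv]) (simp add: matrix_eq_2 matrix_mult_2 bc [symmetric] b mult_ac)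
    then show ?thesis using that[of v "c * v"] v diag inv by auto
  next
    assume b: "b = - c * v * v"
    have "conj_by (mat2 1 0 0 v) B = mat2 (B$1$1) (- (c * v)) (c * v) (B$2$2)"
      by (rule conj_by_eqI[OF inv]) (simp add: matrix_eq_2 matrix_mult_2 bc [symmetric] b mult_ac)
    then show ?thesis using that[of v "c * v"] v diag inv by auto
  qed
qed

text \<open>Rotations commute with matrices of complex type and fix the antisymmetric part of
  \<open>B\<close>, so it suffices to diagonalise the symmetric part orthogonally.\<close>

lemma rotate_symmetric_part:
  obtains R s1 s2 t where "invertible R" "\<And>s t. conj_by R (mat2 s (- t) t s) = mat2 s (- t) t s"
    "conj_by R B = mat2 s1 (- t) t s2"
proof -
  define a b c d where abcd: "a = B$1$1" "b = B$1$2" "c = B$2$1" "d = B$2$2"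
  obtain x y :: real where xy: "x^2 + y^2 = 1" "(b + c) * (x^2 - y^2) = 2 * (a - d) * x * y"
  proof -
    define p q where "p = a - d" and "q = b + c"
    \<comment> \<open>The rotation angle is half the argument of \<open>(a - d) + i (b + c)\<close>,
      so a complex square root yields its cosine and sine.\<close>
    define w where "w = csqrt (Complex p q)"
    have w2: "w^2 = Complex p q" by (simp add: w_def)
    show ?thesis
    proof (cases "w = 0")
      case True
      then have "p = 0" "q = 0" using w2 by (auto simp: complex_eq_iff)
      then show ?thesis using that[of 1 0] by (simp add: p_def q_def)
    next
      case False
      define n where "n = norm w"
      have n: "n > 0" using False by (simp add: n_def)
      have pq: "(Re w)^2 - (Im w)^2 = p" "2 * Re w * Im w = q"
        using w2 by (simp_all add: complex_eq_iff Re_power2 Im_power2)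
      have nn: "n^2 = (Re w)^2 + (Im w)^2" by (simp add: n_def cmod_power2)
      show ?thesis
      proof (rule that[of "Re w / n" "Im w / n"])
        show "(Re w / n)^2 + (Im w / n)^2 = 1"
          unfolding power_divide add_divide_distrib [symmetric] nn [symmetric] using n by simp
        have "q * ((Re w)^2 - (Im w)^2) = 2 * p * Re w * Im w"
          unfolding pq(1) unfolding pq(2) [symmetric] by simp
        then show "(b + c) * ((Re w / n)^2 - (Im w / n)^2) = 2 * (a - d) * (Re w / n) * (Im w / n)"
          unfolding p_def q_def using n by (simp add: power_divide diff_divide_distrib [symmetric] power2_eq_square)
      qed
    qed
  qed
  let ?R = "mat2 x y (- y) x"
  have inv: "invertible ?R" using xy(1) by (simp add: invertible_det_nz det_2 power2_eq_square)
  have rot: "conj_by ?R (mat2 s (- t) t s) = mat2 s (- t) t s" for s t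
    by (rule conj_by_eqI[OF inv]) (simp add: matrix_eq_2 matrix_mult_2)
  define t where "t = (c - b) / 2"
  define s1 where "s1 = a * x^2 + (b + c) * x * y + d * y^2"
  define s2 where "s2 = a * y^2 - (b + c) * x * y + d * x^2"
  have "conj_by ?R B = mat2 s1 (- t) t s2"
  proof -
    have inv': "?R ** mat2 x (- y) y x = mat 1" "mat2 x (- y) y x ** ?R = mat 1"
      using xy(1) by (simp_all add: matrix_eq_2 matrix_mult_2 mat_def power2_eq_square)
    have "matrix_inv ?R = (mat2 x (- y) y x ** ?R) ** matrix_inv ?R" unfolding inv' by simp
    also have "\<dots> = mat2 x (- y) y x"
      by (simp add: matrix_mul_assoc [symmetric] matrix_inv_right_left[OF inv])
    finally have mi: "matrix_inv ?R = mat2 x (- y) y x" .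
    have off: "(x * b + y * d) * x - (x * a + y * c) * y = - t"
      "(- y * a + x * c) * x + (- y * b + x * d) * y = t"
    proof -
      have half: "2 * E = p - p - q * 1 \<Longrightarrow> E = - (q / 2)" "2 * E = p - p + q * 1 \<Longrightarrow> E = q / 2" for E p q :: real
        by simp_all
      have "2 * ((x * b + y * d) * x - (x * a + y * c) * y)
          = ((b + c) * (x^2 - y^2) - 2 * (a - d) * x * y) - (c - b) * (x^2 + y^2)"
        by (simp add: power2_eq_square algebra_simps)
      then show "(x * b + y * d) * x - (x * a + y * c) * y = - t" unfolding xy t_def by (rule half)
      have "2 * ((- y * a + x * c) * x + (- y * b + x * d) * y)
          = ((b + c) * (x^2 - y^2) - 2 * (a - d) * x * y) + (c - b) * (x^2 + y^2)"
        by (simp add: power2_eq_square algebra_simps)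
      then show "(- y * a + x * c) * x + (- y * b + x * d) * y = t" unfolding xy t_def by (rule half)
    qed
    show ?thesis
      unfolding conj_by_def mi using off
      by (simp add: matrix_eq_2 matrix_mult_2 abcd [symmetric] s1_def s2_def power2_eq_square algebra_simps)
  qed
  then show ?thesis using that[OF inv rot] by blast
qed

lemma normal_form_exists:
  assumes "(A, B) \<in> Omega"
  shows "\<exists>T. normal_form T A"
proof -
  have "discr A < 0 \<or> discr A > 0"
    using assms discr_neg_if_mspec_nonreal discr_pos_if_mspec_real unfolding Omega_def by blast
  then show ?thesis
    unfolding normal_form_def using normal_form_complex normal_form_real by metis
qed

text \<open>With \<open>A\<close> diagonal, a vanishing commutator determinant means that
  \<open>B\<close> is triangular, and a nonvanishing one that both off-diagonal entries can be
  balanced.\<close>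

lemma commdet_diagonal: "commdet (mat2 l1 0 0 l2) B = (l1 - l2)^2 * (B$1$2 * B$2$1)"
  by (simp add: commdet_def det_2 matrix_mult_2 power2_eq_square algebra_simps)

lemma normal_form_i_exists:
  assumes "discr A > 0" "commdet A B \<noteq> 0"
  shows "\<exists>T. normal_form T A \<and> form_i T B"
proof -
  obtain T l1 l2 where T: "invertible T" "l1 \<noteq> l2" "conj_by T A = mat2 l1 0 0 l2"
    using normal_form_real[OF assms(1)] .
  define C where "C = conj_by T B"
  have "(l1 - l2)^2 * (C$1$2 * C$2$1) \<noteq> 0"
    using assms(2) commdet_conj_by[OF T(1), of A B] commdet_diagonal[of l1 l2 C] T(3) by (simp add: C_def)
  then have "C$1$2 * C$2$1 \<noteq> 0" by simp
  then obtain v t where v: "conj_by (mat2 1 0 0 v) (mat2 l1 0 0 l2) = mat2 l1 0 0 l2"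
    "invertible (mat2 1 0 0 v)"
    "conj_by (mat2 1 0 0 v) C = mat2 (C$1$1) t t (C$2$2) \<or>
     conj_by (mat2 1 0 0 v) C = mat2 (C$1$1) (- t) t (C$2$2)"
    using balance_off_diagonal by metis
  note S = conj_by_conj_by[OF v(2) T(1)]
  have "conj_by (mat2 1 0 0 v ** T) A = mat2 l1 0 0 l2" using S(2)[of A] T(3) v(1) by simp
  moreover have "form_i (mat2 1 0 0 v ** T) B"
    using S(2)[of B] v(3) unfolding form_i_def C_def [symmetric] by metis
  ultimately show ?thesis unfolding normal_form_def using S(1) T(2) by metis
qed

lemma normal_form_ii_exists:
  assumes "discr A < 0"
  shows "\<exists>T. normal_form T A \<and> form_ii T B"
proof -
  obtain T s t where T: "invertible T" "t \<noteq> 0" "conj_by T A = mat2 s (- t) t s"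
    using normal_form_complex[OF assms] .
  obtain R s1 s2 t2 where R: "invertible R" "\<And>s t. conj_by R (mat2 s (- t) t s) = mat2 s (- t) t s"
    "conj_by R (conj_by T B) = mat2 s1 (- t2) t2 s2"
    using rotate_symmetric_part[of "conj_by T B"] by metis
  note S = conj_by_conj_by[OF R(1) T(1)]
  have "conj_by (R ** T) A = mat2 s (- t) t s" using S(2)[of A] T(3) R(2) by simp
  moreover have "form_ii (R ** T) B"
    using S(2)[of B] R(3) unfolding form_ii_def by metis
  ultimately show ?thesis unfolding normal_form_def using S(1) T(2) by metis
qed

lemma hull_closed_commdet_0:
  assumes "discr A > 0" "commdet A B = 0"
  shows "hull_closed (realR2 \<union> graphplane A \<union> graphplane B)"
proof -
  obtain T l1 l2 where T: "invertible T" "l1 \<noteq> l2" "conj_by T A = mat2 l1 0 0 l2"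
    using normal_form_real[OF assms(1)] .
  define C where "C = conj_by T B"
  have "(l1 - l2)^2 * (C$1$2 * C$2$1) = 0"
    using assms(2) commdet_conj_by[OF T(1), of A B] commdet_diagonal[of l1 l2 C] T(3) by (simp add: C_def)
  then consider "C$2$1 = 0" | "C$1$2 = 0" using T(2) by auto
  then have "hull_closed (realR2 \<union> graphplane (mat2 l1 0 0 l2) \<union> graphplane C)"
  proof cases
    case 1
    then show ?thesis by (intro hull_closed_upper_triangular) simp_all
  next
    case 2
    \<comment> \<open>Exchanging the coordinates makes a lower triangular matrix upper
      triangular.\<close>
    let ?S = "mat2 0 1 1 0"
    have "hull_closed (realR2 \<union> graphplane (conj_by ?S (mat2 l1 0 0 l2)) \<union> graphplane (conj_by ?S C))"
      using 2 unfolding conj_by_swap by (intro hull_closed_upper_triangular) simp_all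
    then show ?thesis unfolding hull_closed_conj_by(3)[OF conj_by_swap(1)] .
  qed
  then show ?thesis
    unfolding C_def T(3) [symmetric] hull_closed_conj_by(3)[OF T(1)] .
qed

lemma hull_closed_posdet:
  assumes T: "invertible T" and "posdet T A" "posdet T B"
    and "hull_closed (realR2 \<union> graphplane A)" "hull_closed (realR2 \<union> graphplane B)"
    and "hull_closed (graphplane A \<union> graphplane B)"
  shows "hull_closed (realR2 \<union> graphplane A \<union> graphplane B)"
proof -
  have "hull_closed (realR2 \<union> graphplane (conj_by T A) \<union> graphplane (conj_by T B))"
    using assms unfolding posdet_def
    by (intro hull_closed_definite) (simp_all add: hull_closed_conj_by[OF T])
  then show ?thesis unfolding hull_closed_conj_by(3)[OF T] .
qed

text \<open>Its contrapositive shows that the example lies outside \<open>Omega_star\<close>,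
  without examining all admissible \<open>T\<close>.\<close>

lemma hull_closed_Omega_star:
  assumes "(A, B) \<in> Omega_star"
    and "hull_closed (realR2 \<union> graphplane A)" "hull_closed (realR2 \<union> graphplane B)"
    and "hull_closed (graphplane A \<union> graphplane B)"
  shows "hull_closed (realR2 \<union> graphplane A \<union> graphplane B)"
proof -
  consider "mspec A \<subseteq> \<real>" "card (mspec A) = 2" "commdet A B = 0"
    | T where "normal_form T A" "posdet T A" "posdet T B"
    using assms(1) unfolding Omega_star_def by blast
  then show ?thesis
  proof cases
    case 1
    then show ?thesis using hull_closed_commdet_0 discr_pos_if_mspec_real by blast
  next
    case 2
    then have "invertible T" unfolding normal_form_def by blast
    then show ?thesis using 2 assms(2-4) by (intro hull_closed_posdet)
  qed
qed

lemma mspec_diagonal: "mspec (mat2 l1 0 0 l2) = {of_real l1, of_real l2}"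
proof -
  have "c^2 - of_real (l1 + l2) * c + of_real (l1 * l2) = (c - of_real l1) * (c - of_real l2)" for c :: complex
    by (simp add: power2_eq_square algebra_simps)
  then show ?thesis by (auto simp: mspec_iff)
qed

lemma diagonal_in_Omega:
  assumes "l1 \<noteq> l2"
  shows "(mat2 l1 0 0 l2, B) \<in> Omega" "mspec (mat2 l1 0 0 l2) \<subseteq> \<real>" "card (mspec (mat2 l1 0 0 l2)) = 2"
  using assms by (auto simp: Omega_def mspec_diagonal)

section \<open>Sufficiency for general planes\<close>

lemma loc_poly_convex_transfer:
  fixes G :: "complex^2^2"
  assumes G: "invertible G" and P: "subspace P0" "subspace P1" "subspace P2"
    and image: "(*v) G ` P0 = realR2" "(*v) G ` P1 = graphplane A" "(*v) G ` P2 = graphplane B"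
  shows "loc_poly_convex (P0 \<union> P1) 0 \<longleftrightarrow> hull_closed (realR2 \<union> graphplane A)"
    "loc_poly_convex (P0 \<union> P2) 0 \<longleftrightarrow> hull_closed (realR2 \<union> graphplane B)"
    "loc_poly_convex (P1 \<union> P2) 0 \<longleftrightarrow> hull_closed (graphplane A \<union> graphplane B)"
    "loc_poly_convex (P0 \<union> P1 \<union> P2) 0 \<longleftrightarrow> hull_closed (realR2 \<union> graphplane A \<union> graphplane B)"
  unfolding loc_poly_convex_Un[OF P(1,2)] loc_poly_convex_Un[OF P(1,3)] loc_poly_convex_Un[OF P(2,3)]
    loc_poly_convex_Un3[OF P] image [symmetric] image_Un [symmetric] hull_closed_matrix[OF G]
  by (rule refl)+

lemma sufficient_conditions:
  fixes P0 P1 P2 :: "(complex^2) set" and g :: "complex^2 \<Rightarrow> complex^2"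
    and A1 A2 :: "real^2^2"
  assumes "totally_real_plane P0" and "totally_real_plane P1" and "totally_real_plane P2"
    and "\<exists>G::complex^2^2. invertible G \<and> g = (\<lambda>z. G *v z)"
    and "g ` P0 = realR2" and "g ` P1 = graphplane A1" and "g ` P2 = graphplane A2"
    and pairs: "loc_poly_convex (P0 \<union> P1) 0" "loc_poly_convex (P0 \<union> P2) 0" "loc_poly_convex (P1 \<union> P2) 0"
  shows "(mspec A1 \<subseteq> \<real> \<and> card (mspec A1) = 2) \<longrightarrow>
         (commdet A1 A2 = 0 \<or> (\<exists>T. normal_form T A1 \<and> form_i T A2)) \<and>
         (commdet A1 A2 = 0 \<longrightarrow> loc_poly_convex (P0 \<union> P1 \<union> P2) 0) \<and>
         ((\<exists>T. normal_form T A1 \<and> form_i T A2 \<and> posdet T A1 \<and> posdet T A2) \<longrightarrow>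
            loc_poly_convex (P0 \<union> P1 \<union> P2) 0)"
    and "mspec A1 \<subseteq> - \<real> \<longrightarrow>
         (\<exists>T. normal_form T A1 \<and> form_ii T A2) \<and>
         ((\<exists>T. normal_form T A1 \<and> form_ii T A2 \<and> posdet T A1 \<and> posdet T A2) \<longrightarrow>
            loc_poly_convex (P0 \<union> P1 \<union> P2) 0)"
proof -
  obtain G :: "complex^2^2" where G: "invertible G" "g = (*v) G" using assms(4) by auto
  have sub: "subspace P0" "subspace P1" "subspace P2"
    using assms(1-3) by (auto simp: totally_real_plane_def)
  note lpc = loc_poly_convex_transfer[OF G(1) sub assms(5-7)[unfolded G(2)]]
  have pos: "loc_poly_convex (P0 \<union> P1 \<union> P2) 0" if "normal_form T A1" "posdet T A1" "posdet T A2" for T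
  proof -
    have "invertible T" using that(1) unfolding normal_form_def by blast
    then show ?thesis using that(2,3) pairs unfolding lpc by (intro hull_closed_posdet)
  qed
  show "(mspec A1 \<subseteq> \<real> \<and> card (mspec A1) = 2) \<longrightarrow>
         (commdet A1 A2 = 0 \<or> (\<exists>T. normal_form T A1 \<and> form_i T A2)) \<and>
         (commdet A1 A2 = 0 \<longrightarrow> loc_poly_convex (P0 \<union> P1 \<union> P2) 0) \<and>
         ((\<exists>T. normal_form T A1 \<and> form_i T A2 \<and> posdet T A1 \<and> posdet T A2) \<longrightarrow>
            loc_poly_convex (P0 \<union> P1 \<union> P2) 0)"
    using pos normal_form_i_exists hull_closed_commdet_0 discr_pos_if_mspec_real lpc(4) by blast
  show "mspec A1 \<subseteq> - \<real> \<longrightarrow>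
         (\<exists>T. normal_form T A1 \<and> form_ii T A2) \<and>
         ((\<exists>T. normal_form T A1 \<and> form_ii T A2 \<and> posdet T A1 \<and> posdet T A2) \<longrightarrow>
            loc_poly_convex (P0 \<union> P1 \<union> P2) 0)"
    using pos normal_form_ii_exists discr_neg_if_mspec_nonreal by blast
qed

section \<open>A family of triples on the boundary of the sufficient conditions\<close>

text \<open>Since \<open>- cot (pi p) + i\<close> and \<open>tan (pi p) + i\<close> are real
  multiples of \<open>cis (- pi p)\<close> and \<open>i cis (- pi p)\<close>, the plane is
  \<open>cis (- pi p)\<close> times the product of the real and the imaginary axis.\<close>

definition exA1 :: "real \<Rightarrow> real^2^2" where
  "exA1 p = mat2 (- cos (pi * p) / sin (pi * p)) 0 0 (sin (pi * p) / cos (pi * p))"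

text \<open>Chosen so that the plane is \<open>cis (pi k)\<close> times the set of all
  \<open>(r + (1 - i) y, r - (1 + i) y)\<close> with real \<open>r, y\<close>. This is
  \<open>(U + Y, U - Y)\<close> for real \<open>U + i Y = r\<close> and
  \<open>Y = y\<close>.\<close>

definition exA2 :: "real \<Rightarrow> real^2^2" where
  "exA2 k = (let \<sigma> = cos (pi * k) / sin (pi * k); \<tau> = 1 / (2 * (sin (pi * k))^2)
    in mat2 (\<sigma> + \<tau>) (- \<tau>) \<tau> (\<sigma> - \<tau>))"

lemma graphplane_exA1:
  assumes "sin (pi * p) \<noteq> 0" "cos (pi * p) \<noteq> 0"
  shows "z \<in> graphplane (exA1 p) \<longleftrightarrow> (\<exists>x y::real. z$1 = cis (- (pi * p)) * of_real x \<and>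
     z$2 = \<i> * cis (- (pi * p)) * of_real y)"
proof
  let ?c = "cos (pi * p)" and ?s = "sin (pi * p)"
  assume "z \<in> graphplane (exA1 p)"
  then have "z$1 = cis (- (pi * p)) * of_real (- Im (z$1) / ?s)"
    "z$2 = \<i> * cis (- (pi * p)) * of_real (Im (z$2) / ?c)"
    using assms by (auto simp: graphplane_iff exA1_def complex_eq_iff)
  then show "\<exists>x y::real. z$1 = cis (- (pi * p)) * of_real x \<and> z$2 = \<i> * cis (- (pi * p)) * of_real y"
    by blast
qed (use assms in \<open>auto simp: graphplane_iff exA1_def\<close>)

lemma graphplane_exA2:
  assumes "sin (pi * k) \<noteq> 0"
  shows "z \<in> graphplane (exA2 k) \<longleftrightarrow> (\<exists>r y::real. z$1 = cis (pi * k) * (of_real r - \<i> * of_real y + of_real y) \<and>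
     z$2 = cis (pi * k) * (of_real r - \<i> * of_real y - of_real y))"
proof
  define c s where "c = cos (pi * k)" and "s = sin (pi * k)"
  have s: "s \<noteq> 0" "c * c = 1 - s * s"
    using assms sin_cos_squared_add[of "pi * k"] by (simp_all add: c_def s_def power2_eq_square algebra_simps)
  assume z: "z \<in> graphplane (exA2 k)"
  define u v where "u = Im (z$1)" and "v = Im (z$2)"
  \<comment> \<open>Solves the imaginary parts of the two formulas for \<open>y\<close> and
    \<open>r\<close>; the graph equations then give the real parts.\<close>
  define y where "y = (u - v) / (2 * s)"
  define r where "r = (u + v + 2 * c * y) / (2 * s)"
  have uv: "u = s * (r + y) - c * y" "v = s * (r - y) - c * y"
    using s(1) by (simp_all add: r_def y_def field_simps)
  have Re: "Re (z$1) = c / s * u + (u - v) / (2 * (s * s))" "Re (z$2) = c / s * v + (u - v) / (2 * (s * s))"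
    using z by (simp_all add: graphplane_iff exA2_def Let_def u_def v_def c_def s_def
      algebra_simps diff_divide_distrib power2_eq_square)
  have uv': "(u - v) / (2 * (s * s)) = y / s" using s(1) by (simp add: y_def)
  have "Re (z$1) * s = (c * (r + y) + s * y) * s" "Re (z$2) * s = (c * (r - y) + s * y) * s"
    unfolding Re uv' using s(1) by (simp_all add: uv distrib_right) (use s(2) in \<open>algebra+\<close>)
  then have "Re (z$1) = c * (r + y) + s * y" "Re (z$2) = c * (r - y) + s * y" using s(1) by simp_all
  then have "z$1 = cis (pi * k) * (of_real r - \<i> * of_real y + of_real y)"
    "z$2 = cis (pi * k) * (of_real r - \<i> * of_real y - of_real y)"
    using uv by (simp_all add: complex_eq_iff u_def v_def c_def s_def algebra_simps)
  then show "\<exists>r y::real. z$1 = cis (pi * k) * (of_real r - \<i> * of_real y + of_real y) \<and>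
     z$2 = cis (pi * k) * (of_real r - \<i> * of_real y - of_real y)" by blast
next
  define c s where "c = cos (pi * k)" and "s = sin (pi * k)"
  have s: "s \<noteq> 0" "c * c = 1 - s * s"
    using assms sin_cos_squared_add[of "pi * k"] by (simp_all add: c_def s_def power2_eq_square algebra_simps)
  assume "\<exists>r y::real. z$1 = cis (pi * k) * (of_real r - \<i> * of_real y + of_real y) \<and>
     z$2 = cis (pi * k) * (of_real r - \<i> * of_real y - of_real y)"
  then obtain r y :: real where z: "z$1 = cis (pi * k) * (of_real r - \<i> * of_real y + of_real y)"
     "z$2 = cis (pi * k) * (of_real r - \<i> * of_real y - of_real y)" by blast
  define u v where "u = Im (z$1)" and "v = Im (z$2)"
  have uv: "u = s * (r + y) - c * y" "v = s * (r - y) - c * y"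
    "Re (z$1) = c * (r + y) + s * y" "Re (z$2) = c * (r - y) + s * y"
    by (simp_all add: z u_def v_def c_def s_def algebra_simps)
  have uv': "(u - v) / (2 * (s * s)) = y / s" using s(1) by (simp add: uv field_simps)
  have "Re (z$1) * s = (c / s * u + y / s) * s" "Re (z$2) * s = (c / s * v + y / s) * s"
    using s(1) by (simp_all add: uv distrib_right) (use s(2) in \<open>algebra+\<close>)
  then have "Re (z$1) = c / s * u + (u - v) / (2 * (s * s))" "Re (z$2) = c / s * v + (u - v) / (2 * (s * s))"
    unfolding uv' using s(1) by simp_all
  then show "z \<in> graphplane (exA2 k)"
    by (simp add: graphplane_iff exA2_def Let_def u_def v_def c_def s_def
      algebra_simps diff_divide_distrib power2_eq_square)
qed

lemma hull_closed_realR2_exA1: "hull_closed (realR2 \<union> graphplane (exA1 p))"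
  using hull_closed_upper_triangular[of "exA1 p" "exA1 p"] by (simp add: exA1_def Un_assoc)

text \<open>\<open>exA2 k\<close> is \<open>\<sigma>\<close> plus \<open>\<tau>\<close> times the
  nilpotent matrix with rows \<open>(1, -1)\<close> twice; in a basis adapted to its kernel it is
  upper triangular.\<close>

lemma hull_closed_realR2_exA2: "hull_closed (realR2 \<union> graphplane (exA2 k))"
proof -
  let ?T = "mat2 1 0 1 (-1)"
  define \<sigma> \<tau> where "\<sigma> = cos (pi * k) / sin (pi * k)" and "\<tau> = 1 / (2 * (sin (pi * k))^2)"
  have inv: "invertible ?T" by (simp add: invertible_det_nz det_2)
  have "conj_by ?T (exA2 k) = mat2 \<sigma> \<tau> 0 \<sigma>"
    by (rule conj_by_eqI[OF inv])
       (simp add: matrix_eq_2 matrix_mult_2 exA2_def \<sigma>_def [symmetric] \<tau>_def [symmetric] Let_def)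
  then have "hull_closed (realR2 \<union> graphplane (conj_by ?T (exA2 k)))"
    using hull_closed_upper_triangular[of "mat2 \<sigma> \<tau> 0 \<sigma>" "mat2 \<sigma> \<tau> 0 \<sigma>"] by (simp add: Un_assoc)
  then show ?thesis unfolding hull_closed_conj_by(1)[OF inv] .
qed

text \<open>The complex line on which the first functional of the matrix below is free and the second one
  vanishes meets each of the two planes in a real line, so both planes are triangular with respect to
  the second functional.\<close>

lemma hull_closed_exA1_exA2:
  assumes "sin (pi * p) \<noteq> 0" "cos (pi * p) \<noteq> 0" "sin (pi * k) \<noteq> 0"
    and pk: "cos (pi * (p + k)) \<noteq> sin (pi * (p + k))"
  shows "hull_closed (graphplane (exA1 p) \<union> graphplane (exA2 k))"
proof -
  define G :: "complex^2^2" where "G = vector [vector [1, -1], vector [1 + \<i>, 1 - \<i>]]"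
  have Gz: "(G *v z)$1 = z$1 - z$2" "(G *v z)$2 = (1 + \<i>) * z$1 + (1 - \<i>) * z$2" for z
    by (simp_all add: matrix_vector_2 G_def)
  have "det G = 2" by (simp add: det_2 G_def)
  then have G: "invertible G" by (simp add: invertible_det_nz)
  let ?a = "cis (- (pi * p))" and ?b = "cis (pi * k)"
  have tri1: "(*v) G ` graphplane (exA1 p) = tri (- ((1 + \<i>) * ?a)) ?a ((1 + \<i>) * ?a)"
  proof (intro set_eqI iffI)
    fix w assume "w \<in> (*v) G ` graphplane (exA1 p)"
    then obtain z and x y :: real where w: "w = G *v z" "z$1 = ?a * of_real x" "z$2 = \<i> * ?a * of_real y"
      using graphplane_exA1[OF assms(1,2)] by blast
    have "w$1 = - ((1 + \<i>) * ?a) * of_real y + ?a * of_real (x + y)"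
      "w$2 = (1 + \<i>) * ?a * of_real (x + y)"
      by (simp_all add: w Gz algebra_simps)
    then show "w \<in> tri (- ((1 + \<i>) * ?a)) ?a ((1 + \<i>) * ?a)" unfolding tri_def by blast
  next
    fix w assume "w \<in> tri (- ((1 + \<i>) * ?a)) ?a ((1 + \<i>) * ?a)"
    then obtain x y :: real where w: "w$1 = - ((1 + \<i>) * ?a) * of_real x + ?a * of_real y"
      "w$2 = (1 + \<i>) * ?a * of_real y" unfolding tri_def by blast
    define z :: "complex^2" where "z = vector [?a * of_real (y - x), \<i> * ?a * of_real x]"
    have "z$1 = ?a * of_real (y - x)" "z$2 = \<i> * ?a * of_real x" by (simp_all add: z_def)
    then have "z \<in> graphplane (exA1 p)" using graphplane_exA1[OF assms(1,2)] by blast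
    moreover have "w = G *v z"
      by (simp add: vec_eq_iff forall_2 w Gz z_def algebra_simps)
    ultimately show "w \<in> (*v) G ` graphplane (exA1 p)" by blast
  qed
  have tri2: "(*v) G ` graphplane (exA2 k) = tri (2 * ?b) 0 (2 * ?b)"
  proof (intro set_eqI iffI)
    fix w assume "w \<in> (*v) G ` graphplane (exA2 k)"
    then obtain z and r y :: real where w: "w = G *v z" "z$1 = ?b * (of_real r - \<i> * of_real y + of_real y)"
      "z$2 = ?b * (of_real r - \<i> * of_real y - of_real y)"
      using graphplane_exA2[OF assms(3)] by blast
    have "w$1 = 2 * ?b * of_real y + 0 * of_real r" "w$2 = 2 * ?b * of_real r"
      by (simp_all add: w Gz algebra_simps)
    then show "w \<in> tri (2 * ?b) 0 (2 * ?b)" unfolding tri_def by blast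
  next
    fix w assume "w \<in> tri (2 * ?b) 0 (2 * ?b)"
    then obtain y r :: real where w: "w$1 = 2 * ?b * of_real y + 0 * of_real r" "w$2 = 2 * ?b * of_real r"
      unfolding tri_def by blast
    define z :: "complex^2" where
      "z = vector [?b * (of_real r - \<i> * of_real y + of_real y), ?b * (of_real r - \<i> * of_real y - of_real y)]"
    have "z$1 = ?b * (of_real r - \<i> * of_real y + of_real y)"
      "z$2 = ?b * (of_real r - \<i> * of_real y - of_real y)" by (simp_all add: z_def)
    then have "z \<in> graphplane (exA2 k)" using graphplane_exA2[OF assms(3)] by blast
    moreover have "w = G *v z"
      by (simp add: vec_eq_iff forall_2 w Gz z_def algebra_simps)
    ultimately show "w \<in> (*v) G ` graphplane (exA2 k)" by blast
  qed
  \<comment> \<open>The second functional sends the planes onto lines whose directions differ by the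
    angle \<open>pi (p + k) - pi/4\<close>, so \<open>pk\<close> says that these lines are
    distinct.\<close>
  have "?b * cnj ?a = cis (pi * (p + k))" by (simp add: cis_cnj cis_mult algebra_simps)
  then have "2 * ?b * cnj ((1 + \<i>) * ?a) = 2 * ((1 - \<i>) * cis (pi * (p + k)))"
    by (simp add: algebra_simps)
  then have "Im (2 * ?b * cnj ((1 + \<i>) * ?a)) = 2 * (sin (pi * (p + k)) - cos (pi * (p + k)))"
    by (simp only:) simp
  then have ne: "Im (2 * ?b * cnj ((1 + \<i>) * ?a)) \<noteq> 0" using pk by simp
  have "1 + \<i> \<noteq> 0" by (simp add: complex_eq_iff)
  then have "hull_closed (tri (- ((1 + \<i>) * ?a)) ?a ((1 + \<i>) * ?a) \<union> tri (2 * ?b) 0 (2 * ?b) \<union> tri (2 * ?b) 0 (2 * ?b))"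
    using ne by (intro hull_closed_tri) auto
  then have "hull_closed ((*v) G ` (graphplane (exA1 p) \<union> graphplane (exA2 k)))"
    unfolding image_Un tri1 tri2 by (simp add: Un_assoc)
  then show ?thesis unfolding hull_closed_matrix[OF G] .
qed

section \<open>Complete elliptic integrals\<close>

definition ellarg :: "complex \<Rightarrow> complex \<Rightarrow> real \<Rightarrow> complex" where
  "ellarg a b t = a * of_real ((cos t)^2) + b * of_real ((sin t)^2)"

text \<open>Gauss's homogeneous form: \<open>pi/2\<close> over the arithmetic-geometric mean of the
  roots of \<open>a\<close> and \<open>b\<close>, for positive \<open>a, b\<close>. Here
  \<open>ellint x 1\<close> is \<open>K(1 - x)\<close> and \<open>ellint (1 - x) 1\<close> is
  \<open>K(x)\<close>; the second argument is needed for the combination in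
  \<open>ellint_connection\<close>.\<close>

definition ellint :: "complex \<Rightarrow> complex \<Rightarrow> complex" where
  "ellint a b = integral {0..pi/2} (\<lambda>t. 1 / csqrt (ellarg a b t))"

text \<open>Keeps the principal square root off its branch cut.\<close>

definition ellok :: "complex \<Rightarrow> complex \<Rightarrow> bool" where
  "ellok a b \<longleftrightarrow> (\<forall>t. ellarg a b t \<notin> \<real>\<^sub>\<le>\<^sub>0)"

text \<open>\<open>ellarg a b t\<close> is a convex combination of \<open>a\<close> and
  \<open>b\<close>, so a half-plane that contains both and misses the cut suffices.\<close>

lemma ellok_Re:
  assumes "Re a > 0" "Re b > 0" shows "ellok a b"
  unfolding ellok_def
proof
  fix t
  have "Re (ellarg a b t) = Re a * (cos t)^2 + Re b * (sin t)^2" by (simp add: ellarg_def)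
  also have "\<dots> \<ge> min (Re a) (Re b) * (cos t)^2 + min (Re a) (Re b) * (sin t)^2"
    by (intro add_mono mult_right_mono) auto
  also have "min (Re a) (Re b) * (cos t)^2 + min (Re a) (Re b) * (sin t)^2 = min (Re a) (Re b)"
    by (simp add: distrib_left [symmetric])
  finally show "ellarg a b t \<notin> \<real>\<^sub>\<le>\<^sub>0" using assms by (auto simp: complex_nonpos_Reals_iff)
qed

lemma ellok_Im_neg:
  assumes "Im a < 0" "Im b < 0" shows "ellok a b"
  unfolding ellok_def
proof
  fix t
  have "Im (ellarg a b t) = Im a * (cos t)^2 + Im b * (sin t)^2" by (simp add: ellarg_def)
  also have "\<dots> \<le> max (Im a) (Im b) * (cos t)^2 + max (Im a) (Im b) * (sin t)^2"
    by (intro add_mono mult_right_mono) auto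
  also have "max (Im a) (Im b) * (cos t)^2 + max (Im a) (Im b) * (sin t)^2 = max (Im a) (Im b)"
    by (simp add: distrib_left [symmetric])
  finally show "ellarg a b t \<notin> \<real>\<^sub>\<le>\<^sub>0" using assms by (auto simp: complex_nonpos_Reals_iff)
qed

lemma ellok_1:
  assumes "Im a \<noteq> 0 \<or> Re a > 0" shows "ellok a 1"
  unfolding ellok_def
proof
  fix t
  have Im: "Im (ellarg a 1 t) = Im a * (cos t)^2" by (simp add: ellarg_def)
  show "ellarg a 1 t \<notin> \<real>\<^sub>\<le>\<^sub>0"
  proof (cases "Re a > 0")
    case True
    then have "ellok a 1" by (intro ellok_Re) auto
    then show ?thesis unfolding ellok_def by blast
  next
    case False
    then have a: "Im a \<noteq> 0" using assms by blast
    show ?thesis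
    proof (cases "cos t = 0")
      case True
      then have "(sin t)^2 = 1" using sin_cos_squared_add[of t] by simp
      then show ?thesis using True by (simp add: ellarg_def)
    next
      case False
      then show ?thesis using Im a by (auto simp: complex_nonpos_Reals_iff)
    qed
  qed
qed

section \<open>Continuity and holomorphy of the integrals\<close>

lemma continuous_on_ellarg:
  fixes a b :: "complex \<Rightarrow> complex"
  assumes "continuous_on S a" "continuous_on S b"
  shows "continuous_on (S \<times> T) (\<lambda>(x, t). ellarg (a x) (b x) t)"
proof -
  have "continuous_on (S \<times> T) (\<lambda>z. a (fst z))" "continuous_on (S \<times> T) (\<lambda>z. b (fst z))"
    by (rule continuous_on_compose2[OF assms(1) continuous_on_fst[OF continuous_on_id]]
          continuous_on_compose2[OF assms(2) continuous_on_fst[OF continuous_on_id]]; auto)+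
  then show ?thesis
    unfolding ellarg_def case_prod_unfold by (intro continuous_intros)
qed

lemma continuous_on_csqrt_slit:
  assumes "continuous_on S f" "\<And>z. z \<in> S \<Longrightarrow> f z \<notin> \<real>\<^sub>\<le>\<^sub>0"
  shows "continuous_on S (\<lambda>z. csqrt (f z))"
proof (rule continuous_on_compose2[OF _ assms(1)])
  show "continuous_on (- \<real>\<^sub>\<le>\<^sub>0) csqrt"
    by (intro continuous_at_imp_continuous_on ballI continuous_at_csqrt) auto
qed (use assms(2) in auto)

lemma continuous_on_ell_integrand:
  fixes a b :: "complex \<Rightarrow> complex"
  assumes "continuous_on S a" "continuous_on S b" "\<And>x. x \<in> S \<Longrightarrow> ellok (a x) (b x)"
  shows "continuous_on (S \<times> T) (\<lambda>(x, t). 1 / csqrt (ellarg (a x) (b x) t))"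
proof -
  have "continuous_on (S \<times> T) (\<lambda>z. ellarg (a (fst z)) (b (fst z)) (snd z))"
    using continuous_on_ellarg[OF assms(1,2)] by (simp add: case_prod_unfold)
  moreover have "ellarg (a (fst z)) (b (fst z)) (snd z) \<notin> \<real>\<^sub>\<le>\<^sub>0" if "z \<in> S \<times> T" for z
    using assms(3) that by (auto simp: ellok_def)
  ultimately show ?thesis
    unfolding case_prod_unfold
    by (intro continuous_on_divide continuous_on_const continuous_on_csqrt_slit) force+
qed

lemma continuous_on_ellint:
  fixes a b :: "complex \<Rightarrow> complex"
  assumes "continuous_on S a" "continuous_on S b" "\<And>x. x \<in> S \<Longrightarrow> ellok (a x) (b x)"
  shows "continuous_on S (\<lambda>x. ellint (a x) (b x))"
  using integral_continuous_on_param[OF continuous_on_ell_integrand[OF assms, where T = "cbox 0 (pi/2)"]]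
  by (simp add: ellint_def)

lemma continuous_on_ell_integrand1:
  assumes "ellok a b"
  shows "continuous_on T (\<lambda>t. 1 / csqrt (ellarg a b t))"
proof -
  have "continuous_on ({a} \<times> T) (\<lambda>(x, t). 1 / csqrt (ellarg x b t))"
    by (rule continuous_on_ell_integrand) (use assms in \<open>auto intro: continuous_intros\<close>)
  then have "continuous_on T (\<lambda>t. (\<lambda>(x, t). 1 / csqrt (ellarg x b t)) (a, t))"
    by (rule continuous_on_compose2) (auto intro!: continuous_intros)
  then show ?thesis by simp
qed

lemma ell_integrable:
  "ellok a b \<Longrightarrow> (\<lambda>t. 1 / csqrt (ellarg a b t)) integrable_on {c..d}"
  by (intro integrable_continuous_interval continuous_on_ell_integrand1)

lemma holomorphic_on_ellint:
  assumes U: "convex U" and ok: "\<And>x. x \<in> U \<Longrightarrow> ellok (a0 + a1 * x) (b0 + b1 * x)"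
  shows "(\<lambda>x. ellint (a0 + a1 * x) (b0 + b1 * x)) holomorphic_on U"
proof -
  let ?L = "\<lambda>x t. ellarg (a0 + a1 * x) (b0 + b1 * x) t"
  let ?d = "\<lambda>t. ellarg a1 b1 t"
  have L: "?L x t \<notin> \<real>\<^sub>\<le>\<^sub>0" if "x \<in> U" for x t using ok[OF that] unfolding ellok_def by blast
  have "(\<lambda>x. integral (cbox 0 (pi/2)) (\<lambda>t. 1 / csqrt (?L x t))) holomorphic_on U"
  proof (rule leibniz_rule_holomorphic[OF _ _ _ U])
    fix x :: complex and t :: real assume x: "x \<in> U"
    have "((\<lambda>x. ?L x t) has_field_derivative ?d t) (at x within U)"
      unfolding ellarg_def by (auto intro!: derivative_eq_intros)
    moreover have "csqrt (?L x t) \<noteq> 0" using L[OF x, of t] by auto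
    ultimately show "((\<lambda>x. 1 / csqrt (?L x t)) has_field_derivative
        - (?d t / (2 * csqrt (?L x t))) / (csqrt (?L x t) * csqrt (?L x t))) (at x within U)"
      using L[OF x, of t] by (auto intro!: derivative_eq_intros)
  next
    fix x assume "x \<in> U"
    then show "(\<lambda>t. 1 / csqrt (?L x t)) integrable_on cbox 0 (pi/2)"
      using ell_integrable[OF ok] by simp
  next
    have c: "continuous_on (U \<times> cbox 0 (pi/2)) (\<lambda>z. ?L (fst z) (snd z))"
      "continuous_on (U \<times> cbox 0 (pi/2)) (\<lambda>z. ?d (snd z))"
      unfolding ellarg_def by (intro continuous_intros)+
    have n: "?L (fst z) (snd z) \<notin> \<real>\<^sub>\<le>\<^sub>0" if "z \<in> U \<times> cbox 0 (pi/2)" for z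
      using L that by auto
    then have n0: "csqrt (?L (fst z) (snd z)) \<noteq> 0" if "z \<in> U \<times> cbox 0 (pi/2)" for z
      using that by fastforce
    show "continuous_on (U \<times> cbox 0 (pi/2)) (\<lambda>(x, t). - (?d t / (2 * csqrt (?L x t))) / (csqrt (?L x t) * csqrt (?L x t)))"
      unfolding case_prod_unfold
      using n0 by (intro continuous_intros c continuous_on_csqrt_slit n) auto
  qed
  then show ?thesis by (simp add: ellint_def)
qed

section \<open>Symmetry and growth of the integrals\<close>

lemma ellarg_cnj: "ellarg (cnj a) (cnj b) t = cnj (ellarg a b t)"
  by (simp add: ellarg_def)

lemma ellint_cnj:
  assumes "ellok a b"
  shows "ellint (cnj a) (cnj b) = cnj (ellint a b)"
  unfolding ellint_def integral_cnj ellarg_cnj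
  using assms by (simp add: ellok_def cnj_csqrt)

lemma ellint_real:
  assumes "ellok (of_real a) (of_real b)"
  shows "Im (ellint (of_real a) (of_real b)) = 0"
  using ellint_cnj[OF assms] by (simp add: complex_eq_iff)

text \<open>The integrand is at least 1 because \<open>a <= 1\<close>. This crude bound is enough to
  see that the disc is not constant.\<close>

lemma ellint_ge:
  assumes "0 < a" "a \<le> 1"
  shows "Re (ellint (of_real a) 1) \<ge> pi / 2"
proof -
  have ok: "ellok (of_real a) 1" using assms by (intro ellok_1) simp
  let ?f = "\<lambda>t. 1 / csqrt (ellarg (of_real a) 1 t)"
  have eq: "ellarg (of_real a) 1 t = of_real (a * (cos t)^2 + (sin t)^2)" for t by (simp add: ellarg_def)
  have ge: "1 \<le> Re (?f t)" for t
  proof -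
    let ?r = "a * (cos t)^2 + (sin t)^2"
    have "ellarg (of_real a) 1 t \<notin> \<real>\<^sub>\<le>\<^sub>0" using ok unfolding ellok_def by blast
    then have pos: "?r > 0" unfolding eq by (simp add: complex_nonpos_Reals_iff del: of_real_add of_real_mult)
    have "?r \<le> 1 * (cos t)^2 + (sin t)^2" using assms by (intro add_mono mult_right_mono) auto
    then have r: "?r \<le> 1" by simp
    have "?f t = of_real (1 / sqrt ?r)" unfolding eq using pos by (subst csqrt_of_real) auto
    moreover have "1 / sqrt ?r \<ge> 1" using pos r by (simp add: le_divide_eq_1)
    ultimately show ?thesis by (simp only: Re_complex_of_real)
  qed
  have int: "(?f has_integral ellint (of_real a) 1) {0..pi/2}"
    unfolding ellint_def by (rule integrable_integral[OF ell_integrable[OF ok]])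
  have Re: "((\<lambda>t. Re (?f t)) has_integral Re (ellint (of_real a) 1)) {0..pi/2}"
    using has_integral_linear[OF int bounded_linear_Re] by (simp add: o_def)
  have "((\<lambda>t. 1::real) has_integral (pi / 2)) {0..pi/2}"
    using has_integral_const_real[of "1::real" 0 "pi/2"] by simp
  then show ?thesis by (rule has_integral_le[OF _ Re]) (rule ge)
qed

text \<open>The hypothesis says that the two summands enclose at most a right angle, so neither can
  cancel the other.\<close>

lemma ellarg_norm_ge:
  assumes "Re (a * cnj b) \<ge> 0"
  shows "norm a * (cos t)^2 \<le> norm (ellarg a b t)" "norm b * (sin t)^2 \<le> norm (ellarg a b t)"
proof -
  define x y where "x = (cos t)^2" and "y = (sin t)^2"
  have xy: "x \<ge> 0" "y \<ge> 0" by (auto simp: x_def y_def)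
  have "(norm (ellarg a b t))^2 = (norm a * x)^2 + (norm b * y)^2 + 2 * x * y * Re (a * cnj b)"
    unfolding ellarg_def x_def [symmetric] y_def [symmetric] cmod_power2 power_mult_distrib
    by (simp add: power2_eq_square algebra_simps)
  then have "(norm a * x)^2 \<le> (norm (ellarg a b t))^2" "(norm b * y)^2 \<le> (norm (ellarg a b t))^2"
    using xy assms by (simp_all add: mult_nonneg_nonneg)
  then show "norm a * (cos t)^2 \<le> norm (ellarg a b t)" "norm b * (sin t)^2 \<le> norm (ellarg a b t)"
    unfolding x_def y_def by (metis norm_ge_zero power2_le_imp_le)+
qed

text \<open>A weak Jordan inequality: \<open>sin x >= x cos x\<close> at \<open>x = t / 2\<close>
  and the doubling formula give \<open>sin t >= t (1 + cos t) / 2\<close>.\<close>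

lemma sin_ge_half:
  assumes "0 \<le> t" "t \<le> pi / 2"
  shows "t / 2 \<le> sin t"
proof -
  have "sin 0 - 0 * cos 0 \<le> sin (t/2) - t/2 * cos (t/2)"
  proof (rule DERIV_nonneg_imp_nondecreasing[where f = "\<lambda>x. sin x - x * cos x"])
    fix x :: real assume x: "0 \<le> x" "x \<le> t/2"
    have "((\<lambda>x. sin x - x * cos x) has_real_derivative x * sin x) (at x)"
      by (auto intro!: derivative_eq_intros)
    moreover have "x * sin x \<ge> 0" using x assms pi_gt_zero by (intro mult_nonneg_nonneg sin_ge_zero) auto
    ultimately show "\<exists>y. ((\<lambda>x. sin x - x * cos x) has_real_derivative y) (at x) \<and> 0 \<le> y" by blast
  qed (use assms in auto)
  moreover have "cos (t/2) \<ge> 0" using assms pi_gt_zero by (intro cos_ge_zero) auto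
  ultimately have "2 * (t/2 * cos (t/2)) * cos (t/2) \<le> 2 * sin (t/2) * cos (t/2)"
    by (intro mult_right_mono) auto
  also have "\<dots> = sin t" using sin_double[of "t/2"] by simp
  finally have "t * (cos (t/2))^2 \<le> sin t" by (simp add: power2_eq_square)
  moreover have "(cos (t/2))^2 = (1 + cos t) / 2" using cos_double_cos[of "t/2"] by simp
  moreover have "cos t \<ge> 0" using assms by (intro cos_ge_zero) auto
  then have "t * (1/2) \<le> t * ((1 + cos t) / 2)" using assms by (intro mult_left_mono) auto
  ultimately show ?thesis by simp
qed

text \<open>Interpolating between the two lower bounds for the argument of the square root.\<close>

lemma ellint_bound:
  assumes \<beta>: "0 < \<beta>" "\<beta> < 1"
  obtains C where "C > 0" "\<And>a b. ellok a b \<Longrightarrow> Re (a * cnj b) \<ge> 0 \<Longrightarrow> a \<noteq> 0 \<Longrightarrow> b \<noteq> 0 \<Longrightarrow>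
    norm (ellint a b) \<le> C * norm a powr (- (\<beta> / 2)) * norm b powr (- ((1 - \<beta>) / 2))"
proof -
  \<comment> \<open>A majorant of
    \<open>cos t powr (- \<beta>) * sin t powr (- (1 - \<beta>))\<close>, integrable because both
    exponents exceed -1. One factor 2 comes from \<open>sin t >= t / 2\<close>, the other from the
    nonsingular factor.\<close>
  define h where "h = (\<lambda>t::real. 4 * (pi/2 - t) powr (- \<beta>) + 4 * t powr (- (1 - \<beta>)))"
  have "(\<lambda>t. t powr (- (1 - \<beta>))) integrable_on {0..pi/2}"
    using has_integral_powr_from_0[of "- (1 - \<beta>)" "pi/2"] \<beta> by (auto simp: integrable_on_def)
  moreover have "(\<lambda>t. (pi/2 - t) powr (- \<beta>)) integrable_on {0..pi/2}"
  proof -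
    have "((\<lambda>t. t powr (- \<beta>)) has_integral ((pi/2) powr (- \<beta> + 1) / (- \<beta> + 1))) (cbox 0 (pi/2))"
      using has_integral_powr_from_0[of "- \<beta>" "pi/2"] \<beta> by simp
    from has_integral_affinity[OF this, of "-1" "pi/2"]
    have "(\<lambda>t. (pi/2 - t) powr (- \<beta>)) integrable_on ((\<lambda>x. - x + pi / 2) ` {0..pi/2})"
      by (auto simp: integrable_on_def add.commute)
    moreover have "(\<lambda>x. - x + pi / 2) ` {0..pi/2} = {0..pi/2}"
    proof (intro set_eqI iffI)
      fix y :: real assume "y \<in> {0..pi/2}"
      then have "y = - (pi/2 - y) + pi/2" "pi/2 - y \<in> {0..pi/2}" by auto
      then show "y \<in> (\<lambda>x. - x + pi / 2) ` {0..pi/2}" by blast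
    qed auto
    ultimately show ?thesis by simp
  qed
  ultimately have h: "h integrable_on {0<..<pi/2}"
    unfolding h_def integrable_on_open_interval_real by (intro integrable_add integrable_on_mult_right) auto
  define C where "C = integral {0<..<pi/2} h"
  have "C \<ge> 0" unfolding C_def by (intro integral_nonneg h) (auto simp: h_def)
  have main: "norm (ellint a b) \<le> C * norm a powr (- (\<beta> / 2)) * norm b powr (- ((1 - \<beta>) / 2))"
    if ok: "ellok a b" and ab: "Re (a * cnj b) \<ge> 0" "a \<noteq> 0" "b \<noteq> 0" for a b
  proof -
    let ?f = "\<lambda>t. 1 / csqrt (ellarg a b t)"
    let ?k = "norm a powr (- (\<beta> / 2)) * norm b powr (- ((1 - \<beta>) / 2))"
    have le: "norm (?f t) \<le> ?k * h t" if t: "t \<in> {0<..<pi/2}" for t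
    proof -
      let ?N = "norm (ellarg a b t)"
      define c s where "c = cos t" and "s = sin t"
      have c: "c > 0" unfolding c_def using t by (intro cos_gt_zero) auto
      have s: "s > 0" unfolding s_def using t by (intro sin_gt_zero) auto
      define A B where "A = norm a * c^2" and "B = norm b * s^2"
      have AB: "0 < A" "0 < B" "A \<le> ?N" "B \<le> ?N"
        using ellarg_norm_ge[OF ab(1), of t] ab c s by (auto simp: A_def B_def c_def s_def)
      have "A powr (\<beta>/2) * B powr ((1 - \<beta>)/2) \<le> ?N powr (\<beta>/2) * ?N powr ((1-\<beta>)/2)"
        using AB \<beta> by (intro mult_mono powr_mono2) auto
      also have "\<dots> = ?N powr (1/2)"
        by (simp add: powr_add [symmetric] add_divide_distrib [symmetric])
      finally have "A powr (\<beta>/2) * B powr ((1 - \<beta>)/2) \<le> sqrt ?N"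
        using AB by (simp add: powr_half_sqrt)
      then have "norm (?f t) \<le> 1 / (A powr (\<beta>/2) * B powr ((1 - \<beta>)/2))"
        using AB by (simp add: norm_divide frac_le)
      also have "\<dots> = ?k * (c powr (- \<beta>) * s powr (- (1 - \<beta>)))"
      proof -
        have sq: "(x^2) powr (g/2) = x powr g" if "x > 0" for x g :: real
          using that powr_powr[of x 2 "g/2"] by simp
        have "A powr (\<beta>/2) = norm a powr (\<beta>/2) * c powr \<beta>"
          unfolding A_def by (subst powr_mult) (simp_all add: sq[OF c])
        moreover have "B powr ((1 - \<beta>)/2) = norm b powr ((1 - \<beta>)/2) * s powr (1 - \<beta>)"
          unfolding B_def by (subst powr_mult) (simp_all add: sq[OF s])
        ultimately show ?thesis
          by (simp only: powr_minus divide_inverse inverse_mult_distrib mult_1 mult_ac)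
      qed
      also have "\<dots> \<le> ?k * h t"
      proof (intro mult_left_mono)
        have cb: "c \<ge> (pi/2 - t) / 2"
          using sin_ge_half[of "pi/2 - t"] t by (simp add: c_def cos_sin_eq)
        have sb: "s \<ge> t / 2" using sin_ge_half[of t] t by (simp add: s_def)
        have two: "2 powr \<beta> \<le> 2" "2 powr (1 - \<beta>) \<le> 2"
          using powr_mono[of \<beta> 1 "2::real"] powr_mono[of "1-\<beta>" 1 "2::real"] \<beta> by auto
        have dv: "(x/2) powr (- g) = 2 powr g * x powr (- g)" if "x > 0" for x g :: real
        proof -
          have "(x/2) powr (- g) = x powr (- g) / 2 powr (- g)"
            using that by (subst powr_divide) auto
          then show ?thesis by (simp only: powr_minus divide_inverse inverse_inverse_eq mult.commute)
        qed
        have c1: "c powr (- \<beta>) \<le> 2 * (pi/2 - t) powr (- \<beta>)"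
        proof -
          have "c powr (- \<beta>) \<le> ((pi/2 - t)/2) powr (- \<beta>)"
            using cb t \<beta> by (intro powr_mono2') auto
          also have "\<dots> = 2 powr \<beta> * (pi/2 - t) powr (- \<beta>)"
            using t by (intro dv) auto
          also have "\<dots> \<le> 2 * (pi/2 - t) powr (- \<beta>)" using two by (intro mult_right_mono) auto
          finally show ?thesis .
        qed
        have s1: "s powr (- (1 - \<beta>)) \<le> 2 * t powr (- (1 - \<beta>))"
        proof -
          have "s powr (- (1 - \<beta>)) \<le> (t/2) powr (- (1 - \<beta>))"
            using sb t \<beta> by (intro powr_mono2') auto
          also have "\<dots> = 2 powr (1 - \<beta>) * t powr (- (1 - \<beta>))"
            using t by (intro dv) auto
          also have "\<dots> \<le> 2 * t powr (- (1 - \<beta>))" using two by (intro mult_right_mono) auto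
          finally show ?thesis .
        qed
        have half: "x powr (- \<gamma>) \<le> 2" if "x \<ge> 1/2" "0 < \<gamma>" "\<gamma> < 1" for x \<gamma> :: real
        proof -
          have "x powr (- \<gamma>) \<le> (1/2) powr (- \<gamma>)" using that by (intro powr_mono2') auto
          also have "\<dots> = 2 powr \<gamma>" using dv[of 1 \<gamma>] by simp
          also have "\<dots> \<le> 2" using powr_mono[of \<gamma> 1 "2::real"] that by simp
          finally show ?thesis .
        qed
        \<comment> \<open>So at each point at most one of the two factors is singular.\<close>
        have "c \<ge> 1/2 \<or> s \<ge> 1/2"
        proof (rule ccontr)
          assume "\<not> (c \<ge> 1/2 \<or> s \<ge> 1/2)"
          then have "c < 1/2" "s < 1/2" by auto
          then have "c * c < 1/2 * (1/2)" "s * s < 1/2 * (1/2)"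
            using c s mult_strict_mono[of c "1/2" c "1/2"] mult_strict_mono[of s "1/2" s "1/2"] by auto
          then show False using sin_cos_squared_add[of t] by (simp add: c_def s_def power2_eq_square)
        qed
        then show "c powr (- \<beta>) * s powr (- (1 - \<beta>)) \<le> h t"
        proof
          assume "c \<ge> 1/2"
          then have "c powr (- \<beta>) * s powr (- (1 - \<beta>)) \<le> 2 * (2 * t powr (- (1 - \<beta>)))"
            using half[of c \<beta>] \<beta> s1 by (intro mult_mono) auto
          then show ?thesis unfolding h_def using powr_ge_zero[of "pi/2 - t" "-\<beta>"] by linarith
        next
          assume "s \<ge> 1/2"
          then have "c powr (- \<beta>) * s powr (- (1 - \<beta>)) \<le> (2 * (pi/2 - t) powr (- \<beta>)) * 2"
            using half[of s "1 - \<beta>"] \<beta> c1 by (intro mult_mono) auto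
          then show ?thesis unfolding h_def using powr_ge_zero[of t "-(1-\<beta>)"] by linarith
        qed
      qed auto
      finally show ?thesis .
    qed
    have eq: "ellint a b = integral {0<..<pi/2} ?f"
      unfolding ellint_def using integral_open_interval[of 0 "pi/2" ?f] by simp
    have f_int: "?f integrable_on {0<..<pi/2}"
      using ell_integrable[OF ok, of 0 "pi/2"] integrable_on_open_interval[of ?f 0 "pi/2"] by simp
    have h_int: "(\<lambda>t. ?k * h t) integrable_on {0<..<pi/2}" using h by (rule integrable_on_mult_right)
    have "norm (ellint a b) \<le> integral {0<..<pi/2} (\<lambda>t. ?k * h t)"
      unfolding eq by (rule integral_norm_bound_integral[OF f_int h_int le])
    also have "\<dots> = ?k * C" unfolding C_def by simp
    finally show ?thesis by (simp only: mult_ac)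
  qed
  \<comment> \<open>Passing to \<open>C + 1\<close> makes the constant strictly positive.\<close>
  have mono: "C * norm a powr (- (\<beta> / 2)) * norm b powr (- ((1 - \<beta>) / 2))
      \<le> (C + 1) * norm a powr (- (\<beta> / 2)) * norm b powr (- ((1 - \<beta>) / 2))" for a b :: complex
    by (intro mult_right_mono) auto
  show ?thesis
    by (rule that[of "C + 1"]) (use \<open>C \<ge> 0\<close> in simp, rule order_trans[OF main mono])
qed

lemma sin_lower_half_plane:
  "sin (Complex a (- w)) = Complex (sin a * cosh w) (- (cos a * sinh w))"
  by (simp add: complex_eq_iff Re_sin Im_sin cosh_field_def sinh_field_def field_simps)

lemma norm_sin_ge:
  "(sinh w)^2 \<le> (norm (sin (Complex a (- w))))^2"
proof -
  have "(norm (sin (Complex a (- w))))^2 = (sin a)^2 * (cosh w)^2 + (cos a)^2 * (sinh w)^2"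
    by (simp add: sin_lower_half_plane cmod_power2 power_mult_distrib)
  also have "\<dots> = (sinh w)^2 * ((sin a)^2 + (cos a)^2) + (sin a)^2"
    unfolding cosh_square_eq by algebra
  finally show ?thesis by simp
qed

text \<open>Integrate \<open>1 / csqrt ((sin \<theta>)\<^sup>2 - x)\<close> along the boundary of the half-strip
  \<open>0 \<le> Re \<theta> \<le> pi/2\<close>, \<open>Im \<theta> \<le> 0\<close>, on which \<open>(sin \<theta>)\<^sup>2\<close> stays in the closed lower half-plane.
  The two vertical sides give the integrals on the right after \<open>sinh w = tan \<psi>\<close>.\<close>

lemma ellint_connection:
  assumes x: "Im x > 0"
  shows "ellint (- x) (1 - x) = ellint x 1 + \<i> * ellint (1 - x) 1"
proof -
  define H where "H = {z. 0 \<le> Re z \<and> Re z \<le> pi/2 \<and> Im z \<le> 0}"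
  define F where "F = (\<lambda>z. 1 / csqrt ((sin z)^2 - x))"
  have "Im ((sin z)^2 - x) < 0" if "z \<in> H" for z
  proof -
    have z: "z = Complex (Re z) (- (- Im z))" by simp
    have "Im ((sin z)^2) = - 2 * (sin (Re z) * cosh (- Im z)) * (cos (Re z) * sinh (- Im z))"
      by (subst z, subst sin_lower_half_plane) (simp add: Im_power2)
    moreover have "0 \<le> (sin (Re z) * cosh (- Im z)) * (cos (Re z) * sinh (- Im z))"
      using that by (intro mult_nonneg_nonneg sin_ge_zero cos_ge_zero) (auto simp: H_def)
    ultimately show ?thesis using x by simp
  qed
  then have slit: "(sin z)^2 - x \<notin> \<real>\<^sub>\<le>\<^sub>0" if "z \<in> H" for z
    using that by (force simp: complex_nonpos_Reals_iff)
  have conv: "convex H"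
  proof -
    have "H = {z. 0 \<le> Re z} \<inter> {z. Re z \<le> pi/2} \<inter> {z. Im z \<le> 0}" by (auto simp: H_def)
    then show ?thesis
      by (simp only:) (intro convex_Int convex_halfspace_Re_ge convex_halfspace_Re_le convex_halfspace_Im_le)
  qed
  have contF: "continuous_on H F"
    unfolding F_def
    by (intro continuous_on_divide continuous_on_const continuous_on_csqrt_slit continuous_intros slit)
       (use slit in fastforce)+
  have diffF: "F field_differentiable at z" if "z \<in> interior H - {}" for z
  proof -
    have "z \<in> H" using that interior_subset by blast
    note s = slit[OF this]
    have "(F has_field_derivative - (2 * sin z * cos z / (2 * csqrt ((sin z)^2 - x))) /
        (csqrt ((sin z)^2 - x) * csqrt ((sin z)^2 - x))) (at z)"
      unfolding F_def using s by (auto intro!: derivative_eq_intros)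
    then show ?thesis unfolding field_differentiable_def by blast
  qed
  \<comment> \<open>A primitive on the convex half-strip replaces Cauchy's theorem: every contour
    integral becomes a difference of values of \<open>P\<close>.\<close>
  obtain P where P: "\<And>z. z \<in> H \<Longrightarrow> (P has_field_derivative F z) (at z within H)"
    using holomorphic_convex_primitive[OF conv finite.emptyI contF diffF] by blast
  have ftc: "((\<lambda>t. g' t * F (g t)) has_integral (P (g b) - P (g a))) {a..b}"
    if ab: "a \<le> b" and g: "\<And>t. t \<in> {a..b} \<Longrightarrow> (g has_vector_derivative g' t) (at t within {a..b})"
      and gH: "\<And>t. t \<in> {a..b} \<Longrightarrow> g t \<in> H" for g g' a b
  proof -
    have "((P \<circ> g) has_vector_derivative g' t * F (g t)) (at t within {a..b})" if t: "t \<in> {a..b}" for t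
    proof (rule field_vector_diff_chain_within[OF g[OF t]])
      show "(P has_field_derivative F (g t)) (at (g t) within g ` {a..b})"
        by (rule has_field_derivative_subset[OF P[OF gH[OF t]]]) (use gH in blast)
    qed
    from fundamental_theorem_of_calculus[OF ab this] show ?thesis by (simp add: o_def)
  qed

  let ?S = "ellint (- x) (1 - x)"
  have okG: "ellok x 1" using x by (intro ellok_1) auto
  have okY: "ellok (1 - x) 1" using x by (intro ellok_1) auto
  have S: "?S = P (of_real (pi/2)) - P 0"
  proof -
    have "((\<lambda>t. 1 * F (of_real t)) has_integral (P (of_real (pi/2)) - P (of_real 0))) {0..pi/2}"
      by (rule ftc) (auto simp: H_def intro!: derivative_eq_intros)
    moreover have "1 * F (of_real t) = 1 / csqrt (ellarg (- x) (1 - x) t)" for t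
    proof -
      have cs: "complex_of_real ((cos t)^2) + of_real ((sin t)^2) = 1"
        by (simp only: of_real_add [symmetric]) simp
      have "ellarg (- x) (1 - x) t = of_real ((sin t)^2) - x * (of_real ((cos t)^2) + of_real ((sin t)^2))"
        unfolding ellarg_def by algebra
      then have "ellarg (- x) (1 - x) t = (sin (of_real t))^2 - x"
        unfolding cs by (simp add: sin_of_real)
      then show ?thesis by (simp add: F_def)
    qed
    ultimately show ?thesis unfolding ellint_def by (simp add: integral_unique)
  qed

  \<comment> \<open>This substitution has \<open>cosh (w t) = 1 / cos t\<close> and
    \<open>dw = dt / cos t\<close>, so both vertical integrals run over \<open>{0..<pi/2}\<close>
    with the integrands of \<open>ellint\<close>.\<close>
  define w :: "real \<Rightarrow> real" where "w = (\<lambda>t. arsinh (tan t))"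
  have w: "sinh (w t) = tan t" "cosh (w t) = 1 / cos t" "w t \<ge> 0"
    "(w has_real_derivative 1 / cos t) (at t within A)" if "0 \<le> t" "t < pi/2" for t A
  proof -
    have c: "cos t > 0" using that by (intro cos_gt_zero_pi) auto
    show "sinh (w t) = tan t" by (simp add: w_def)
    have sq: "sqrt ((tan t)^2 + 1) = 1 / cos t"
    proof (rule real_sqrt_unique)
      show "(1 / cos t)^2 = (tan t)^2 + 1"
        using c sin_cos_squared_add[of t] by (simp add: tan_def power_divide field_simps)
    qed (use c in simp)
    then show "cosh (w t) = 1 / cos t" by (simp add: w_def cosh_arsinh_real)
    have "tan t \<ge> 0" using that by (metis order_le_less tan_gt_zero tan_zero)
    then have "\<not> w t < 0" by (simp add: w_def)
    then show "w t \<ge> 0" by simp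
    have "(w has_real_derivative 1 / sqrt ((tan t)^2 + 1) * inverse ((cos t)^2)) (at t within A)"
      unfolding w_def using c
      by (intro DERIV_chain2[OF arsinh_real_has_field_derivative] has_field_derivative_at_within[OF DERIV_tan]) simp
    moreover have "1 / sqrt ((tan t)^2 + 1) * inverse ((cos t)^2) = 1 / cos t"
      unfolding sq using c by (simp add: power2_eq_square field_simps)
    ultimately show "(w has_real_derivative 1 / cos t) (at t within A)" by simp
  qed
  have vd: "((\<lambda>t. Complex a (- w t)) has_vector_derivative (- \<i> / of_real (cos t))) (at t within A)"
    if "0 \<le> t" "t < pi/2" for t A a
  proof -
    have "((\<lambda>t. of_real a - \<i> * of_real (w t)) has_vector_derivative (0 - \<i> * of_real (1 / cos t))) (at t within A)"
      by (intro has_vector_derivative_diff has_vector_derivative_const has_vector_derivative_mult_right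
          has_vector_derivative_of_real w(4)[OF that])
    moreover have "(\<lambda>t. of_real a - \<i> * of_real (w t)) = (\<lambda>t. Complex a (- w t))"
      by (auto simp: complex_eq_iff)
    ultimately show ?thesis by simp
  qed
  have csqrt_scale: "csqrt (of_real (c^2) * v) = of_real c * csqrt v" if "c > 0" for c v
  proof (rule csqrt_unique)
    show "(of_real c * csqrt v)^2 = of_real (c^2) * v" by (simp add: power_mult_distrib)
    show "0 < Re (of_real c * csqrt v) \<or> Re (of_real c * csqrt v) = 0 \<and> 0 \<le> Im (of_real c * csqrt v)"
      using csqrt_principal[of v] that by auto
  qed
  have G: "integral {0..s} (\<lambda>t. 1 / csqrt (ellarg x 1 t)) = - (P (Complex 0 (- w s)) - P 0) * (- 1)"
    if s: "0 \<le> s" "s < pi/2" for s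
  proof -
    have "((\<lambda>t. (- \<i> / of_real (cos t)) * F (Complex 0 (- w t))) has_integral
        (P (Complex 0 (- w s)) - P (Complex 0 (- w 0)))) {0..s}"
      by (rule ftc[OF s(1) vd]) (use s w(3) in \<open>auto simp: H_def\<close>)
    moreover have "(- \<i> / of_real (cos t)) * F (Complex 0 (- w t)) = 1 / csqrt (ellarg x 1 t)"
      if t: "t \<in> {0..s}" for t
    proof -
      have c: "cos t > 0" using t s by (intro cos_gt_zero_pi) auto
      define v where "v = of_real ((tan t)^2) + x"
      have Im_v: "Im v > 0" using x by (simp add: v_def)
      have "(sin (Complex 0 (- w t)))^2 - x = - v"
        using w(1)[of t] t s by (simp add: v_def sin_lower_half_plane complex_eq_iff Re_power2 Im_power2)
      \<comment> \<open>The branch is fixed by \<open>Im v > 0\<close>: the root of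
        \<open>- v\<close> lies in the fourth quadrant and is turned by \<open>i\<close> into the
        first.\<close>
      moreover have "csqrt v = \<i> * csqrt (- v)"
        using csqrt_minus[of "- v"] Im_v by simp
      ultimately have F: "F (Complex 0 (- w t)) = \<i> / csqrt v"
        by (simp add: F_def)
      have "ellarg x 1 t = of_real ((cos t)^2) * v"
        using c by (simp add: v_def ellarg_def tan_def power_divide distrib_left mult.commute)
      then have "csqrt (ellarg x 1 t) = of_real (cos t) * csqrt v" using csqrt_scale[OF c] by simp
      then show ?thesis unfolding F by simp
    qed
    moreover have "w 0 = 0" by (simp add: w_def)
    moreover have "Complex 0 0 = 0" by (simp add: complex_eq_iff)
    ultimately have "((\<lambda>t. 1 / csqrt (ellarg x 1 t)) has_integral (P (Complex 0 (- w s)) - P 0)) {0..s}"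
      using has_integral_eq[of "{0..s}" "\<lambda>t. (- \<i> / of_real (cos t)) * F (Complex 0 (- w t))"] by simp
    then show ?thesis by (simp add: integral_unique)
  qed
  have Y: "- \<i> * integral {0..s} (\<lambda>t. 1 / csqrt (ellarg (1 - x) 1 t)) =
      P (Complex (pi/2) (- w s)) - P (of_real (pi/2))"
    if s: "0 \<le> s" "s < pi/2" for s
  proof -
    have "((\<lambda>t. (- \<i> / of_real (cos t)) * F (Complex (pi/2) (- w t))) has_integral
        (P (Complex (pi/2) (- w s)) - P (Complex (pi/2) (- w 0)))) {0..s}"
      by (rule ftc[OF s(1) vd]) (use s w(3) in \<open>auto simp: H_def\<close>)
    moreover have "(- \<i> / of_real (cos t)) * F (Complex (pi/2) (- w t)) = - \<i> * (1 / csqrt (ellarg (1 - x) 1 t))"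
      if t: "t \<in> {0..s}" for t
    proof -
      have c: "cos t > 0" using t s by (intro cos_gt_zero_pi) auto
      define v where "v = of_real (1 / (cos t)^2) - x"
      have "(sin (Complex (pi/2) (- w t)))^2 - x = v"
        using w(2)[of t] t s by (simp add: sin_lower_half_plane complex_eq_iff Re_power2 Im_power2 power_divide v_def)
      then have F: "F (Complex (pi/2) (- w t)) = 1 / csqrt v" by (simp add: F_def)
      have "complex_of_real ((sin t)^2) = 1 - of_real ((cos t)^2)"
        by (simp only: sin_squared_eq of_real_diff of_real_1)
      then have "ellarg (1 - x) 1 t = of_real ((cos t)^2) * v"
        using c by (simp add: v_def ellarg_def algebra_simps)
      then have "csqrt (ellarg (1 - x) 1 t) = of_real (cos t) * csqrt v" using csqrt_scale[OF c] by simp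
      then show ?thesis unfolding F by simp
    qed
    moreover have "w 0 = 0" by (simp add: w_def)
    moreover have "Complex (pi/2) 0 = of_real (pi/2)" by (simp add: complex_eq_iff)
    ultimately have "((\<lambda>t. - \<i> * (1 / csqrt (ellarg (1 - x) 1 t))) has_integral
        (P (Complex (pi/2) (- w s)) - P (of_real (pi/2)))) {0..s}"
      using has_integral_eq[of "{0..s}" "\<lambda>t. (- \<i> / of_real (cos t)) * F (Complex (pi/2) (- w t))"] by simp
    then have "integral {0..s} (\<lambda>t. - \<i> * (1 / csqrt (ellarg (1 - x) 1 t))) =
      P (Complex (pi/2) (- w s)) - P (of_real (pi/2))" by (rule integral_unique)
    then show ?thesis by (simp only: integral_mult_right)
  qed

  \<comment> \<open>The defect of the identity after truncation at \<open>s\<close>. It equals the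
    integral over the horizontal side at height \<open>- w s\<close>, of length \<open>pi/2\<close>,
    where \<open>sin\<close> is large.\<close>
  define E where "E = (\<lambda>s. ?S - integral {0..s} (\<lambda>t. 1 / csqrt (ellarg x 1 t))
      - \<i> * integral {0..s} (\<lambda>t. 1 / csqrt (ellarg (1 - x) 1 t)))"
  have E_le: "norm (E s) \<le> 1 / sqrt ((tan s)^2 - norm x) * (pi/2)"
    if s: "0 \<le> s" "s < pi/2" and big: "(tan s)^2 > norm x" for s
  proof -
    let ?a = "Complex 0 (- w s)" and ?b = "Complex (pi/2) (- w s)"
    let ?L = "{z. 0 \<le> Re z} \<inter> {z. Re z \<le> pi/2} \<inter> {z. Im z \<ge> - w s} \<inter> {z. Im z \<le> - w s}"
    have "\<i> * integral {0..s} (\<lambda>t. 1 / csqrt (ellarg (1 - x) 1 t)) = - (P ?b - P (of_real (pi/2)))"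
      unfolding Y[OF s, symmetric] by simp
    then have "E s = P ?b - P ?a"
      unfolding E_def S G[OF s] by simp
    also have "norm \<dots> \<le> 1 / sqrt ((tan s)^2 - norm x) * norm (?b - ?a)"
    proof (rule field_differentiable_bound[where S = ?L])
      show "convex ?L"
        by (intro convex_Int convex_halfspace_Re_ge convex_halfspace_Re_le
            convex_halfspace_Im_ge convex_halfspace_Im_le)
      fix z assume z: "z \<in> ?L"
      have zH: "?L \<subseteq> H" using w(3)[OF s] by (auto simp: H_def)
      show "(P has_field_derivative F z) (at z within ?L)"
        by (rule has_field_derivative_subset[OF P zH]) (use z zH in blast)
      have "z = Complex (Re z) (- w s)" using z by (auto simp: complex_eq_iff)
      then have "(norm (sin z))^2 \<ge> (tan s)^2" using norm_sin_ge[of "w s" "Re z"] w(1)[OF s] by simp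
      then have "norm ((sin z)^2 - x) \<ge> (tan s)^2 - norm x"
        using norm_triangle_ineq2[of "(sin z)^2" x] by (simp add: norm_power)
      then show "norm (F z) \<le> 1 / sqrt ((tan s)^2 - norm x)"
        using big by (simp add: F_def norm_divide frac_le)
    qed (use w(3)[OF s] in auto)
    also have "norm (?b - ?a) = pi / 2"
    proof -
      have "?b - ?a = of_real (pi/2)" by (simp add: complex_eq_iff)
      then show ?thesis by (simp only: norm_of_real) simp
    qed
    finally show ?thesis .
  qed
  have "continuous_on {0..pi/2} E"
    unfolding E_def
    by (intro continuous_intros indefinite_integral_continuous_1 ell_integrable okG okY)
  then have "(E \<longlongrightarrow> E (pi/2)) (at (pi/2) within {0..pi/2})"
    by (auto simp: continuous_on_def)
  then have lim: "(E \<longlongrightarrow> E (pi/2)) (at_left (pi/2))"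
    using pi_half_gt_zero by (simp add: at_within_Icc_at_left)
  have "(E \<longlongrightarrow> 0) (at_left (pi/2))"
  proof (rule Lim_null_comparison)
    have ev: "\<forall>\<^sub>F s in at_left (pi/2). s \<in> {0<..<pi/2}"
      using pi_half_gt_zero by (rule eventually_at_left_real)
    have "\<forall>\<^sub>F s in at_left (pi/2). tan s \<ge> 1 + norm x"
      using filterlim_tan_at_left unfolding filterlim_at_top by blast
    with ev show "\<forall>\<^sub>F s in at_left (pi/2). norm (E s) \<le> 1 / sqrt ((tan s)^2 - norm x) * (pi/2)"
    proof eventually_elim
      case (elim s)
      have "norm x < (1 + norm x) * (1 + norm x)" by (simp add: algebra_simps add_pos_nonneg)
      also have "\<dots> \<le> tan s * tan s" using elim(2) by (intro mult_mono) (auto intro: order_trans[OF _ elim(2)])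
      finally show ?case using elim by (intro E_le) (auto simp: power2_eq_square)
    qed
    have "filterlim (\<lambda>s. (tan s)^2) at_top (at_left (pi/2))"
      by (rule filterlim_compose[OF filterlim_pow_at_top filterlim_tan_at_left]) (auto simp: filterlim_ident)
    then have "filterlim (\<lambda>s. - norm x + (tan s)^2) at_top (at_left (pi/2))"
      by (rule filterlim_tendsto_add_at_top[OF tendsto_const])
    then have "filterlim (\<lambda>s. sqrt ((tan s)^2 - norm x)) at_top (at_left (pi/2))"
      by (intro filterlim_compose[OF sqrt_at_top]) (simp add: add.commute)
    then have "((\<lambda>s. inverse (sqrt ((tan s)^2 - norm x)) * (pi/2)) \<longlongrightarrow> 0 * (pi/2)) (at_left (pi/2))"
      by (intro tendsto_mult tendsto_const tendsto_inverse_0_at_top)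
    then show "((\<lambda>s. 1 / sqrt ((tan s)^2 - norm x) * (pi/2)) \<longlongrightarrow> 0) (at_left (pi/2))"
      by (simp only: divide_inverse mult_1 mult_zero_left)
  qed
  then have "E (pi/2) = 0"
    by (rule tendsto_unique[OF trivial_limit_at_left_real lim])
  then show ?thesis by (simp add: E_def ellint_def algebra_simps)
qed

section \<open>A disc with boundary in three planes\<close>

definition corner_domain :: "complex set" where
  "corner_domain = {x. Re x < 1/2 \<and> Im x > 0}"

definition corner_closure :: "complex set" where
  "corner_closure = {x. Re x \<le> 1/2 \<and> Im x \<ge> 0}"

definition discY :: "complex \<Rightarrow> complex" where
  "discY x = ellint (1 - x) 1"

text \<open>By \<open>ellint_connection\<close> both branches agree with \<open>ellint x 1\<close> for \<open>Im x > 0\<close>; the first one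
  continues it to the negative reals.\<close>

definition discU :: "complex \<Rightarrow> complex" where
  "discU x = (if Re x < 0 then ellint (- x) (1 - x) - \<i> * ellint (1 - x) 1 else ellint x 1)"

text \<open>The product of the branches of \<open>(1/2 - x) powr (2 p)\<close> and \<open>(x (1 - x)) powr k\<close>; the second
  factor is cut along the negative imaginary axis to be continuous on the closed upper half-plane.\<close>

definition disc_weight :: "real \<Rightarrow> real \<Rightarrow> complex \<Rightarrow> complex" where
  "disc_weight p k x = exp (of_real (2 * p) * Ln (1/2 - x)) *
     exp (of_real k * (Ln (- \<i> * (x * (1 - x))) + \<i> * of_real (pi / 2)))"

definition disc :: "real \<Rightarrow> real \<Rightarrow> complex \<Rightarrow> complex^2" where
  "disc p k x = (if x = 0 \<or> x = 1/2 then 0 else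
     vector [disc_weight p k x * (discU x + discY x), disc_weight p k x * (discU x - discY x)])"

lemma disc_nth:
  "disc p k x $ 1 = (if x = 0 \<or> x = 1/2 then 0 else disc_weight p k x * (discU x + discY x))"
  "disc p k x $ 2 = (if x = 0 \<or> x = 1/2 then 0 else disc_weight p k x * (discU x - discY x))"
  by (auto simp: disc_def)

section \<open>The weight and its boundary values\<close>

lemma Ln_polar:
  assumes "r > 0" "- pi < t" "t \<le> pi"
  shows "Ln (of_real r * cis t) = of_real (ln r) + \<i> * of_real t"
proof -
  have "exp (of_real (ln r) + \<i> * of_real t) = of_real r * cis t"
    using assms by (simp add: exp_add exp_of_real cis_conv_exp)
  moreover have "- pi < Im (of_real (ln r) + \<i> * of_real t)" "Im (of_real (ln r) + \<i> * of_real t) \<le> pi"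
    using assms by auto
  ultimately show ?thesis by (metis Ln_exp)
qed

text \<open>\<open>Im (x * (1 - x)) = Im x * (1 - 2 * Re x)\<close> is nonnegative on the closure,
  so multiplication by \<open>- i\<close> moves the product into the closed right half-plane, away
  from 0.\<close>

lemma corner_slits:
  assumes "x \<in> corner_closure" "x \<noteq> 0" "x \<noteq> 1/2"
  shows "1/2 - x \<notin> \<real>\<^sub>\<le>\<^sub>0" "- \<i> * (x * (1 - x)) \<notin> \<real>\<^sub>\<le>\<^sub>0"
proof -
  have x: "Re x \<le> 1/2" "Im x \<ge> 0" using assms(1) by (auto simp: corner_closure_def)
  show "1/2 - x \<notin> \<real>\<^sub>\<le>\<^sub>0"
    using x assms(3) by (auto simp: complex_nonpos_Reals_iff complex_eq_iff)
  define w where "w = x * (1 - x)"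
  have "x \<noteq> 1" using x by auto
  then have "w \<noteq> 0" using assms by (simp add: w_def)
  have "Im w = Im x * (1 - 2 * Re x)" by (simp add: w_def algebra_simps)
  then have "Im w \<ge> 0" using x by simp
  then show "- \<i> * (x * (1 - x)) \<notin> \<real>\<^sub>\<le>\<^sub>0"
    using \<open>w \<noteq> 0\<close> unfolding w_def [symmetric] by (auto simp: complex_nonpos_Reals_iff complex_eq_iff)
qed

lemma continuous_on_disc_weight:
  "continuous_on (corner_closure - {0, 1/2}) (disc_weight p k)"
  unfolding disc_weight_def
  by (intro continuous_intros continuous_on_Ln corner_slits) auto

lemma corner_domain_subset: "corner_domain \<subseteq> corner_closure - {0, 1/2}"
  by (auto simp: corner_domain_def corner_closure_def)

lemma holomorphic_on_disc_weight: "disc_weight p k holomorphic_on corner_domain"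
proof -
  have "x \<in> corner_closure \<and> x \<noteq> 0 \<and> x \<noteq> 1/2" if "x \<in> corner_domain" for x
    using corner_domain_subset that by blast
  then show ?thesis
    unfolding disc_weight_def by (intro holomorphic_intros corner_slits) blast+
qed

lemma norm_disc_weight:
  assumes "x \<in> corner_closure" "x \<noteq> 0" "x \<noteq> 1/2"
  shows "norm (disc_weight p k x) = norm (1/2 - x) powr (2 * p) * norm (x * (1 - x)) powr k"
proof -
  have "x \<noteq> 1" using assms(1) by (auto simp: corner_closure_def)
  then have ne: "1/2 - x \<noteq> 0" "x * (1 - x) \<noteq> 0" using assms(2,3) by auto
  have "norm (exp (of_real (2 * p) * Ln (1/2 - x))) = norm (1/2 - x) powr (2 * p)"
    using ne(1) by (simp add: norm_exp_eq_Re powr_def)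
  moreover have "norm (exp (of_real k * (Ln (- \<i> * (x * (1 - x))) + \<i> * of_real (pi / 2)))) =
      exp (k * Re (Ln (- \<i> * (x * (1 - x)))))"
    by (simp only: norm_exp_eq_Re) simp
  moreover have "Re (Ln (- \<i> * (x * (1 - x)))) = ln (norm (x * (1 - x)))"
  proof -
    have "- \<i> * (x * (1 - x)) \<noteq> 0" using ne(2) by simp
    then have "Re (Ln (- \<i> * (x * (1 - x)))) = ln (norm (- \<i> * (x * (1 - x))))" by (rule Re_Ln)
    also have "norm (- \<i> * (x * (1 - x))) = norm (x * (1 - x))" by (simp add: norm_mult)
    finally show ?thesis .
  qed
  ultimately show ?thesis using ne(2) unfolding disc_weight_def norm_mult[of "exp _"] by (simp add: powr_def)
qed

lemma Ln_ii_times: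
  assumes "r > 0"
  shows "Ln (\<i> * of_real r) = of_real (ln r) + \<i> * of_real (pi/2)"
    "Ln (- \<i> * of_real r) = of_real (ln r) - \<i> * of_real (pi/2)"
proof -
  have "- pi < pi/2" "pi/2 \<le> pi" "- pi < - (pi/2)" "- (pi/2) \<le> pi" using pi_gt_zero by linarith+
  then show "Ln (\<i> * of_real r) = of_real (ln r) + \<i> * of_real (pi/2)"
    "Ln (- \<i> * of_real r) = of_real (ln r) - \<i> * of_real (pi/2)"
    using Ln_polar[OF assms, of "pi/2"] Ln_polar[OF assms, of "- (pi/2)"] by (simp_all add: mult.commute)
qed

text \<open>\<open>t1\<close> and \<open>t2\<close> are the arguments of \<open>1/2 - x\<close> and
  \<open>x * (1 - x)\<close>. On the three boundary pieces they are \<open>(0, 0)\<close>,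
  \<open>(0, pi)\<close> and \<open>(- pi/2, 0)\<close>, whence the phases of the planes.\<close>

lemma disc_weight_polar:
  assumes "Ln (1/2 - x) = of_real l1 + \<i> * of_real t1"
    and "Ln (- \<i> * (x * (1 - x))) = of_real l2 + \<i> * of_real (t2 - pi/2)"
  shows "disc_weight p k x = cis (2 * p * t1 + k * t2) * of_real (exp (2 * p * l1 + k * l2))"
proof -
  have "disc_weight p k x = exp (of_real (2 * p * l1 + k * l2) + \<i> * of_real (2 * p * t1 + k * t2))"
    unfolding disc_weight_def assms by (simp add: exp_add [symmetric] algebra_simps)
  then show ?thesis by (simp only: exp_add exp_of_real cis_conv_exp mult.commute)
qed

lemma disc_weight_right:
  assumes "0 < a" "a < 1/2"
  obtains r where "disc_weight p k (of_real a) = of_real r"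
proof -
  have "Ln (1/2 - of_real a) = of_real (ln (1/2 - a)) + \<i> * of_real 0"
    using assms Ln_of_real[of "1/2 - a"] by simp
  moreover have "a * (1 - a) > 0" using assms by simp
  from Ln_ii_times(2)[OF this]
  have "Ln (- \<i> * (of_real a * (1 - of_real a))) = of_real (ln (a * (1 - a))) + \<i> * of_real (0 - pi/2)"
    by simp
  ultimately have "disc_weight p k (of_real a) = cis (2 * p * 0 + k * 0) *
      of_real (exp (2 * p * ln (1/2 - a) + k * ln (a * (1 - a))))"
    by (rule disc_weight_polar)
  then show ?thesis using that by simp
qed

lemma disc_weight_left:
  assumes "a < 0"
  obtains r where "disc_weight p k (of_real a) = cis (pi * k) * of_real r"
proof -
  have "Ln (1/2 - of_real a) = of_real (ln (1/2 - a)) + \<i> * of_real 0"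
    using assms Ln_of_real[of "1/2 - a"] by simp
  moreover have "- (a * (1 - a)) > 0" using assms by (simp add: mult_neg_pos)
  from Ln_ii_times(1)[OF this]
  have "Ln (- \<i> * (of_real a * (1 - of_real a))) = of_real (ln (- (a * (1 - a)))) + \<i> * of_real (pi - pi/2)"
    by simp
  ultimately have "disc_weight p k (of_real a) = cis (2 * p * 0 + k * pi) *
      of_real (exp (2 * p * ln (1/2 - a) + k * ln (- (a * (1 - a)))))"
    by (rule disc_weight_polar)
  then show ?thesis using that by (simp add: mult.commute)
qed

lemma disc_weight_vertical:
  assumes "y > 0"
  obtains r where "disc_weight p k (Complex (1/2) y) = cis (- (pi * p)) * of_real r"
proof -
  have "1/2 - Complex (1/2) y = - \<i> * of_real y" by (simp add: complex_eq_iff)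
  then have "Ln (1/2 - Complex (1/2) y) = of_real (ln y) + \<i> * of_real (- (pi/2))"
    using Ln_ii_times(2)[OF assms] by simp
  moreover have w: "Complex (1/2) y * (1 - Complex (1/2) y) = of_real (1/4 + y * y)"
    by (simp add: complex_eq_iff)
  have "1/4 + y * y > 0" by (simp add: add_pos_nonneg)
  from Ln_ii_times(2)[OF this]
  have "Ln (- \<i> * (Complex (1/2) y * (1 - Complex (1/2) y))) = of_real (ln (1/4 + y * y)) + \<i> * of_real (0 - pi/2)"
    unfolding w by simp
  ultimately have "disc_weight p k (Complex (1/2) y) = cis (2 * p * (- (pi/2)) + k * 0) *
      of_real (exp (2 * p * ln y + k * ln (1/4 + y * y)))"
    by (rule disc_weight_polar)
  then show ?thesis using that by (simp add: mult.commute)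
qed

section \<open>Continuity, holomorphy and growth of the disc\<close>

lemma continuous_on_discY: "continuous_on corner_closure discY"
  unfolding discY_def
  by (intro continuous_on_ellint continuous_intros ellok_1) (auto simp: corner_closure_def)

lemma discU_eq: "Im x > 0 \<Longrightarrow> discU x = ellint x 1"
  using ellint_connection[of x] by (simp add: discU_def)

text \<open>The two branches are glued along the positive imaginary axis, where
  \<open>ellint_connection\<close> identifies them. The point 0 is left out because of the
  logarithmic singularity.\<close>

lemma continuous_on_discU: "continuous_on (corner_closure - {0}) discU"
proof -
  let ?A = "(corner_closure - {0}) \<inter> {x. Re x \<le> 0}" and ?B = "(corner_closure - {0}) \<inter> {x. Re x \<ge> 0}"
  have AB: "corner_closure - {0} = ?A \<union> ?B" by auto
  have "continuous_on (?A \<union> ?B)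
      (\<lambda>x. if Re x < 0 then ellint (- x) (1 - x) - \<i> * ellint (1 - x) 1 else ellint x 1)"
  proof (rule continuous_on_cases_local)
    show "closedin (top_of_set (?A \<union> ?B)) ?A" "closedin (top_of_set (?A \<union> ?B)) ?B"
      unfolding AB [symmetric]
      by (auto intro!: closedin_closed_Int closed_halfspace_Re_le closed_halfspace_Re_ge)
    have okS: "ellok (- x) (1 - x)" if "x \<in> ?A" for x
    proof (cases "Im x > 0")
      case True
      then show ?thesis by (intro ellok_Im_neg) auto
    next
      case False
      then have "Re x < 0" using that by (auto simp: corner_closure_def complex_eq_iff)
      then show ?thesis by (intro ellok_Re) auto
    qed
    show "continuous_on ?A (\<lambda>x. ellint (- x) (1 - x) - \<i> * ellint (1 - x) 1)"
      by (intro continuous_intros continuous_on_ellint okS ellok_1) auto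
    show "continuous_on ?B (\<lambda>x. ellint x 1)"
      by (intro continuous_intros continuous_on_ellint ellok_1)
         (auto simp: corner_closure_def complex_eq_iff)
    fix x assume "x \<in> ?A \<and> \<not> Re x < 0 \<or> x \<in> ?B \<and> Re x < 0"
    then have "Im x > 0" by (auto simp: corner_closure_def complex_eq_iff)
    then show "ellint (- x) (1 - x) - \<i> * ellint (1 - x) 1 = ellint x 1"
      by (simp add: ellint_connection)
  qed
  then show ?thesis unfolding AB [symmetric] discU_def [abs_def] .
qed

lemma convex_corner_domain: "convex corner_domain"
proof -
  have eq: "corner_domain = {x. Re x < 1/2} \<inter> {x. Im x > 0}" by (auto simp: corner_domain_def)
  show ?thesis unfolding eq by (intro convex_Int convex_halfspace_Re_lt convex_halfspace_Im_gt)
qed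

lemma closed_corner_closure: "closed corner_closure"
proof -
  have eq: "corner_closure = {x. Re x \<le> 1/2} \<inter> {x. Im x \<ge> 0}" by (auto simp: corner_closure_def)
  show ?thesis unfolding eq by (intro closed_Int closed_halfspace_Re_le closed_halfspace_Im_ge)
qed

lemma open_corner_domain: "open corner_domain"
proof -
  have eq: "corner_domain = {x. Re x < 1/2} \<inter> {x. Im x > 0}" by (auto simp: corner_domain_def)
  show ?thesis unfolding eq by (intro open_Int open_halfspace_Re_lt open_halfspace_Im_gt)
qed

lemma holomorphic_on_disc_functions:
  "discY holomorphic_on corner_domain" "discU holomorphic_on corner_domain"
proof -
  have "(\<lambda>x. ellint (1 + (-1) * x) (1 + 0 * x)) holomorphic_on corner_domain"
    by (rule holomorphic_on_ellint[OF convex_corner_domain]) (auto simp: corner_domain_def intro!: ellok_1)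
  then show "discY holomorphic_on corner_domain" by (simp add: discY_def [abs_def])
  have "(\<lambda>x. ellint (0 + 1 * x) (1 + 0 * x)) holomorphic_on corner_domain"
    by (rule holomorphic_on_ellint[OF convex_corner_domain]) (auto simp: corner_domain_def intro!: ellok_1)
  then show "discU holomorphic_on corner_domain"
    by (rule holomorphic_transform) (auto simp: corner_domain_def discU_eq)
qed

text \<open>The exponent \<open>\<beta>\<close> stays free: at 0, where the growth is at most
  logarithmic, a small value is wanted, and at infinity a value close to 1.\<close>

lemma disc_functions_bound:
  assumes "0 < \<beta>" "\<beta> < 1"
  obtains C where "C > 0" "\<And>x. x \<in> corner_closure \<Longrightarrow> x \<noteq> 0 \<Longrightarrow> norm (discY x) \<le> C * norm x powr (- (\<beta> / 2))"
    "\<And>x. x \<in> corner_closure \<Longrightarrow> x \<noteq> 0 \<Longrightarrow> norm (discU x) \<le> 2 * C * norm x powr (- (\<beta> / 2))"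
proof -
  obtain C where C: "C > 0" "\<And>a b. ellok a b \<Longrightarrow> Re (a * cnj b) \<ge> 0 \<Longrightarrow> a \<noteq> 0 \<Longrightarrow> b \<noteq> 0 \<Longrightarrow>
    norm (ellint a b) \<le> C * norm a powr (- (\<beta> / 2)) * norm b powr (- ((1 - \<beta>) / 2))"
    using ellint_bound[OF assms] by blast
  have Y: "norm (discY x) \<le> C * norm x powr (- (\<beta> / 2))" if x: "x \<in> corner_closure" "x \<noteq> 0" for x
  proof -
    have re: "Re x \<le> 1/2" using x by (simp add: corner_closure_def)
    have "(norm x)^2 \<le> (norm (1 - x))^2" using re unfolding cmod_power2 by (simp add: power2_eq_square algebra_simps)
    then have le: "norm x \<le> norm (1 - x)" by (rule power2_le_imp_le) simp
    have ok: "ellok (1 - x) 1" using re by (intro ellok_1) simp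
    have ne: "1 - x \<noteq> 0" using re by auto
    have "norm (discY x) \<le> C * norm (1 - x) powr (- (\<beta> / 2))"
      using C(2)[OF ok _ ne] re by (simp add: discY_def)
    also have "\<dots> \<le> C * norm x powr (- (\<beta> / 2))"
      using C(1) le x(2) assms by (intro mult_left_mono powr_mono2') auto
    finally show ?thesis .
  qed
  have U: "norm (discU x) \<le> 2 * C * norm x powr (- (\<beta> / 2))" if x: "x \<in> corner_closure" "x \<noteq> 0" for x
  proof (cases "Re x < 0")
    case True
    have ok: "ellok (- x) (1 - x)" using True by (intro ellok_Re) auto
    have "Re (- x * cnj (1 - x)) = Im x * Im x + Re x * Re x - Re x" by (simp add: algebra_simps)
    then have re: "Re (- x * cnj (1 - x)) \<ge> 0"
      using True zero_le_square[of "Im x"] zero_le_square[of "Re x"] by linarith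
    have one: "1 \<le> norm (1 - x)" using complex_Re_le_cmod[of "1 - x"] True by simp
    have ne: "- x \<noteq> 0" "1 - x \<noteq> 0" using x one by auto
    have "norm (1 - x) powr (- ((1 - \<beta>) / 2)) \<le> 1 powr (- ((1 - \<beta>) / 2))"
      using one assms by (intro powr_mono2') auto
    then have "C * norm x powr (- (\<beta> / 2)) * norm (1 - x) powr (- ((1 - \<beta>) / 2)) \<le> C * norm x powr (- (\<beta> / 2)) * 1"
      using C(1) by (intro mult_left_mono) auto
    then have "norm (ellint (- x) (1 - x)) \<le> C * norm x powr (- (\<beta> / 2))"
      using C(2)[OF ok re ne] by simp
    moreover have "norm (\<i> * ellint (1 - x) 1) \<le> C * norm x powr (- (\<beta> / 2))"
      using Y[OF x] by (simp add: discY_def norm_mult)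
    ultimately show ?thesis
      using True norm_triangle_ineq4[of "ellint (- x) (1 - x)" "\<i> * ellint (1 - x) 1"]
      by (simp add: discU_def)
  next
    case False
    have ok: "ellok x 1" using x False by (intro ellok_1) (auto simp: corner_closure_def complex_eq_iff)
    have "norm (discU x) \<le> C * norm x powr (- (\<beta> / 2))"
      using C(2)[OF ok _ x(2)] False by (simp add: discU_def)
    also have "\<dots> \<le> 2 * C * norm x powr (- (\<beta> / 2))" using C(1) by (intro mult_right_mono) auto
    finally show ?thesis .
  qed
  show ?thesis by (rule that[OF C(1) Y U])
qed

lemma disc_bound:
  assumes "0 < \<beta>" "\<beta> < 1"
  obtains C where "C > 0" "\<And>x i. x \<in> corner_closure \<Longrightarrow> x \<noteq> 0 \<Longrightarrow> x \<noteq> 1/2 \<Longrightarrow> norm (disc p k x $ i)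
    \<le> C * (norm (1/2 - x) powr (2 * p) * norm (x * (1 - x)) powr k) * norm x powr (- (\<beta> / 2))"
proof -
  obtain C where C: "C > 0" "\<And>x. x \<in> corner_closure \<Longrightarrow> x \<noteq> 0 \<Longrightarrow> norm (discY x) \<le> C * norm x powr (- (\<beta> / 2))"
    "\<And>x. x \<in> corner_closure \<Longrightarrow> x \<noteq> 0 \<Longrightarrow> norm (discU x) \<le> 2 * C * norm x powr (- (\<beta> / 2))"
    using disc_functions_bound[OF assms] by blast
  show ?thesis
  proof (rule that[of "3 * C"])
    fix x and i :: 2 assume x: "x \<in> corner_closure" "x \<noteq> 0" "x \<noteq> 1/2"
    have "norm (discU x + discY x) \<le> 3 * C * norm x powr (- (\<beta> / 2))"
      "norm (discU x - discY x) \<le> 3 * C * norm x powr (- (\<beta> / 2))"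
      using C(2,3)[OF x(1,2)] norm_triangle_ineq[of "discU x" "discY x"] norm_triangle_ineq4[of "discU x" "discY x"]
      by linarith+
    then have "norm (disc_weight p k x) * norm (discU x + discY x) \<le> norm (disc_weight p k x) * (3 * C * norm x powr (- (\<beta> / 2)))"
      "norm (disc_weight p k x) * norm (discU x - discY x) \<le> norm (disc_weight p k x) * (3 * C * norm x powr (- (\<beta> / 2)))"
      by (intro mult_left_mono; simp)+
    moreover have "i = 1 \<or> i = 2" using exhaust_2 by blast
    ultimately have "norm (disc p k x $ i) \<le> norm (disc_weight p k x) * (3 * C * norm x powr (- (\<beta> / 2)))"
      using x by (auto simp: disc_nth norm_mult)
    then show "norm (disc p k x $ i) \<le> 3 * C * (norm (1/2 - x) powr (2 * p) * norm (x * (1 - x)) powr k) * norm x powr (- (\<beta> / 2))"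
      unfolding norm_disc_weight[OF x] by (simp only: mult_ac)
  qed (use C in auto)
qed

text \<open>At 0 the choice \<open>\<beta> = k\<close> leaves a positive power \<open>k / 2\<close>
  of \<open>|x|\<close>; at 1/2 the factor \<open>|1/2 - x| powr (2 * p)\<close> vanishes and the
  others stay bounded.\<close>

lemma disc_tendsto_0:
  assumes p: "p > 0" and k: "0 < k" "k < 1"
  shows "((\<lambda>x. disc p k x $ i) \<longlongrightarrow> 0) (at 0 within corner_closure)"
    "((\<lambda>x. disc p k x $ i) \<longlongrightarrow> 0) (at (1/2) within corner_closure)"
proof -
  obtain C where C: "C > 0" "\<And>x i. x \<in> corner_closure \<Longrightarrow> x \<noteq> 0 \<Longrightarrow> x \<noteq> 1/2 \<Longrightarrow> norm (disc p k x $ i)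
    \<le> C * (norm (1/2 - x) powr (2 * p) * norm (x * (1 - x)) powr k) * norm x powr (- (k / 2))"
    using disc_bound[OF k] by blast
  have le1: "a powr b \<le> 1" if "0 \<le> a" "a \<le> 1" "b > 0" for a b :: real
    using powr_mono2[of b a 1] that by simp
  show "((\<lambda>x. disc p k x $ i) \<longlongrightarrow> 0) (at 0 within corner_closure)"
  proof (rule Lim_null_comparison)
    let ?F = "at 0 within corner_closure"
    have "\<forall>\<^sub>F x in ?F. x \<in> corner_closure \<and> x \<noteq> 0 \<and> dist x 0 < 1/2"
      unfolding eventually_at by (rule exI[of _ "1/2"]) auto
    then show "\<forall>\<^sub>F x in ?F. norm (disc p k x $ i) \<le> C * (2 powr k * norm x powr (k / 2))"
    proof eventually_elim
      case (elim x)
      then have x: "x \<in> corner_closure" "x \<noteq> 0" "norm x < 1/2" by auto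
      have "norm (1/2 :: complex) = 1/2" by simp
      then have "x \<noteq> 1/2" using x(3) by (metis less_irrefl)
      have "norm (1/2 - x) \<le> 1" using x(3) norm_triangle_ineq4[of "1/2" x] by simp
      then have "norm (1/2 - x) powr (2 * p) \<le> 1" using p by (intro le1) auto
      moreover have "norm (1 - x) \<le> 2" using x(3) norm_triangle_ineq4[of 1 x] by simp
      then have "norm (x * (1 - x)) \<le> 2 * norm x"
        using mult_left_mono[of "norm (1 - x)" 2 "norm x"] by (simp add: norm_mult)
      then have "norm (x * (1 - x)) powr k \<le> (2 * norm x) powr k" using k by (intro powr_mono2) auto
      ultimately have "norm (1/2 - x) powr (2 * p) * norm (x * (1 - x)) powr k \<le> 1 * (2 * norm x) powr k"
        by (intro mult_mono) auto
      then have "norm (disc p k x $ i) \<le> C * (1 * (2 * norm x) powr k) * norm x powr (- (k / 2))"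
        using C(1) by (intro order_trans[OF C(2)[OF x(1,2) \<open>x \<noteq> 1/2\<close>]] mult_right_mono mult_left_mono) auto
      also have "(2 * norm x) powr k = 2 powr k * norm x powr k" by (subst powr_mult) auto
      also have "C * (1 * (2 powr k * norm x powr k)) * norm x powr (- (k / 2))
          = C * (2 powr k * (norm x powr k * norm x powr (- (k / 2))))" by simp
      also have "norm x powr k * norm x powr (- (k / 2)) = norm x powr (k / 2)"
        by (simp add: powr_add [symmetric])
      finally show ?case .
    qed
    have "((\<lambda>x. norm x powr (k / 2)) \<longlongrightarrow> 0) ?F"
      by (rule tendsto_zero_powrI[where b = "k / 2"]) (use k in \<open>auto intro!: tendsto_eq_intros\<close>)
    then have "((\<lambda>x. C * (2 powr k * norm x powr (k / 2))) \<longlongrightarrow> C * (2 powr k * 0)) ?F"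
      by (intro tendsto_mult tendsto_const)
    then show "((\<lambda>x. C * (2 powr k * norm x powr (k / 2))) \<longlongrightarrow> 0) ?F" by simp
  qed
  show "((\<lambda>x. disc p k x $ i) \<longlongrightarrow> 0) (at (1/2) within corner_closure)"
  proof (rule Lim_null_comparison)
    let ?F = "at (1/2) within corner_closure"
    have "\<forall>\<^sub>F x in ?F. x \<in> corner_closure \<and> x \<noteq> 1/2 \<and> dist x (1/2) < 1/4"
      unfolding eventually_at by (rule exI[of _ "1/4"]) auto
    then show "\<forall>\<^sub>F x in ?F. norm (disc p k x $ i) \<le> C * (1/4) powr (- (k / 2)) * norm (1/2 - x) powr (2 * p)"
    proof eventually_elim
      case (elim x)
      then have x: "x \<in> corner_closure" "x \<noteq> 1/2" "norm (1/2 - x) < 1/4"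
        by (auto simp: dist_norm norm_minus_commute)
      have big: "norm x \<ge> 1/4" using x(3) norm_triangle_ineq2[of "1/2" "1/2 - x"] by simp
      then have "x \<noteq> 0" by auto
      have "norm x \<le> 1" "norm (1 - x) \<le> 1"
        using x(3) norm_triangle_ineq4[of "1/2" "1/2 - x"] norm_triangle_ineq[of "1/2" "1/2 - x"] by simp_all
      then have "norm (x * (1 - x)) \<le> 1" unfolding norm_mult by (intro mult_le_one) auto
      then have "norm (x * (1 - x)) powr k \<le> 1" using k by (intro le1) auto
      then have m: "norm (1/2 - x) powr (2 * p) * norm (x * (1 - x)) powr k \<le> norm (1/2 - x) powr (2 * p) * 1"
        by (intro mult_left_mono) auto
      have "norm x powr (- (k / 2)) \<le> (1/4) powr (- (k / 2))" using big k by (intro powr_mono2') auto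
      then have "norm (disc p k x $ i) \<le> C * (norm (1/2 - x) powr (2 * p) * 1) * (1/4) powr (- (k / 2))"
        using C(1) by (intro order_trans[OF C(2)[OF x(1) \<open>x \<noteq> 0\<close> x(2)]] mult_mono[OF mult_left_mono[OF m]]) auto
      then show ?case by (simp only: mult_1_right mult_ac)
    qed
    have "((\<lambda>x. norm (1/2 - x) powr (2 * p)) \<longlongrightarrow> 0) ?F"
      by (rule tendsto_zero_powrI[where b = "2 * p"]) (use p in \<open>auto intro!: tendsto_eq_intros\<close>)
    then have "((\<lambda>x. C * (1/4) powr (- (k / 2)) * norm (1/2 - x) powr (2 * p)) \<longlongrightarrow> C * (1/4) powr (- (k / 2)) * 0) ?F"
      by (intro tendsto_mult tendsto_const)
    then show "((\<lambda>x. C * (1/4) powr (- (k / 2)) * norm (1/2 - x) powr (2 * p)) \<longlongrightarrow> 0) ?F" by simp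
  qed
qed

lemma continuous_on_disc_nth:
  assumes "p > 0" "0 < k" "k < 1"
  shows "continuous_on corner_closure (\<lambda>x. disc p k x $ i)"
  unfolding continuous_on_def
proof
  fix x assume x: "x \<in> corner_closure"
  show "((\<lambda>x. disc p k x $ i) \<longlongrightarrow> disc p k x $ i) (at x within corner_closure)"
  proof (cases "x = 0 \<or> x = 1/2")
    case True
    then have "disc p k x $ i = 0" by (auto simp: disc_def)
    moreover have "((\<lambda>x. disc p k x $ i) \<longlongrightarrow> 0) (at x within corner_closure)"
      using True
    proof
      assume "x = 0"
      then show ?thesis by (simp only: disc_tendsto_0(1)[OF assms])
    next
      assume "x = 1/2"
      then show ?thesis by (simp only: disc_tendsto_0(2)[OF assms])
    qed
    ultimately show ?thesis by (simp only:)
  next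
    case False
    let ?S = "corner_closure - {0, 1/2}"
    have "continuous_on ?S (\<lambda>x. disc_weight p k x * (discU x + discY x))"
      "continuous_on ?S (\<lambda>x. disc_weight p k x * (discU x - discY x))"
      by (intro continuous_intros continuous_on_disc_weight
          continuous_on_subset[OF continuous_on_discU] continuous_on_subset[OF continuous_on_discY]; auto)+
    have "i = 1 \<or> i = 2" using exhaust_2 by blast
    then have "continuous_on ?S (\<lambda>x. disc p k x $ i)"
    proof
      assume "i = 1"
      then show ?thesis
        using \<open>continuous_on ?S (\<lambda>x. disc_weight p k x * (discU x + discY x))\<close>
        by (simp only:) (rule continuous_on_eq, assumption, simp add: disc_nth)
    next
      assume "i = 2"
      then show ?thesis
        using \<open>continuous_on ?S (\<lambda>x. disc_weight p k x * (discU x - discY x))\<close>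
        by (simp only:) (rule continuous_on_eq, assumption, simp add: disc_nth)
    qed
    then have "((\<lambda>x. disc p k x $ i) \<longlongrightarrow> disc p k x $ i) (at x within ?S)"
      using x False unfolding continuous_on_def by blast
    moreover have "at x within corner_closure = at x within ?S"
      using False by (intro at_within_nhd[of x "- {0, 1/2}"]) (auto intro: open_Compl finite_imp_closed)
    ultimately show ?thesis by simp
  qed
qed

lemma continuous_on_disc:
  assumes "p > 0" "0 < k" "k < 1"
  shows "continuous_on corner_closure (disc p k)"
proof -
  have "continuous_on corner_closure (\<lambda>x. \<chi> i. disc p k x $ i)"
    by (intro continuous_on_vec_lambda continuous_on_disc_nth assms)
  then show ?thesis by simp
qed

lemma norm_complex2_le: "norm (z::complex^2) \<le> norm (z$1) + norm (z$2)"
  using L2_set_le_sum[of UNIV "\<lambda>i. norm (z$i)"] by (simp add: norm_vec_def sum_2)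

lemma disc_decay:
  assumes p: "p > 0" and k: "k > 0" and pk: "p + k < 1/4" and e: "e > 0"
  obtains R where "R > 0" "\<And>x. x \<in> corner_closure \<Longrightarrow> norm x \<ge> R \<Longrightarrow> norm (disc p k x) < e"
proof -
  \<comment> \<open>With this value the total exponent at infinity is
    \<open>2 p + 2 k - \<beta> / 2 = p + k - 1/4 = - \<delta>\<close>, and
    \<open>\<beta> < 1\<close> is the same condition \<open>p + k < 1/4\<close>.\<close>
  define \<beta> where "\<beta> = 1/2 + 2 * (p + k)"
  have \<beta>: "0 < \<beta>" "\<beta> < 1" using assms by (simp_all add: \<beta>_def)
  define \<delta> where "\<delta> = 1/4 - p - k"
  have \<delta>: "- \<delta> < 0" using pk by (simp add: \<delta>_def)
  obtain C where C: "C > 0" "\<And>x i. x \<in> corner_closure \<Longrightarrow> x \<noteq> 0 \<Longrightarrow> x \<noteq> 1/2 \<Longrightarrow> norm (disc p k x $ i)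
    \<le> C * (norm (1/2 - x) powr (2 * p) * norm (x * (1 - x)) powr k) * norm x powr (- (\<beta> / 2))"
    using disc_bound[OF \<beta>] by blast
  have "((\<lambda>r. r powr (- \<delta>)) \<longlongrightarrow> (0::real)) at_top"
    by (rule tendsto_neg_powr[OF \<delta> filterlim_ident])
  then have "\<forall>\<^sub>F r in at_top. dist (r powr (- \<delta>)) 0 < e / (8 * C)"
    using e C(1) by (intro tendstoD) auto
  then obtain R where R: "\<And>r. r \<ge> R \<Longrightarrow> r powr (- \<delta>) < e / (8 * C)"
    by (auto simp: eventually_at_top_linorder)
  show ?thesis
  proof (rule that[of "max R 1"])
    fix x assume x: "x \<in> corner_closure" and big: "norm x \<ge> max R 1"
    then have n1: "norm x \<ge> 1" by simp
    moreover have "norm (1/2 :: complex) = 1/2" by simp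
    ultimately have ne: "x \<noteq> 0" "x \<noteq> 1/2" by fastforce+
    have "norm (1/2 - x) \<le> 2 * norm x" using n1 norm_triangle_ineq4[of "1/2" x] by simp
    then have "norm (1/2 - x) powr (2 * p) \<le> (2 * norm x) powr (2 * p)" using p by (intro powr_mono2) auto
    also have "\<dots> = 2 powr (2 * p) * norm x powr (2 * p)" by (subst powr_mult) auto
    also have "\<dots> \<le> 2 * norm x powr (2 * p)"
      using powr_mono[of "2 * p" 1 "2::real"] pk k by (intro mult_right_mono) auto
    finally have 1: "norm (1/2 - x) powr (2 * p) \<le> 2 * norm x powr (2 * p)" .
    have "norm (1 - x) \<le> 2 * norm x" using n1 norm_triangle_ineq4[of 1 x] by simp
    then have "norm (x * (1 - x)) \<le> norm x * (2 * norm x)" unfolding norm_mult by (intro mult_left_mono) auto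
    then have "norm (x * (1 - x)) powr k \<le> (norm x * (2 * norm x)) powr k" using k by (intro powr_mono2) auto
    also have "\<dots> = norm x powr k * (2 powr k * norm x powr k)" by (simp add: powr_mult)
    also have "\<dots> \<le> norm x powr k * (2 * norm x powr k)"
      using powr_mono[of k 1 "2::real"] pk p by (intro mult_left_mono mult_right_mono) auto
    finally have 2: "norm (x * (1 - x)) powr k \<le> norm x powr k * (2 * norm x powr k)" .
    have "norm (disc p k x $ i) \<le> 4 * C * norm x powr (- \<delta>)" for i
    proof -
      have "norm (disc p k x $ i) \<le> C * ((2 * norm x powr (2 * p)) * (norm x powr k * (2 * norm x powr k))) * norm x powr (- (\<beta> / 2))"
        using C(1) 1 2 by (intro order_trans[OF C(2)[OF x ne]] mult_right_mono mult_left_mono mult_mono) auto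
      also have "\<dots> = 4 * C * (norm x powr (2 * p) * norm x powr k * norm x powr k * norm x powr (- (\<beta> / 2)))" by simp
      also have "norm x powr (2 * p) * norm x powr k * norm x powr k * norm x powr (- (\<beta> / 2)) = norm x powr (- \<delta>)"
        by (simp only: powr_add [symmetric]) (simp add: \<beta>_def \<delta>_def algebra_simps add_divide_distrib)
      finally show ?thesis .
    qed
    from this[of 1] this[of 2] have "norm (disc p k x) \<le> 8 * C * norm x powr (- \<delta>)"
      using norm_complex2_le[of "disc p k x"] by linarith
    also have "\<dots> < 8 * C * (e / (8 * C))"
      using R[of "norm x"] big C(1) by (intro mult_strict_left_mono) auto
    finally show "norm (disc p k x) < e" using C(1) by simp
  qed simp
qed

lemma disc_boundary:
  assumes sc: "sin (pi * p) \<noteq> 0" "cos (pi * p) \<noteq> 0" "sin (pi * k) \<noteq> 0"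
    and x: "x \<in> corner_closure" "x \<notin> corner_domain"
  shows "disc p k x \<in> realR2 \<union> graphplane (exA1 p) \<union> graphplane (exA2 k)"
proof -
  have Y_real: "Im (discY x) = 0" if "Im x = 0" "Re x \<le> 1/2"
  proof -
    have "1 - x = of_real (1 - Re x)" using that by (simp add: complex_eq_iff)
    then show ?thesis using ellint_real[of "1 - Re x" 1] that ellok_1[of "1 - x"] by (simp add: discY_def)
  qed
  consider "x = 0 \<or> x = 1/2" | "Im x = 0" "0 < Re x" "Re x < 1/2" | "Im x = 0" "Re x < 0" | "Re x = 1/2" "Im x > 0"
  proof -
    have "Re x \<le> 1/2" "Im x \<ge> 0" "Re x = 1/2 \<or> Im x = 0"
      using x by (auto simp: corner_closure_def corner_domain_def)
    moreover have "x = 0 \<longleftrightarrow> Re x = 0 \<and> Im x = 0" "x = 1/2 \<longleftrightarrow> Re x = 1/2 \<and> Im x = 0"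
      by (simp_all add: complex_eq_iff)
    ultimately have "(x = 0 \<or> x = 1/2) \<or> (Im x = 0 \<and> 0 < Re x \<and> Re x < 1/2) \<or>
        (Im x = 0 \<and> Re x < 0) \<or> (Re x = 1/2 \<and> Im x > 0)" by argo
    then show ?thesis using that by blast
  qed
  then show ?thesis
  proof cases
    case 1
    then show ?thesis by (auto simp: disc_def realR2_iff)
  next
    case 2
    define a where "a = Re x"
    have xr: "x = of_real a" "0 < a" "a < 1/2" using 2 by (simp_all add: a_def complex_eq_iff)
    obtain r where r: "disc_weight p k x = of_real r" using disc_weight_right[OF xr(2,3)] xr(1) by metis
    have "Im (discU x) = 0"
      using ellint_real[of a 1] ellok_1[of x] xr by (simp add: discU_def)
    then show ?thesis using Y_real 2 by (simp add: realR2_iff disc_nth r)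
  next
    case 3
    define a where "a = Re x"
    have xr: "x = of_real a" "a < 0" using 3 by (simp_all add: a_def complex_eq_iff)
    have ne: "x \<noteq> 0" "x \<noteq> 1/2" using 3 by (auto simp: complex_eq_iff)
    obtain r where r: "disc_weight p k x = cis (pi * k) * of_real r" using disc_weight_left[OF xr(2)] xr(1) by metis
    define s where "s = Re (ellint (- x) (1 - x))"
    have "ellok (- x) (1 - x)" using 3 by (intro ellok_Re) auto
    then have "Im (ellint (- x) (1 - x)) = 0" using ellint_real[of "- a" "1 - a"] xr(1) by simp
    then have S: "ellint (- x) (1 - x) = of_real s" by (simp add: s_def complex_eq_iff)
    define y where "y = Re (discY x)"
    have Y: "discY x = of_real y" using Y_real 3 by (simp add: y_def complex_eq_iff)
    have U: "discU x = of_real s - \<i> * of_real y" using 3 S Y by (simp add: discU_def discY_def)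
    have "disc p k x $ 1 = cis (pi * k) * (of_real (r * s) - \<i> * of_real (r * y) + of_real (r * y))"
      "disc p k x $ 2 = cis (pi * k) * (of_real (r * s) - \<i> * of_real (r * y) - of_real (r * y))"
      using ne by (simp_all add: disc_nth r Y U algebra_simps)
    then have "disc p k x \<in> graphplane (exA2 k)" unfolding graphplane_exA2[OF sc(3)] by blast
    then show ?thesis by blast
  next
    case 4
    have xc: "Complex (1/2) (Im x) = x" using 4 by (simp add: complex_eq_iff)
    have ne: "x \<noteq> 0" "x \<noteq> 1/2" using 4 by (auto simp: complex_eq_iff)
    obtain r where r: "disc_weight p k x = cis (- (pi * p)) * of_real r" using disc_weight_vertical[OF 4(2)] xc by metis
    have "1 - x = cnj x" using 4 by (simp add: complex_eq_iff)
    moreover have "ellok x 1" using 4 by (intro ellok_1) auto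
    ultimately have Y: "discY x = cnj (discU x)"
      using ellint_cnj[of x 1] 4 by (simp add: discY_def discU_def)
    have "discU x + discY x = of_real (2 * Re (discU x))" "discU x - discY x = \<i> * of_real (2 * Im (discU x))"
      unfolding Y by (simp_all add: complex_eq_iff)
    then have "disc p k x $ 1 = cis (- (pi * p)) * of_real (r * (2 * Re (discU x)))"
      "disc p k x $ 2 = \<i> * cis (- (pi * p)) * of_real (r * (2 * Im (discU x)))"
      using ne by (simp_all add: disc_nth r mult_ac)
    then have "disc p k x \<in> graphplane (exA1 p)" unfolding graphplane_exA1[OF sc(1,2)] by blast
    then show ?thesis by blast
  qed
qed

section \<open>The disc lies in the hull but not in the union\<close>

lemma holomorphic_on_disc_nth: "(\<lambda>x. disc p k x $ i) holomorphic_on corner_domain"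
proof -
  have "(\<lambda>x. disc_weight p k x * (discU x + discY x)) holomorphic_on corner_domain"
    "(\<lambda>x. disc_weight p k x * (discU x - discY x)) holomorphic_on corner_domain"
    by (intro holomorphic_intros holomorphic_on_disc_weight holomorphic_on_disc_functions)+
  moreover have "x \<noteq> 0 \<and> x \<noteq> 1/2" if "x \<in> corner_domain" for x using corner_domain_subset that by blast
  moreover have "i = 1 \<or> i = 2" using exhaust_2 by blast
  ultimately show ?thesis by (auto simp: disc_nth cong: holomorphic_cong)
qed

lemma holomorphic_on_cpoly2:
  assumes "cpoly2 P" "(\<lambda>x. f x $ 1) holomorphic_on S" "(\<lambda>x. f x $ 2) holomorphic_on S"
  shows "(\<lambda>x. P (f x)) holomorphic_on S"
proof -
  obtain c N where P: "P = (\<lambda>z. \<Sum>j\<le>N. \<Sum>k\<le>N. c (j,k) * (z$1)^j * (z$2)^k)"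
    using assms(1) unfolding cpoly2_def by blast
  show ?thesis unfolding P by (intro holomorphic_intros assms)
qed

text \<open>The domain is unbounded, so the maximum principle is applied on its part inside a large
  ball. On the boundary the disc lies in \<open>K\<close>; on the circular arc it is close to 0, a
  point of \<open>K\<close>, so the polynomial exceeds its bound by less than
  \<open>e\<close>.\<close>

lemma disc_in_hull:
  assumes p: "p > 0" and k: "k > 0" and pk: "p + k < 1/4"
    and E: "closed E" "0 \<in> E" "\<And>x. x \<in> corner_closure \<Longrightarrow> x \<notin> corner_domain \<Longrightarrow> disc p k x \<in> E"
  obtains K where "compact K" "K \<subseteq> E" "\<And>x. x \<in> corner_domain \<Longrightarrow> in_hull K (disc p k x)"
proof -
  have cont: "continuous_on corner_closure (disc p k)" using p k pk by (intro continuous_on_disc) auto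
  note cl = closed_corner_closure
  have sub: "corner_domain \<subseteq> corner_closure" using corner_domain_subset by blast
  obtain R0 where R0: "R0 > 0" "\<And>x. x \<in> corner_closure \<Longrightarrow> norm x \<ge> R0 \<Longrightarrow> norm (disc p k x) < 1"
    using disc_decay[OF p k pk, of 1] by auto
  have "compact (disc p k ` (corner_closure \<inter> cball 0 R0))"
    using cl by (intro compact_continuous_image continuous_on_subset[OF cont]) (auto simp: closed_Int_compact)
  then obtain B where B: "\<forall>z\<in>disc p k ` (corner_closure \<inter> cball 0 R0). norm z \<le> B"
    using compact_imp_bounded bounded_iff by blast
  \<comment> \<open>The radius covers the whole disc: \<open>B\<close> inside the ball of radius
    \<open>R0\<close>, and 1 outside by decay.\<close>
  define K where "K = E \<inter> cball 0 (max B 1)"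
  have bound: "norm (disc p k x) \<le> max B 1" if "x \<in> corner_closure" for x
    using R0(2)[of x] B that by (cases "norm x \<ge> R0") (auto simp: le_max_iff_disj)
  have K: "compact K" "K \<subseteq> E" "0 \<in> K" using E(1,2) by (auto simp: K_def closed_Int_compact)
  show ?thesis
  proof (rule that[OF K(1,2)])
    fix x0 assume x0: "x0 \<in> corner_domain"
    show "in_hull K (disc p k x0)"
      unfolding in_hull_def
    proof (intro allI impI)
      fix P M assume P: "cpoly2 P" and M: "\<forall>w\<in>K. norm (P w) \<le> M"
      show "norm (P (disc p k x0)) \<le> M"
      proof (rule field_le_epsilon)
        fix e :: real assume e: "e > 0"
        have "isCont P 0"
          using continuous_on_cpoly2[OF P continuous_on_id[of UNIV]] by (simp add: continuous_on_eq_continuous_at)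
        then obtain d where d: "d > 0" "\<And>z. norm z < d \<Longrightarrow> norm (P z - P 0) < e"
          using e unfolding continuous_at_eps_delta by (auto simp: dist_norm)
        obtain R where R: "R > 0" "\<And>x. x \<in> corner_closure \<Longrightarrow> norm x \<ge> R \<Longrightarrow> norm (disc p k x) < d"
          using disc_decay[OF p k pk d(1)] by blast
        \<comment> \<open>The summand \<open>norm x0 + 1\<close> only ensures that the truncated
          domain still contains \<open>x0\<close>.\<close>
        define R' where "R' = max R (norm x0 + 1)"
        let ?S = "corner_domain \<inter> ball 0 R'"
        have op: "open ?S" by (intro open_Int open_corner_domain open_ball)
        have clS: "closure ?S \<subseteq> corner_closure \<inter> cball 0 R'"
          using sub cl by (intro closure_minimal) auto
        have "norm x0 < R'" unfolding R'_def by linarith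
        then have x0S: "x0 \<in> ?S" using x0 by simp
        have "(\<lambda>x. P (disc p k x)) holomorphic_on corner_domain"
          by (intro holomorphic_on_cpoly2[OF P] holomorphic_on_disc_nth)
        then have 1: "(\<lambda>x. P (disc p k x)) holomorphic_on interior ?S"
          by (rule holomorphic_on_subset) (use interior_subset in blast)
        have "continuous_on corner_closure (\<lambda>x. P (disc p k x))"
          by (rule continuous_on_cpoly2[OF P cont])
        then have 2: "continuous_on (closure ?S) (\<lambda>x. P (disc p k x))"
          by (rule continuous_on_subset) (use clS in blast)
        have 3: "bounded ?S" by (intro bounded_Int) auto
        have 4: "norm (P (disc p k x)) \<le> M + e" if "x \<in> frontier ?S" for x
        proof -
          have x: "x \<in> corner_closure" "norm x \<le> R'" "x \<notin> ?S"
            using that clS unfolding frontier_def interior_open[OF op] by auto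
          show ?thesis
          proof (cases "x \<in> corner_domain")
            case True
            then have "norm x \<ge> R" using x by (simp add: R'_def)
            then have "norm (P (disc p k x) - P 0) < e" using R(2)[OF x(1)] d(2) by blast
            moreover have "norm (P 0) \<le> M" using M K(3) by blast
            ultimately show ?thesis using norm_triangle_sub[of "P (disc p k x)" "P 0"] by linarith
          next
            case False
            then have "disc p k x \<in> K" using E(3) x(1) bound by (simp add: K_def)
            then show ?thesis using bspec[OF M] e by fastforce
          qed
        qed
        show "norm (P (disc p k x0)) \<le> M + e"
          by (rule maximum_modulus_frontier[OF 1 2 3 4 x0S])
      qed
    qed
  qed
qed

text \<open>By the open mapping theorem a nonconstant \<open>q\<close> would map \<open>V\<close>
  onto an open set, which cannot lie in the real line.\<close>

lemma real_on_open_imp_constant: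
  assumes q: "q holomorphic_on S" and S: "open S" "connected S" and V: "open V" "V \<subseteq> S" "V \<noteq> {}"
    and real: "\<And>x. x \<in> V \<Longrightarrow> Im (q x) = 0"
  shows "q constant_on S"
proof (rule ccontr)
  assume "\<not> q constant_on S"
  then have "open (q ` V)" by (intro open_mapping_thm[OF q S V(1,2)])
  moreover obtain v where v: "v \<in> V" using V(3) by blast
  ultimately obtain e where e: "e > 0" "ball (q v) e \<subseteq> q ` V" unfolding open_contains_ball by blast
  have "q v + \<i> * of_real (e/2) \<in> ball (q v) e" using e(1) by (simp add: dist_norm norm_mult)
  then obtain u where "u \<in> V" "q u = q v + \<i> * of_real (e/2)" using e(2) by (metis imageE subsetD)
  then show False using real[of u] real[OF v] e(1) by simp
qed

text \<open>Both functions extend continuously to the closure and vanish at 0. At 1/4 they are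
  nonzero multiples of \<open>discY\<close> and \<open>discU + discY\<close>, which have positive
  real part there.\<close>

lemma disc_not_constant:
  assumes pk: "p > 0" "0 < k" "k < 1" and c: "c \<noteq> 0"
  shows "\<not> (\<lambda>x. c * (disc p k x $ 1 - disc p k x $ 2)) constant_on corner_domain" (is "\<not> ?q constant_on _")
    and "\<not> (\<lambda>x. c * disc p k x $ 1) constant_on corner_domain" (is "\<not> ?r constant_on _")
proof -
  have cl: "of_real a \<in> closure corner_domain" if "a < 1/2" for a
    unfolding closure_approachable
  proof (intro allI impI)
    fix e :: real assume "e > 0"
    then show "\<exists>y\<in>corner_domain. dist y (of_real a) < e"
      using that by (intro bexI[of _ "Complex a (e/2)"])
        (auto simp: corner_domain_def dist_norm complex_norm cmod_def)
  qed
  have "closure corner_domain \<subseteq> corner_closure"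
    using corner_domain_subset by (intro closure_minimal closed_corner_closure) auto
  then have cont: "continuous_on (closure corner_domain) (\<lambda>x. disc p k x $ i)" for i
    using continuous_on_subset[OF continuous_on_disc_nth[OF pk]] by blast
  have eq: "f 0 = f (1/4)" if f: "f constant_on corner_domain" "continuous_on (closure corner_domain) f" for f :: "complex \<Rightarrow> complex"
  proof -
    obtain b where b: "\<And>x. x \<in> corner_domain \<Longrightarrow> f x = b" using f(1) unfolding constant_on_def by blast
    have "f (of_real 0) = b" "f (of_real (1/4)) = b"
      using continuous_constant_on_closure[OF f(2) b] cl[of 0] cl[of "1/4"] by (simp_all del: of_real_divide of_real_0)
    then show ?thesis by simp
  qed
  have "Re (discU (1/4)) \<ge> pi / 2" "Re (discY (1/4)) \<ge> pi / 2"
    using ellint_ge[of "1/4"] ellint_ge[of "3/4"] by (simp_all add: discU_def discY_def)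
  then have "Re (discY (1/4)) > 0" "Re (discU (1/4) + discY (1/4)) > 0"
    using pi_gt_zero unfolding plus_complex.sel by linarith+
  then have ne: "discY (1/4) \<noteq> 0" "discU (1/4) + discY (1/4) \<noteq> 0" by (metis less_irrefl zero_complex.sel(1))+
  have w: "disc_weight p k (1/4) \<noteq> 0" by (simp add: disc_weight_def)
  show "\<not> ?q constant_on corner_domain"
  proof
    assume "?q constant_on corner_domain"
    then have "?q 0 = ?q (1/4)" by (rule eq) (intro continuous_intros cont)
    then show False using c w ne(1) by (simp add: disc_nth algebra_simps)
  qed
  show "\<not> ?r constant_on corner_domain"
  proof
    assume "?r constant_on corner_domain"
    then have "?r 0 = ?r (1/4)" by (rule eq) (intro continuous_intros cont)
    then show False using c w ne(2) by (simp add: disc_nth)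
  qed
qed

text \<open>Otherwise the whole disc would lie in the three planes, and an open part of it in a
  single one. On each plane some nonzero linear functional is real, namely a rotation of
  \<open>z$1 - z$2\<close> or of \<open>z$1\<close>, which forces a nonconstant function to be
  constant.\<close>

lemma not_hull_closed_example:
  assumes p: "p > 0" and k: "k > 0" and pk: "p + k < 1/4"
  shows "\<not> hull_closed (realR2 \<union> graphplane (exA1 p) \<union> graphplane (exA2 k))"
proof
  let ?E = "realR2 \<union> graphplane (exA1 p) \<union> graphplane (exA2 k)"
  assume hc: "hull_closed ?E"
  have "0 < pi * p" "pi * p < pi * (1/4)" "0 < pi * k" "pi * k < pi * (1/4)"
    using assms by (auto intro!: mult_strict_left_mono)
  then have sc: "sin (pi * p) \<noteq> 0" "cos (pi * p) \<noteq> 0" "sin (pi * k) \<noteq> 0"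
    using sin_gt_zero[of "pi * p"] cos_gt_zero[of "pi * p"] sin_gt_zero[of "pi * k"] by auto
  have E: "closed ?E" "0 \<in> ?E"
    by (intro closed_Un closed_subspace subspace_realR2 subspace_graphplane, simp add: realR2_iff)
  obtain K where K: "compact K" "K \<subseteq> ?E" "\<And>x. x \<in> corner_domain \<Longrightarrow> in_hull K (disc p k x)"
    using disc_in_hull[OF p k pk E] disc_boundary[OF sc] by metis
  have inE: "disc p k x \<in> ?E" if "x \<in> corner_domain" for x
    by (rule hull_closedD[OF hc K(1,2) K(3)[OF that]])
  have conn: "connected corner_domain" by (rule convex_connected[OF convex_corner_domain])
  have const: "(\<lambda>x. c * (disc p k x $ 1 - disc p k x $ 2)) constant_on corner_domain"
    if "open V" "V \<subseteq> corner_domain" "V \<noteq> {}" "\<And>x. x \<in> V \<Longrightarrow> Im (c * (disc p k x $ 1 - disc p k x $ 2)) = 0" for c V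
    by (rule real_on_open_imp_constant[OF _ open_corner_domain conn that])
       (intro holomorphic_intros holomorphic_on_disc_nth)
  have const1: "(\<lambda>x. c * disc p k x $ 1) constant_on corner_domain"
    if "open V" "V \<subseteq> corner_domain" "V \<noteq> {}" "\<And>x. x \<in> V \<Longrightarrow> Im (c * disc p k x $ 1) = 0" for c V
    by (rule real_on_open_imp_constant[OF _ open_corner_domain conn that])
       (intro holomorphic_intros holomorphic_on_disc_nth)
  have k1: "k < 1" using pk p by simp
  have cont: "continuous_on corner_domain (disc p k)"
    using continuous_on_subset[OF continuous_on_disc[OF p k k1]] corner_domain_subset by blast
  have pre: "open {x \<in> U. disc p k x \<notin> F}" if "open U" "U \<subseteq> corner_domain" "closed F" for U F
  proof -
    have "open (U \<inter> disc p k -` (- F))"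
      using that by (intro continuous_open_preimage continuous_on_subset[OF cont]) auto
    moreover have "U \<inter> disc p k -` (- F) = {x \<in> U. disc p k x \<notin> F}" by auto
    ultimately show ?thesis by simp
  qed
  \<comment> \<open>Removing the closed planes in turn gives open sets; the last nonempty one lies
    over the next plane in the list.\<close>
  define U1 where "U1 = {x \<in> corner_domain. disc p k x \<notin> realR2}"
  define U2 where "U2 = {x \<in> U1. disc p k x \<notin> graphplane (exA1 p)}"
  have U1: "open U1" "U1 \<subseteq> corner_domain" unfolding U1_def
    by (auto intro!: pre open_corner_domain closed_subspace subspace_realR2)
  have U2: "open U2" "U2 \<subseteq> corner_domain" unfolding U2_def
    using U1 by (auto intro!: pre closed_subspace subspace_graphplane)
  have ne: "Complex 0 1 \<in> corner_domain" by (simp add: corner_domain_def)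
  show False
  proof (cases "U1 = {}")
    case True
    then have "Im (1 * (disc p k x $ 1 - disc p k x $ 2)) = 0" if "x \<in> corner_domain" for x
      using that by (auto simp: U1_def realR2_iff)
    then have "(\<lambda>x. 1 * (disc p k x $ 1 - disc p k x $ 2)) constant_on corner_domain"
      using ne by (intro const[OF open_corner_domain]) auto
    then show False using disc_not_constant(1)[OF p k k1, of 1] by simp
  next
    case 1: False
    show False
    proof (cases "U2 = {}")
      case True
      have "Im (cis (pi * p) * disc p k x $ 1) = 0" if "x \<in> U1" for x
      proof -
        have "disc p k x \<in> graphplane (exA1 p)" using True that by (auto simp: U2_def)
        then obtain a :: real where "disc p k x $ 1 = cis (- (pi * p)) * of_real a"
          unfolding graphplane_exA1[OF sc(1,2)] by blast
        then have "cis (pi * p) * disc p k x $ 1 = (cis (pi * p) * cis (- (pi * p))) * of_real a" by simp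
        also have "cis (pi * p) * cis (- (pi * p)) = 1" by (simp add: cis_mult del: cis_inverse)
        finally show ?thesis by simp
      qed
      then have "(\<lambda>x. cis (pi * p) * disc p k x $ 1) constant_on corner_domain"
        using 1 by (intro const1[OF U1]) auto
      then show False using disc_not_constant(2)[OF p k k1, of "cis (pi * p)"] by simp
    next
      case 2: False
      have "Im (cis (- (pi * k)) * (disc p k x $ 1 - disc p k x $ 2)) = 0" if "x \<in> U2" for x
      proof -
        have "disc p k x \<in> graphplane (exA2 k)"
          using inE[of x] that by (auto simp: U2_def U1_def)
        then obtain r y :: real where
          "disc p k x $ 1 = cis (pi * k) * (of_real r - \<i> * of_real y + of_real y)"
          "disc p k x $ 2 = cis (pi * k) * (of_real r - \<i> * of_real y - of_real y)"
          unfolding graphplane_exA2[OF sc(3)] by blast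
        then have "disc p k x $ 1 - disc p k x $ 2 = cis (pi * k) * of_real (2 * y)"
          by (simp only:) (simp add: algebra_simps)
        then have "cis (- (pi * k)) * (disc p k x $ 1 - disc p k x $ 2) = (cis (- (pi * k)) * cis (pi * k)) * of_real (2 * y)"
          by simp
        also have "cis (- (pi * k)) * cis (pi * k) = 1" by (simp add: cis_mult del: cis_inverse)
        finally show ?thesis by simp
      qed
      then have "(\<lambda>x. cis (- (pi * k)) * (disc p k x $ 1 - disc p k x $ 2)) constant_on corner_domain"
        using 2 by (intro const[OF U2]) auto
      then show False using disc_not_constant(1)[OF p k k1, of "cis (- (pi * k))"] by simp
    qed
  qed
qed

section \<open>Optimality\<close>

text \<open>Here \<open>p + k = 1/4 - e\<close> stays below the critical value 1/4. As
  \<open>e\<close> tends to 0, so that \<open>p\<close> tends to 0 and \<open>k\<close> to 1/4, both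
  lower right entries tend to 0.\<close>

definition example :: "real \<Rightarrow> (real^2^2) \<times> (real^2^2)" where
  "example e = (exA1 e, exA2 (1/4 - 2 * e))"

lemma trig_example:
  assumes "0 < e" "e < 1/16"
  shows "sin (pi * e) > 0" "cos (pi * e) > 0" "sin (pi * (1/4 - 2 * e)) > 0" "cos (pi * (1/4 - 2 * e)) > 0"
    "sin (pi * (e + (1/4 - 2 * e))) < cos (pi * (e + (1/4 - 2 * e)))"
proof -
  have "0 < pi * e" "pi * e < pi * (1/4)" "0 < pi * (1/4 - 2 * e)" "pi * (1/4 - 2 * e) < pi * (1/4)"
    "0 < pi * (e + (1/4 - 2 * e))" and lt: "pi * (e + (1/4 - 2 * e)) < pi * (1/4)"
    using assms by (auto intro!: mult_strict_left_mono)
  then show "sin (pi * e) > 0" "cos (pi * e) > 0" "sin (pi * (1/4 - 2 * e)) > 0" "cos (pi * (1/4 - 2 * e)) > 0"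
    by (auto intro!: sin_gt_zero cos_gt_zero)
  have "a < pi / 4 \<Longrightarrow> 0 < a \<Longrightarrow> sin a < cos a" for a
    unfolding sin_cos_eq by (intro cos_monotone_0_pi) auto
  then show "sin (pi * (e + (1/4 - 2 * e))) < cos (pi * (e + (1/4 - 2 * e)))"
    using lt \<open>0 < pi * (e + (1/4 - 2 * e))\<close> by simp
qed

lemma example_properties:
  assumes e: "0 < e" "e < 1/16"
  shows "example e \<in> Omega - Omega_star"
    "loc_poly_convex (realR2 \<union> graphplane (fst (example e))) 0"
    "loc_poly_convex (realR2 \<union> graphplane (snd (example e))) 0"
    "loc_poly_convex (graphplane (fst (example e)) \<union> graphplane (snd (example e))) 0"
    "\<not> loc_poly_convex (realR2 \<union> graphplane (fst (example e)) \<union> graphplane (snd (example e))) 0"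
proof -
  let ?k = "1/4 - 2 * e"
  note trig = trig_example[OF e]
  have pairs: "hull_closed (realR2 \<union> graphplane (exA1 e))" "hull_closed (realR2 \<union> graphplane (exA2 ?k))"
    "hull_closed (graphplane (exA1 e) \<union> graphplane (exA2 ?k))"
    using trig by (auto intro!: hull_closed_realR2_exA1 hull_closed_realR2_exA2 hull_closed_exA1_exA2)
  have triple: "\<not> hull_closed (realR2 \<union> graphplane (exA1 e) \<union> graphplane (exA2 ?k))"
    using e by (intro not_hull_closed_example) auto
  have "- cos (pi * e) / sin (pi * e) < 0" "sin (pi * e) / cos (pi * e) > 0"
    using trig by (simp_all add: divide_neg_pos)
  then have "(exA1 e, exA2 ?k) \<in> Omega" unfolding exA1_def by (intro diagonal_in_Omega) auto
  moreover have "(exA1 e, exA2 ?k) \<notin> Omega_star"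
    using hull_closed_Omega_star pairs triple by blast
  ultimately show "example e \<in> Omega - Omega_star" by (simp add: example_def)
  show "loc_poly_convex (realR2 \<union> graphplane (fst (example e))) 0"
    "loc_poly_convex (realR2 \<union> graphplane (snd (example e))) 0"
    "loc_poly_convex (graphplane (fst (example e)) \<union> graphplane (snd (example e))) 0"
    "\<not> loc_poly_convex (realR2 \<union> graphplane (fst (example e)) \<union> graphplane (snd (example e))) 0"
    using pairs triple
    by (simp_all add: example_def loc_poly_convex_Un loc_poly_convex_Un3 subspace_realR2 subspace_graphplane)
qed

lemma norm_mat2_diagonal_le: "norm (mat2 a 0 0 b) \<le> \<bar>a\<bar> + \<bar>b\<bar>"
proof -
  have "norm (mat2 a 0 0 b $ 1) = \<bar>a\<bar>" "norm (mat2 a 0 0 b $ 2) = \<bar>b\<bar>"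
    by (simp_all add: norm_vec_def L2_set_def sum_2)
  then show ?thesis
    using L2_set_le_sum[of UNIV "\<lambda>i. norm (mat2 a 0 0 b $ i)"] by (simp add: norm_vec_def[of "mat2 a 0 0 b"] sum_2)
qed

text \<open>The lower right entries of the two matrices are small. Moving them to \<open>- e\<close> and \<open>e\<close> makes both
  symmetric parts definite, and the frontier is hit on the way.\<close>

lemma frontier_near_example:
  assumes e: "0 < e" "e < 1/16" and small: "e < cos (pi * e) / sin (pi * e)"
  obtains b where "b \<in> top_of_set Omega frontier_of Omega_star"
    "dist (example e) b \<le> \<bar>sin (pi * e) / cos (pi * e) + e\<bar>
      + \<bar>cos (pi * (1/4 - 2 * e)) / sin (pi * (1/4 - 2 * e)) - 1 / (2 * (sin (pi * (1/4 - 2 * e)))^2) - e\<bar>"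
proof -
  note trig = trig_example[OF e]
  define \<sigma> \<tau> where "\<sigma> = cos (pi * (1/4 - 2 * e)) / sin (pi * (1/4 - 2 * e))"
    and "\<tau> = 1 / (2 * (sin (pi * (1/4 - 2 * e)))^2)"
  define l1 l2 where "l1 = - cos (pi * e) / sin (pi * e)" and "l2 = sin (pi * e) / cos (pi * e)"
  have pos: "\<sigma> > 0" "\<tau> > 0" "l2 > 0" using trig by (simp_all add: \<sigma>_def \<tau>_def l2_def)
  have l1: "l1 < - e" using small by (simp add: l1_def)
  \<comment> \<open>With the identity as \<open>T\<close> the determinants of the symmetric parts
    become \<open>- 4 l1 e\<close> and \<open>4 (\<sigma> + \<tau>) e\<close>, both
    positive.\<close>
  define c where "c = (mat2 l1 0 0 (- e), mat2 (\<sigma> + \<tau>) (- \<tau>) \<tau> e)"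
  have ex: "example e = (mat2 l1 0 0 l2, mat2 (\<sigma> + \<tau>) (- \<tau>) \<tau> (\<sigma> - \<tau>))"
    by (simp add: example_def exA1_def exA2_def Let_def \<sigma>_def \<tau>_def l1_def l2_def)
  have "normal_form (mat 1) (mat2 l1 0 0 (- e))"
    unfolding normal_form_def conj_by_mat1 using less_imp_neq[OF l1] invertible_det_nz[of "mat 1 :: real^2^2"]
    by (metis det_I zero_neq_one)
  moreover have "form_i (mat 1) (mat2 (\<sigma> + \<tau>) (- \<tau>) \<tau> e)"
    unfolding form_i_def conj_by_mat1 by blast
  moreover have "e * l1 < 0" using l1 e(1) by (intro mult_pos_neg) auto
  then have "posdet (mat 1) (mat2 l1 0 0 (- e))"
    unfolding posdet_def conj_by_mat1 by (simp add: det_2 transpose_def)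
  moreover have "posdet (mat 1) (mat2 (\<sigma> + \<tau>) (- \<tau>) \<tau> e)"
    using pos e(1) unfolding posdet_def conj_by_mat1 by (simp add: det_2 transpose_def)
  moreover have "l1 \<noteq> - e" using l1 by simp
  ultimately have cstar: "c \<in> Omega_star"
    unfolding c_def Omega_star_def using diagonal_in_Omega[of l1 "- e"] by auto
  \<comment> \<open>Along the segment the first matrix is diagonal with entries \<open>l1\<close>
    and \<open>d >= - e > l1\<close>, so its eigenvalues stay distinct; this is what
    \<open>small\<close> is for.\<close>
  have seg: "closed_segment (example e) c \<subseteq> Omega"
  proof
    fix x assume "x \<in> closed_segment (example e) c"
    then obtain u where u: "0 \<le> u" "u \<le> 1" "x = (1 - u) *\<^sub>R example e + u *\<^sub>R c"
      unfolding closed_segment_def by blast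
    define d where "d = (1 - u) * l2 + u * (- e)"
    have "(1 - u) * l2 \<ge> 0" "u * e \<le> e" using u pos(3) e(1) by (auto intro: mult_left_le_one_le)
    then have "d \<ge> - e" by (simp add: d_def)
    then have "l1 \<noteq> d" using l1 by linarith
    moreover have "fst x = mat2 l1 0 0 d"
      by (simp add: u(3) ex c_def matrix_eq_2 d_def algebra_simps)
    ultimately show "x \<in> Omega" using diagonal_in_Omega(1) by (metis prod.collapse)
  qed
  have "connectedin (top_of_set Omega) (closed_segment (example e) c)"
    using seg by (simp add: connectedin_subtopology)
  moreover have "c \<in> closed_segment (example e) c \<inter> Omega_star" using cstar by simp
  moreover have "example e \<in> closed_segment (example e) c - Omega_star"
    using example_properties(1)[OF e] by simp
  \<comment> \<open>A connected subset of \<open>Omega\<close> that meets \<open>Omega_star\<close>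
    and its complement meets the relative frontier.\<close>
  ultimately obtain b where b: "b \<in> closed_segment (example e) c" "b \<in> top_of_set Omega frontier_of Omega_star"
    using connectedin_Int_frontier_of[of "top_of_set Omega" "closed_segment (example e) c" Omega_star] by blast
  have "dist (example e) b \<le> dist (example e) c"
    using b(1) by (metis dist_commute dist_in_closed_segment)
  also have "\<dots> \<le> dist (fst (example e)) (fst c) + dist (snd (example e)) (snd c)"
    unfolding dist_prod_def by (rule sqrt_sum_squares_le_sum) auto
  also have "fst (example e) - fst c = mat2 0 0 0 (l2 + e)"
    "snd (example e) - snd c = mat2 0 0 0 (\<sigma> - \<tau> - e)"
    by (simp_all add: ex c_def matrix_eq_2)
  then have "dist (fst (example e)) (fst c) + dist (snd (example e)) (snd c) \<le> \<bar>l2 + e\<bar> + \<bar>\<sigma> - \<tau> - e\<bar>"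
    using norm_mat2_diagonal_le[of 0 "l2 + e"] norm_mat2_diagonal_le[of 0 "\<sigma> - \<tau> - e"]
    by (simp add: dist_norm)
  finally show ?thesis using that b(2) unfolding \<sigma>_def \<tau>_def l2_def by blast
qed

lemma example_tends_to_frontier:
  assumes "d > 0"
  shows "\<forall>\<^sub>F e in at_right 0. \<exists>b \<in> top_of_set Omega frontier_of Omega_star. dist (example e) b < d"
proof -
  let ?F = "\<lambda>e. \<bar>sin (pi * e) / cos (pi * e) + e\<bar>
      + \<bar>cos (pi * (1/4 - 2 * e)) / sin (pi * (1/4 - 2 * e)) - 1 / (2 * (sin (pi * (1/4 - 2 * e)))^2) - e\<bar>"
  \<comment> \<open>At \<open>e = 0\<close> the last quotients are \<open>cot (pi/4) = 1\<close> and
    \<open>1 / (2 sin^2 (pi/4)) = 1\<close>, and they cancel.\<close>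
  have "sin (pi / 4) = cos (pi / 4)" "2 * (sin (pi / 4))\<^sup>2 = 1" "sin (pi / 4) \<noteq> 0"
    by (simp_all add: sin_45 cos_45 power2_eq_square)
  then have "(?F \<longlongrightarrow> 0) (at_right 0)"
    by (auto intro!: tendsto_eq_intros)
  then have "\<forall>\<^sub>F e in at_right 0. ?F e < d" using assms by (rule order_tendstoD(2))
  \<comment> \<open>The condition \<open>e < cot (pi e)\<close> multiplied by the sine, since the
    quotient itself is singular at 0.\<close>
  moreover have "((\<lambda>e. e * sin (pi * e) - cos (pi * e)) \<longlongrightarrow> -1) (at_right 0)"
    by (auto intro!: tendsto_eq_intros)
  then have "\<forall>\<^sub>F e in at_right 0. e * sin (pi * e) - cos (pi * e) < 0"
    by (rule order_tendstoD(2)) simp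
  moreover have "\<forall>\<^sub>F e in at_right (0::real). e \<in> {0<..<1/16}"
    by (rule eventually_at_right_real) simp
  ultimately show ?thesis
  proof eventually_elim
    case (elim e)
    then have e: "0 < e" "e < 1/16" by auto
    have "e < cos (pi * e) / sin (pi * e)"
      using elim(2) trig_example(1)[OF e] by (simp add: field_simps)
    then obtain b where "b \<in> top_of_set Omega frontier_of Omega_star" "dist (example e) b \<le> ?F e"
      using frontier_near_example[OF e] by blast
    then show ?case using elim(1) by (intro bexI[of _ b]) (rule le_less_trans)
  qed
qed

theorem theorem1p4:
  fixes P0 P1 P2 :: "(complex^2) set" and g :: "complex^2 \<Rightarrow> complex^2"
    and A1 A2 :: "real^2^2"
  assumes "totally_real_plane P0" and "totally_real_plane P1" and "totally_real_plane P2"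
    and "P0 \<inter> P1 = {0}" and "P0 \<inter> P2 = {0}"
    and "\<exists>G::complex^2^2. invertible G \<and> g = (\<lambda>z. G *v z)"
    and "g ` P0 = realR2" and "g ` P1 = graphplane A1" and "g ` P2 = graphplane A2"
    and "(A1, A2) \<in> Omega"
  shows "(\<exists>T. normal_form T A1) \<and>
    ((loc_poly_convex (P0 \<union> P1) 0 \<and> loc_poly_convex (P0 \<union> P2) 0 \<and> loc_poly_convex (P1 \<union> P2) 0) \<longrightarrow>
      ((mspec A1 \<subseteq> \<real> \<and> card (mspec A1) = 2) \<longrightarrow>
         (commdet A1 A2 = 0 \<or> (\<exists>T. normal_form T A1 \<and> form_i T A2)) \<and>
         (commdet A1 A2 = 0 \<longrightarrow> loc_poly_convex (P0 \<union> P1 \<union> P2) 0) \<and>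
         ((\<exists>T. normal_form T A1 \<and> form_i T A2 \<and> posdet T A1 \<and> posdet T A2) \<longrightarrow>
            loc_poly_convex (P0 \<union> P1 \<union> P2) 0)) \<and>
      (mspec A1 \<subseteq> - \<real> \<longrightarrow>
         (\<exists>T. normal_form T A1 \<and> form_ii T A2) \<and>
         ((\<exists>T. normal_form T A1 \<and> form_ii T A2 \<and> posdet T A1 \<and> posdet T A2) \<longrightarrow>
            loc_poly_convex (P0 \<union> P1 \<union> P2) 0))) \<and>
    Omega_star \<subset> Omega \<and>
    (\<exists>(Ae :: real \<Rightarrow> (real^2^2) \<times> (real^2^2)) e0. e0 > 0 \<and>
       (\<forall>e\<in>{0<..<e0}.
          Ae e \<in> Omega - Omega_star \<and>
          loc_poly_convex (realR2 \<union> graphplane (fst (Ae e))) 0 \<and>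
          loc_poly_convex (realR2 \<union> graphplane (snd (Ae e))) 0 \<and>
          loc_poly_convex (graphplane (fst (Ae e)) \<union> graphplane (snd (Ae e))) 0 \<and>
          \<not> loc_poly_convex (realR2 \<union> graphplane (fst (Ae e)) \<union> graphplane (snd (Ae e))) 0) \<and>
       (\<forall>d>0. \<forall>\<^sub>F e in at_right 0.
          \<exists>b \<in> top_of_set Omega frontier_of Omega_star. dist (Ae e) b < d))"
proof (intro conjI impI)
  show "\<exists>T. normal_form T A1" using assms(10) by (rule normal_form_exists)
next
  assume "loc_poly_convex (P0 \<union> P1) 0 \<and> loc_poly_convex (P0 \<union> P2) 0 \<and> loc_poly_convex (P1 \<union> P2) 0"
  then have "loc_poly_convex (P0 \<union> P1) 0" "loc_poly_convex (P0 \<union> P2) 0" "loc_poly_convex (P1 \<union> P2) 0"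
    by simp_all
  note sufficient = sufficient_conditions[OF assms(1-3,6-9) this]
  {
    assume "mspec A1 \<subseteq> \<real> \<and> card (mspec A1) = 2"
    note real = sufficient(1)[THEN mp, OF this]
    show "commdet A1 A2 = 0 \<or> (\<exists>T. normal_form T A1 \<and> form_i T A2)"
      by (rule conjunct1[OF real])
    show "loc_poly_convex (P0 \<union> P1 \<union> P2) 0" if "commdet A1 A2 = 0"
      using real that by (elim conjE) (erule mp)
    show "loc_poly_convex (P0 \<union> P1 \<union> P2) 0"
      if "\<exists>T. normal_form T A1 \<and> form_i T A2 \<and> posdet T A1 \<and> posdet T A2"
      by (rule real[THEN conjunct2, THEN conjunct2, THEN mp, OF that])
  next
    assume "mspec A1 \<subseteq> - \<real>"
    note nonreal = sufficient(2)[THEN mp, OF this]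
    show "\<exists>T. normal_form T A1 \<and> form_ii T A2" by (rule conjunct1[OF nonreal])
    show "loc_poly_convex (P0 \<union> P1 \<union> P2) 0"
      if "\<exists>T. normal_form T A1 \<and> form_ii T A2 \<and> posdet T A1 \<and> posdet T A2"
      by (rule nonreal[THEN conjunct2, THEN mp, OF that])
  }
next
  have "Omega_star \<subseteq> Omega" by (auto simp: Omega_star_def)
  moreover have "example (1/32) \<in> Omega - Omega_star" by (rule example_properties(1)) simp_all
  ultimately show "Omega_star \<subset> Omega" by blast
next
  show "\<exists>(Ae :: real \<Rightarrow> (real^2^2) \<times> (real^2^2)) e0. e0 > 0 \<and>
       (\<forall>e\<in>{0<..<e0}.
          Ae e \<in> Omega - Omega_star \<and>
          loc_poly_convex (realR2 \<union> graphplane (fst (Ae e))) 0 \<and>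
          loc_poly_convex (realR2 \<union> graphplane (snd (Ae e))) 0 \<and>
          loc_poly_convex (graphplane (fst (Ae e)) \<union> graphplane (snd (Ae e))) 0 \<and>
          \<not> loc_poly_convex (realR2 \<union> graphplane (fst (Ae e)) \<union> graphplane (snd (Ae e))) 0) \<and>
       (\<forall>d>0. \<forall>\<^sub>F e in at_right 0.
          \<exists>b \<in> top_of_set Omega frontier_of Omega_star. dist (Ae e) b < d)"
    by (intro exI[of _ example] exI[of _ "1/16"])
       (simp add: example_properties [simplified] example_tends_to_frontier)
qed

end
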